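(* Let $\mathcal{J}\subset[0,\pi/2]$ be the set of Kähler angles of totally geodesic submanifolds in non-flat irreducible Hermitian symmetric spaces. Then $\mathcal{J}$ contains a dense subset of $[0,\pi/2]$.
   Context: Let $V$ be a real subspace of a complex vector space with complex structure $J$ and $J$-invariant (real) inner product $\langle\cdot,\cdot\rangle$, and let $\pi_V$ be the orthogonal projection onto $V$. The Kähler angle of a nonzero $v\in V$ with respect to $V$ is the $\varphi\in[0,\pi/2]$ such that $\langle\pi_VJv,\pi_VJv\rangle=\cos^2(\varphi)\langle v,v\rangle$. The subspace $V$ has constant Kähler angle $\varphi$ if every nonzero $v\in V$ has Kähler angle $\varphi$. A submanifold $\Sigma$ (of positive dimension) of a Kähler manifold $M$ has constant Kähler angle $\varphi$ if for every $p\in\Sigma$ the subspace $T_p\Sigma\subset T_pM$ has constant Kähler angle $\varphi$. The set $\mathcal{J}$ consists of all $\varphi\in[0,\pi/2]$ such that some (connected, complete) totally geodesic submanifold of some non-flat irreducible Hermitian symmetric space (of any rank) has constant Kähler angle $\varphi$. *)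

theory Defs
  imports "HOL-Analysis.Analysis"
begin

text \<open>
  Since dimensions have to be quantified inside a formula, R^n is the library's
  \<^const>\<open>Euclidean_space\<close> \<open>n\<close>, the topological space of all real sequences vanishing from
  index \<open>n\<close> on, and the differential geometry is done classically, with coordinate expressions in
  charts.
\<close>

type_synonym vec = "nat \<Rightarrow> real"

abbreviation Rn :: "nat \<Rightarrow> vec set" where
  "Rn n \<equiv> topspace (Euclidean_space n)"

definition lin_subspace :: "nat \<Rightarrow> vec set \<Rightarrow> bool" where
  "lin_subspace n W \<longleftrightarrow> W \<subseteq> Rn n \<and> (\<lambda>i. 0) \<in> W \<and>
     (\<forall>u\<in>W. \<forall>v\<in>W. \<forall>a b. (\<lambda>i. a * u i + b * v i) \<in> W)"

definition bilin :: "nat \<Rightarrow> (nat \<Rightarrow> nat \<Rightarrow> real) \<Rightarrow> vec \<Rightarrow> vec \<Rightarrow> real" where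
  "bilin n g v w = (\<Sum>i<n. \<Sum>j<n. g i j * v i * w j)"

text \<open>R^(2m) is identified with C^m by \<open>z_j = x_(2j) + i x_(2j+1)\<close>; this is multiplication by i.\<close>

definition Jstd :: "vec \<Rightarrow> vec" where
  "Jstd v = (\<lambda>i. if even i then - v (i + 1) else v (i - 1))"


section \<open>Kaehler angles of real subspaces\<close>

definition orth_proj :: "(vec \<Rightarrow> vec \<Rightarrow> real) \<Rightarrow> vec set \<Rightarrow> vec \<Rightarrow> vec" where
  "orth_proj ip V w = (THE u. u \<in> V \<and> (\<forall>v\<in>V. ip (\<lambda>i. w i - u i) v = 0))"

definition has_kaehler_angle ::
    "(vec \<Rightarrow> vec \<Rightarrow> real) \<Rightarrow> (vec \<Rightarrow> vec) \<Rightarrow> vec set \<Rightarrow> vec \<Rightarrow> real \<Rightarrow> bool" where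
  "has_kaehler_angle ip J V v \<phi> \<longleftrightarrow> 0 \<le> \<phi> \<and> \<phi> \<le> pi / 2 \<and>
     ip (orth_proj ip V (J v)) (orth_proj ip V (J v)) = (cos \<phi>)\<^sup>2 * ip v v"

definition constant_kaehler_angle ::
    "(vec \<Rightarrow> vec \<Rightarrow> real) \<Rightarrow> (vec \<Rightarrow> vec) \<Rightarrow> vec set \<Rightarrow> real \<Rightarrow> bool" where
  "constant_kaehler_angle ip J V \<phi> \<longleftrightarrow>
     (\<forall>v\<in>V. v \<noteq> (\<lambda>i. 0) \<longrightarrow> has_kaehler_angle ip J V v \<phi>)"


section \<open>Calculus in coordinates\<close>

definition pd :: "nat \<Rightarrow> (vec \<Rightarrow> real) \<Rightarrow> vec \<Rightarrow> real" where
  "pd i f x = deriv (\<lambda>t. f (x(i := t))) (x i)"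

text \<open>\<open>Ck n U k f\<close>: \<open>f\<close> is of class \<open>C^k\<close> on the open subset \<open>U\<close> of R^n.\<close>

primrec Ck :: "nat \<Rightarrow> vec set \<Rightarrow> nat \<Rightarrow> (vec \<Rightarrow> real) \<Rightarrow> bool" where
  "Ck n U 0 f \<longleftrightarrow> continuous_map (subtopology (Euclidean_space n) U) euclideanreal f"
| "Ck n U (Suc k) f \<longleftrightarrow> continuous_map (subtopology (Euclidean_space n) U) euclideanreal f \<and>
     (\<forall>i<n. (\<forall>x\<in>U. (\<lambda>t. f (x(i := t))) field_differentiable at (x i)) \<and> Ck n U k (pd i f))"

definition smooth_fun :: "nat \<Rightarrow> vec set \<Rightarrow> (vec \<Rightarrow> real) \<Rightarrow> bool" where
  "smooth_fun n U f \<longleftrightarrow> (\<forall>k. Ck n U k f)"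

definition differential :: "nat \<Rightarrow> (vec \<Rightarrow> vec) \<Rightarrow> vec \<Rightarrow> vec \<Rightarrow> vec" where
  "differential n f x v = (\<lambda>i. \<Sum>j<n. pd j (\<lambda>y. f y i) x * v j)"


section \<open>Smooth manifolds with a metric tensor\<close>

text \<open>A chart is a pair of its domain and its coordinate map.\<close>

type_synonym 'p chart = "'p set \<times> ('p \<Rightarrow> vec)"

text \<open>\<open>metric M c x i j\<close> is the component \<open>g_ij\<close>, in the chart \<open>c\<close>, of the metric tensor at the point
  with coordinates \<open>x\<close>.\<close>

record 'p mfd =
  dimen :: nat
  space_of :: "'p topology"
  atlas :: "'p chart set"
  metric :: "'p chart \<Rightarrow> vec \<Rightarrow> nat \<Rightarrow> nat \<Rightarrow> real"

text \<open>The coordinate expression of a map \<open>F\<close> with respect to charts \<open>c\<close> and \<open>d\<close>. For the identity map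
  this is the change of coordinates.\<close>

definition rep :: "'p chart \<Rightarrow> 'q chart \<Rightarrow> ('p \<Rightarrow> 'q) \<Rightarrow> vec \<Rightarrow> vec" where
  "rep c d F = (\<lambda>x. snd d (F (inv_into (fst c) (snd c) x)))"

definition is_chart :: "'p mfd \<Rightarrow> 'p chart \<Rightarrow> bool" where
  "is_chart M c \<longleftrightarrow> openin (space_of M) (fst c) \<and>
     openin (Euclidean_space (dimen M)) (snd c ` fst c) \<and>
     homeomorphic_map (subtopology (space_of M) (fst c))
       (subtopology (Euclidean_space (dimen M)) (snd c ` fst c)) (snd c)"

definition smooth_reps :: "'p mfd \<Rightarrow> 'q mfd \<Rightarrow> ('p \<Rightarrow> 'q) \<Rightarrow> bool" where
  "smooth_reps M N F \<longleftrightarrow> (\<forall>c\<in>atlas M. \<forall>d\<in>atlas N. \<forall>i.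
     smooth_fun (dimen M) (snd c ` {p \<in> fst c. F p \<in> fst d}) (\<lambda>x. rep c d F x i))"

definition smooth_manifold :: "'p mfd \<Rightarrow> bool" where
  "smooth_manifold M \<longleftrightarrow> Hausdorff_space (space_of M) \<and> second_countable (space_of M) \<and>
     (\<forall>c\<in>atlas M. is_chart M c) \<and> (\<Union>c\<in>atlas M. fst c) = topspace (space_of M) \<and>
     smooth_reps M M (\<lambda>p. p)"

definition smooth_map :: "'p mfd \<Rightarrow> 'q mfd \<Rightarrow> ('p \<Rightarrow> 'q) \<Rightarrow> bool" where
  "smooth_map M N F \<longleftrightarrow> continuous_map (space_of M) (space_of N) F \<and> smooth_reps M N F"

definition inner_at :: "'p mfd \<Rightarrow> 'p chart \<Rightarrow> vec \<Rightarrow> vec \<Rightarrow> vec \<Rightarrow> real" where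
  "inner_at M c x = bilin (dimen M) (metric M c x)"

definition preserves_metric :: "'p mfd \<Rightarrow> 'q mfd \<Rightarrow> ('p \<Rightarrow> 'q) \<Rightarrow> bool" where
  "preserves_metric M N F \<longleftrightarrow>
     (\<forall>c\<in>atlas M. \<forall>d\<in>atlas N. \<forall>p\<in>fst c. F p \<in> fst d \<longrightarrow>
       (\<forall>v\<in>Rn (dimen M). \<forall>w\<in>Rn (dimen M).
          inner_at N d (snd d (F p))
            (differential (dimen M) (rep c d F) (snd c p) v)
            (differential (dimen M) (rep c d F) (snd c p) w)
          = inner_at M c (snd c p) v w))"

text \<open>Applied to the identity map, the last clause is the transformation law of the metric tensor
  under changes of coordinates.\<close>

definition riemannian_manifold :: "'p mfd \<Rightarrow> bool" where
  "riemannian_manifold M \<longleftrightarrow> smooth_manifold M \<and>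
     (\<forall>c\<in>atlas M.
        (\<forall>i<dimen M. \<forall>j<dimen M. smooth_fun (dimen M) (snd c ` fst c) (\<lambda>x. metric M c x i j)) \<and>
        (\<forall>x\<in>snd c ` fst c.
           (\<forall>i<dimen M. \<forall>j<dimen M. metric M c x i j = metric M c x j i) \<and>
           (\<forall>v\<in>Rn (dimen M). v \<noteq> (\<lambda>i. 0) \<longrightarrow> inner_at M c x v v > 0))) \<and>
     preserves_metric M M (\<lambda>p. p)"


section \<open>The Levi-Civita connection\<close>

definition inv_metric :: "nat \<Rightarrow> (nat \<Rightarrow> nat \<Rightarrow> real) \<Rightarrow> nat \<Rightarrow> nat \<Rightarrow> real" where
  "inv_metric n g = (THE h. (\<forall>i j. i \<ge> n \<or> j \<ge> n \<longrightarrow> h i j = 0) \<and>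
     (\<forall>i<n. \<forall>j<n. (\<Sum>k<n. h i k * g k j) = (if i = j then 1 else 0)))"

definition christoffel :: "'p mfd \<Rightarrow> 'p chart \<Rightarrow> nat \<Rightarrow> nat \<Rightarrow> nat \<Rightarrow> vec \<Rightarrow> real" where
  "christoffel M c k i j x =
     (\<Sum>l<dimen M. inv_metric (dimen M) (metric M c x) k l *
        (pd i (\<lambda>y. metric M c y j l) x + pd j (\<lambda>y. metric M c y i l) x
         - pd l (\<lambda>y. metric M c y i j) x)) / 2"

text \<open>The component along \<open>e_l\<close> of \<open>R(e_i, e_j) e_k\<close>.\<close>

definition curvature :: "'p mfd \<Rightarrow> 'p chart \<Rightarrow> nat \<Rightarrow> nat \<Rightarrow> nat \<Rightarrow> nat \<Rightarrow> vec \<Rightarrow> real" where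
  "curvature M c l k i j x =
     pd i (christoffel M c l j k) x - pd j (christoffel M c l i k) x +
     (\<Sum>m<dimen M. christoffel M c l i m x * christoffel M c m j k x
                  - christoffel M c l j m x * christoffel M c m i k x)"

definition flat :: "'p mfd \<Rightarrow> bool" where
  "flat M \<longleftrightarrow> (\<forall>c\<in>atlas M. \<forall>x\<in>snd c ` fst c.
     \<forall>l<dimen M. \<forall>k<dimen M. \<forall>i<dimen M. \<forall>j<dimen M. curvature M c l k i j x = 0)"

definition velocity :: "'p chart \<Rightarrow> (real \<Rightarrow> 'p) \<Rightarrow> real \<Rightarrow> vec" where
  "velocity c \<gamma> t = (\<lambda>i. deriv (\<lambda>s. snd c (\<gamma> s) i) t)"

definition geodesic :: "'p mfd \<Rightarrow> real set \<Rightarrow> (real \<Rightarrow> 'p) \<Rightarrow> bool" where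
  "geodesic M I \<gamma> \<longleftrightarrow> open I \<and> is_interval I \<and>
     continuous_map (top_of_set I) (space_of M) \<gamma> \<and>
     (\<forall>c\<in>atlas M. \<forall>t\<in>I. \<gamma> t \<in> fst c \<longrightarrow>
       (\<forall>k<dimen M.
          (\<lambda>s. snd c (\<gamma> s) k) field_differentiable at t \<and>
          ((\<lambda>s. velocity c \<gamma> s k) has_real_derivative
             - (\<Sum>i<dimen M. \<Sum>j<dimen M. christoffel M c k i j (snd c (\<gamma> t)) *
                  velocity c \<gamma> t i * velocity c \<gamma> t j)) (at t)))"

definition geodesically_complete :: "'p mfd \<Rightarrow> bool" where
  "geodesically_complete M \<longleftrightarrow>
     (\<forall>c\<in>atlas M. \<forall>p\<in>fst c. \<forall>v\<in>Rn (dimen M).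
        \<exists>\<gamma>. geodesic M UNIV \<gamma> \<and> \<gamma> 0 = p \<and> velocity c \<gamma> 0 = v)"

text \<open>
  \<open>transport M c x v d y w\<close>: some piecewise \<open>C^1\<close> path from the point with coordinates \<open>x\<close> in the chart
  \<open>c\<close> to the point with coordinates \<open>y\<close> in the chart \<open>d\<close> has a parallel field leading from the tangent
  vector with components \<open>v\<close> in \<open>c\<close> to the one with components \<open>w\<close> in \<open>d\<close>. A path is cut into
  pieces each of which runs inside one chart.
\<close>

inductive transport ::
    "'p mfd \<Rightarrow> 'p chart \<Rightarrow> vec \<Rightarrow> vec \<Rightarrow> 'p chart \<Rightarrow> vec \<Rightarrow> vec \<Rightarrow> bool"
  for M :: "'p mfd" where
  along_curve:
    "\<lbrakk> c \<in> atlas M; a < b;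
       \<And>t. t \<in> {a..b} \<Longrightarrow> x t \<in> snd c ` fst c;
       \<And>t i. t \<in> {a..b} \<Longrightarrow> ((\<lambda>s. x s i) has_real_derivative x' t i) (at t within {a..b});
       \<And>i. continuous_on {a..b} (\<lambda>t. x' t i);
       \<And>t. t \<in> {a..b} \<Longrightarrow> Y t \<in> Rn (dimen M);
       \<And>t k. t \<in> {a..b} \<Longrightarrow> k < dimen M \<Longrightarrow>
         ((\<lambda>s. Y s k) has_real_derivative
            - (\<Sum>i<dimen M. \<Sum>j<dimen M. christoffel M c k i j (x t) * x' t i * Y t j))
         (at t within {a..b}) \<rbrakk>
     \<Longrightarrow> transport M c (x a) (Y a) c (x b) (Y b)"
| change_chart:
    "\<lbrakk> c \<in> atlas M; d \<in> atlas M; p \<in> fst c; p \<in> fst d; v \<in> Rn (dimen M) \<rbrakk>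
     \<Longrightarrow> transport M c (snd c p) v d (snd d p)
           (differential (dimen M) (rep c d (\<lambda>q. q)) (snd c p) v)"
| concat:
    "\<lbrakk> transport M c x u d y v; transport M d y v e z w \<rbrakk> \<Longrightarrow> transport M c x u e z w"

text \<open>Irreducibility of the holonomy representation on every tangent space.\<close>

definition irreducible_manifold :: "'p mfd \<Rightarrow> bool" where
  "irreducible_manifold M \<longleftrightarrow> dimen M > 0 \<and>
     (\<forall>c\<in>atlas M. \<forall>x\<in>snd c ` fst c. \<forall>W. lin_subspace (dimen M) W \<and>
        (\<forall>v\<in>W. \<forall>w. transport M c x v c x w \<longrightarrow> w \<in> W) \<longrightarrow>
        W = {\<lambda>i. 0} \<or> W = Rn (dimen M))"


section \<open>Hermitian symmetric spaces\<close>

text \<open>In the charts of a complex manifold the complex structure is \<^const>\<open>Jstd\<close>, so holomorphy of a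
  smooth map is complex linearity of the differentials of its coordinate expressions (the
  Cauchy-Riemann equations).\<close>

definition holomorphic_reps :: "'p mfd \<Rightarrow> 'q mfd \<Rightarrow> ('p \<Rightarrow> 'q) \<Rightarrow> bool" where
  "holomorphic_reps M N F \<longleftrightarrow>
     (\<forall>c\<in>atlas M. \<forall>d\<in>atlas N. \<forall>p\<in>fst c. F p \<in> fst d \<longrightarrow>
       (\<forall>v\<in>Rn (dimen M).
          differential (dimen M) (rep c d F) (snd c p) (Jstd v)
          = Jstd (differential (dimen M) (rep c d F) (snd c p) v)))"

definition hermitian_manifold :: "'p mfd \<Rightarrow> bool" where
  "hermitian_manifold M \<longleftrightarrow> riemannian_manifold M \<and> even (dimen M) \<and>
     holomorphic_reps M M (\<lambda>p. p) \<and>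
     (\<forall>c\<in>atlas M. \<forall>x\<in>snd c ` fst c. \<forall>v\<in>Rn (dimen M). \<forall>w\<in>Rn (dimen M).
        inner_at M c x (Jstd v) (Jstd w) = inner_at M c x v w)"

text \<open>Every point is an isolated fixed point of an involutive holomorphic isometry. This forces the
  metric to be Kaehler, because the covariant derivative of the complex structure is a tensor
  of odd order and hence vanishes.\<close>

definition hermitian_symmetric_space :: "'p mfd \<Rightarrow> bool" where
  "hermitian_symmetric_space M \<longleftrightarrow> hermitian_manifold M \<and> connected_space (space_of M) \<and>
     (\<forall>p\<in>topspace (space_of M). \<exists>s.
        smooth_map M M s \<and> preserves_metric M M s \<and> holomorphic_reps M M s \<and>
        (\<forall>q\<in>topspace (space_of M). s (s q) = q) \<and>
        s p = p \<and> (\<exists>U. openin (space_of M) U \<and> p \<in> U \<and> (\<forall>q\<in>U. s q = q \<longrightarrow> q = p)))"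


section \<open>Totally geodesic submanifolds\<close>

text \<open>A submanifold is an injectively immersed one: its points are points of \<open>M\<close>, its topology may be
  finer than the subspace topology, and it carries the induced metric. The inclusion is an immersion
  because the metric of \<open>S\<close> is positive definite.\<close>

definition riemannian_submanifold :: "'p mfd \<Rightarrow> 'p mfd \<Rightarrow> bool" where
  "riemannian_submanifold S M \<longleftrightarrow> riemannian_manifold S \<and> dimen S > 0 \<and>
     topspace (space_of S) \<noteq> {} \<and>
     smooth_map S M (\<lambda>p. p) \<and> preserves_metric S M (\<lambda>p. p)"

definition totally_geodesic :: "'p mfd \<Rightarrow> 'p mfd \<Rightarrow> bool" where
  "totally_geodesic S M \<longleftrightarrow> riemannian_submanifold S M \<and>
     (\<forall>I \<gamma>. geodesic S I \<gamma> \<longrightarrow> geodesic M I \<gamma>)"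

text \<open>The tangent space, in the chart \<open>c\<close> of the ambient manifold, of \<open>S\<close> at a point \<open>p\<close> in the
  domains of \<open>c\<close> and of the chart \<open>b\<close> of \<open>S\<close>.\<close>

definition tangent_subspace :: "'p mfd \<Rightarrow> 'p chart \<Rightarrow> 'p chart \<Rightarrow> 'p \<Rightarrow> vec set" where
  "tangent_subspace S b c p =
     differential (dimen S) (rep b c (\<lambda>q. q)) (snd b p) ` Rn (dimen S)"

definition submanifold_constant_kaehler_angle :: "'p mfd \<Rightarrow> 'p mfd \<Rightarrow> real \<Rightarrow> bool" where
  "submanifold_constant_kaehler_angle S M \<phi> \<longleftrightarrow>
     (\<forall>p\<in>topspace (space_of S). \<forall>b\<in>atlas S. \<forall>c\<in>atlas M. p \<in> fst b \<longrightarrow> p \<in> fst c \<longrightarrow>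
        constant_kaehler_angle (inner_at M c (snd c p)) Jstd (tangent_subspace S b c p) \<phi>)"

text \<open>A connected manifold has at most the cardinality of the continuum, so it is no restriction to
  take the points of all manifolds from one fixed type of that cardinality.\<close>

definition kaehler_angles :: "real set" where
  "kaehler_angles = {\<phi>. 0 \<le> \<phi> \<and> \<phi> \<le> pi / 2 \<and>
     (\<exists>(M :: (nat \<Rightarrow> real) mfd) S.
        hermitian_symmetric_space M \<and> irreducible_manifold M \<and> \<not> flat M \<and>
        totally_geodesic S M \<and> connected_space (space_of S) \<and> geodesically_complete S \<and>
        submanifold_constant_kaehler_angle S M \<phi>)}"

end

theory Submission
  imports Defs "Jordan_Normal_Form.Determinant" "HOL-Library.Function_Algebras"
begin

text \<open>
  The tube domain \<open>Z = X + i Y\<close>, \<open>Y > 0\<close>, over the Hermitian \<open>n \<times> n\<close> matrices carries the invariant Kaehler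
  metric \<open>Re tr (Y\<^sup>-\<^sup>1 dZ Y\<^sup>-\<^sup>1 dZ\<^sup>*)\<close> and is an irreducible Hermitian symmetric space of rank \<open>n\<close>. It contains
  the polydisc of diagonal matrices, a product of \<open>n\<close> half planes, and in it the totally geodesic half plane
  of all \<open>diag (z, \<dots>, z, - cnj z, \<dots>, - cnj z)\<close> with \<open>m\<close> holomorphic and \<open>n - m\<close> antiholomorphic entries. On
  its tangent spaces the projection of \<open>J\<close> is \<open>\<plusminus> (m - (n - m)) / n\<close> times a rotation by a right angle, so
  the Kaehler angle is \<open>arccos (\<bar>2 m - n\<bar> / n)\<close>, and these angles are dense.

  The Christoffel form is \<open>\<Gamma>(A, B) = (i / 2) (A Y\<^sup>-\<^sup>1 B + B Y\<^sup>-\<^sup>1 A)\<close>. Transport along horizontal and vertical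
  segments is therefore explicit; horizontal translation at two different heights gives loops with holonomy
  \<open>V \<mapsto> exp (i t A Y\<^sup>-\<^sup>1) V exp (i t Y\<^sup>-\<^sup>1 A)\<close>, and an invariant subspace is turned by \<open>V \<mapsto> V Y\<^sup>-\<^sup>1\<close> into a
  nonzero ideal of the simple Jordan algebra of all matrices.
\<close>

section \<open>Smooth functions on open subsets of coordinate space\<close>

text \<open>In this family an angle strictly between 0 and pi/2 requires both kinds of entries, in
  unequal numbers, and density requires n to be unbounded. All n entries move in isometric half
  planes, so projecting J to the tangent plane averages the signs +1 and -1. With n = 2 b and m = a
  + b the average is a / b: every rational in [0, 1] is a cosine, and continuity of arccos does the
  rest. The tube model is convenient because one global chart suffices and the metric, the
  connection and the symmetries become matrix expressions in it. The main obstacle is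
  irreducibility, which speaks of parallel transport. For general A the exponential of A H, with H
  the inverse of Y, is unwieldy. For a Hermitian A of rank one A H A is a multiple mu A of A, so the
  exponential is 1 + c A H and transport is a polynomial of degree two in c. Two values of c
  together with the identity isolate the linear term A H V + V H A, and Hermitian matrices of rank
  one span all complex matrices. The choice A = Y yields scalar phases, so invariant real subspaces
  are complex.\<close>

lemma Euclidean_space_eq: "Euclidean_space n = top_of_set {x. \<forall>i\<ge>n. x i = 0}"
  by (simp add: Euclidean_space_def euclidean_product_topology)

lemma mem_Rn: "x \<in> Rn n \<longleftrightarrow> (\<forall>i\<ge>n. x i = 0)"
  by (simp add: topspace_Euclidean_space)

lemma openin_Rn_subset: "openin (Euclidean_space n) U \<Longrightarrow> U \<subseteq> Rn n"
  by (rule openin_subset)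

lemma subtopology_Rn: "U \<subseteq> Rn n \<Longrightarrow> subtopology (Euclidean_space n) U = top_of_set U"
  unfolding Euclidean_space_eq topspace_euclidean_subtopology subtopology_subtopology by (simp add: Int_absorb1)

text \<open>Derivatives are quantified existentially, so that they need to be known on \<open>U\<close> only.\<close>

primrec gCk :: "nat \<Rightarrow> (nat \<Rightarrow> real) set \<Rightarrow> nat \<Rightarrow> ((nat \<Rightarrow> real) \<Rightarrow> 'a::real_normed_vector) \<Rightarrow> bool" where
  "gCk n U 0 f \<longleftrightarrow> continuous_on U f"
| "gCk n U (Suc k) f \<longleftrightarrow> continuous_on U f \<and>
     (\<forall>i<n. \<exists>D. (\<forall>x\<in>U. ((\<lambda>t. f (x(i := t))) has_vector_derivative D x) (at (x i))) \<and> gCk n U k D)"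

definition gsmooth :: "nat \<Rightarrow> (nat \<Rightarrow> real) set \<Rightarrow> ((nat \<Rightarrow> real) \<Rightarrow> 'a::real_normed_vector) \<Rightarrow> bool" where
  "gsmooth n U f \<longleftrightarrow> (\<forall>k. gCk n U k f)"

lemma gCk_cont: "gCk n U k f \<Longrightarrow> continuous_on U f"
  by (cases k) auto

lemma gCk_SucE:
  assumes "gCk n U (Suc k) f" "i < n"
  obtains D where "\<And>x. x \<in> U \<Longrightarrow> ((\<lambda>t. f (x(i := t))) has_vector_derivative D x) (at (x i))" "gCk n U k D"
proof -
  have "\<exists>D. (\<forall>x\<in>U. ((\<lambda>t. f (x(i := t))) has_vector_derivative D x) (at (x i))) \<and> gCk n U k D"
    using assms unfolding gCk.simps by blast
  then show thesis using that by blast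
qed

lemma gCk_SucI:
  assumes "continuous_on U f"
    and "\<And>i. i < n \<Longrightarrow> \<exists>D. (\<forall>x\<in>U. ((\<lambda>t. f (x(i := t))) has_vector_derivative D x) (at (x i))) \<and> gCk n U k D"
  shows "gCk n U (Suc k) f"
  using assms by simp

lemma gCk_Suc_imp: "gCk n U (Suc k) f \<Longrightarrow> gCk n U k f"
proof (induction k arbitrary: f)
  case 0
  then show ?case by simp
next
  case (Suc k)
  show ?case
    unfolding gCk.simps(2)[of n U k]
  proof (intro conjI allI impI)
    show "continuous_on U f" using Suc.prems by (rule gCk_cont)
    fix i assume "i < n"
    then obtain D where "\<And>x. x \<in> U \<Longrightarrow> ((\<lambda>t. f (x(i := t))) has_vector_derivative D x) (at (x i))" "gCk n U (Suc k) D"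
      using gCk_SucE[OF Suc.prems] by blast
    then show "\<exists>D. (\<forall>x\<in>U. ((\<lambda>t. f (x(i := t))) has_vector_derivative D x) (at (x i))) \<and> gCk n U k D"
      using Suc.IH by blast
  qed
qed

lemma gCk_const: "gCk n U k (\<lambda>x. c)"
proof (induction k arbitrary: c)
  case (Suc k)
  have "\<exists>D. (\<forall>x\<in>U. ((\<lambda>t. c) has_vector_derivative D x) (at (x i))) \<and> gCk n U k D" for i
    by (rule exI[of _ "\<lambda>x. 0"]) (simp add: Suc.IH)
  then show ?case by simp
qed simp

lemma gCk_coord: "gCk n U k (\<lambda>x. x j)"
proof (cases k)
  case 0
  have "continuous_on U (\<lambda>x::nat\<Rightarrow>real. x j)"
    by (rule continuous_on_subset[OF continuous_on_product_coordinates]) simp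
  then show ?thesis using 0 by simp
next
  case (Suc k')
  have "continuous_on U (\<lambda>x::nat\<Rightarrow>real. x j)"
    by (rule continuous_on_subset[OF continuous_on_product_coordinates]) simp
  moreover have "\<exists>D. (\<forall>x\<in>U. ((\<lambda>t. (x(i := t)) j) has_vector_derivative D x) (at (x i))) \<and> gCk n U k' D" for i
    by (rule exI[of _ "\<lambda>x. if i = j then 1 else 0"]) (auto simp: gCk_const)
  ultimately show ?thesis using Suc by simp
qed

lemma gCk_add: "gCk n U k f \<Longrightarrow> gCk n U k g \<Longrightarrow> gCk n U k (\<lambda>x. f x + g x)"
proof (induction k arbitrary: f g)
  case 0
  then show ?case by (simp add: continuous_on_add)
next
  case (Suc k)
  have "\<exists>D. (\<forall>x\<in>U. ((\<lambda>t. f (x(i := t)) + g (x(i := t))) has_vector_derivative D x) (at (x i))) \<and> gCk n U k D"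
    if i: "i < n" for i
  proof -
    obtain D where D: "\<And>x. x \<in> U \<Longrightarrow> ((\<lambda>t. f (x(i := t))) has_vector_derivative D x) (at (x i))" "gCk n U k D"
      using gCk_SucE[OF Suc.prems(1) i] by blast
    obtain E where E: "\<And>x. x \<in> U \<Longrightarrow> ((\<lambda>t. g (x(i := t))) has_vector_derivative E x) (at (x i))" "gCk n U k E"
      using gCk_SucE[OF Suc.prems(2) i] by blast
    show ?thesis
      by (intro exI[of _ "\<lambda>x. D x + E x"] conjI ballI has_vector_derivative_add D E Suc.IH)
  qed
  then show ?case using gCk_cont[OF Suc.prems(1)] gCk_cont[OF Suc.prems(2)] by (intro gCk_SucI continuous_on_add)
qed

lemma gCk_linear:
  assumes h: "bounded_linear h"
  shows "gCk n U k f \<Longrightarrow> gCk n U k (\<lambda>x. h (f x))"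
proof (induction k arbitrary: f)
  case 0
  then show ?case using bounded_linear.continuous_on[OF h] by simp
next
  case (Suc k)
  have "\<exists>D. (\<forall>x\<in>U. ((\<lambda>t. h (f (x(i := t)))) has_vector_derivative D x) (at (x i))) \<and> gCk n U k D"
    if i: "i < n" for i
  proof -
    obtain D where D: "\<And>x. x \<in> U \<Longrightarrow> ((\<lambda>t. f (x(i := t))) has_vector_derivative D x) (at (x i))" "gCk n U k D"
      using gCk_SucE[OF Suc.prems(1) i] by blast
    show ?thesis
      by (intro exI[of _ "\<lambda>x. h (D x)"] conjI ballI bounded_linear.has_vector_derivative[OF h] D Suc.IH)
  qed
  then show ?case by (intro gCk_SucI bounded_linear.continuous_on[OF h] gCk_cont[OF Suc.prems(1)])
qed

lemma gCk_mult:
  fixes f g :: "(nat \<Rightarrow> real) \<Rightarrow> 'a::real_normed_algebra"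
  shows "gCk n U k f \<Longrightarrow> gCk n U k g \<Longrightarrow> gCk n U k (\<lambda>x. f x * g x)"
proof (induction k arbitrary: f g)
  case 0
  then show ?case by (simp add: continuous_on_mult)
next
  case (Suc k)
  have "\<exists>D. (\<forall>x\<in>U. ((\<lambda>t. f (x(i := t)) * g (x(i := t))) has_vector_derivative D x) (at (x i))) \<and> gCk n U k D"
    if i: "i < n" for i
  proof -
    obtain D where D: "\<And>x. x \<in> U \<Longrightarrow> ((\<lambda>t. f (x(i := t))) has_vector_derivative D x) (at (x i))" "gCk n U k D"
      using gCk_SucE[OF Suc.prems(1) i] by blast
    obtain E where E: "\<And>x. x \<in> U \<Longrightarrow> ((\<lambda>t. g (x(i := t))) has_vector_derivative E x) (at (x i))" "gCk n U k E"
      using gCk_SucE[OF Suc.prems(2) i] by blast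
    have "((\<lambda>t. f (x(i := t)) * g (x(i := t))) has_vector_derivative f x * E x + D x * g x) (at (x i))" if "x \<in> U" for x
      using has_vector_derivative_mult[OF D(1)[OF that] E(1)[OF that]] by simp
    moreover have "gCk n U k (\<lambda>x. f x * E x + D x * g x)"
      by (intro gCk_add Suc.IH D E gCk_Suc_imp[OF Suc.prems(1)] gCk_Suc_imp[OF Suc.prems(2)])
    ultimately show ?thesis by (intro exI[of _ "\<lambda>x. f x * E x + D x * g x"] conjI ballI)
  qed
  then show ?case using gCk_cont[OF Suc.prems(1)] gCk_cont[OF Suc.prems(2)] by (intro gCk_SucI continuous_on_mult)
qed

lemma gsmooth_const [intro]: "gsmooth n U (\<lambda>x. c)"
  and gsmooth_coord [intro]: "gsmooth n U (\<lambda>x. x j)"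
  by (simp_all add: gsmooth_def gCk_const gCk_coord)

lemma gsmooth_add: "gsmooth n U f \<Longrightarrow> gsmooth n U g \<Longrightarrow> gsmooth n U (\<lambda>x. f x + g x)"
  by (simp add: gsmooth_def gCk_add)

lemma gsmooth_linear: "bounded_linear h \<Longrightarrow> gsmooth n U f \<Longrightarrow> gsmooth n U (\<lambda>x. h (f x))"
  by (simp add: gsmooth_def gCk_linear)

lemma gsmooth_mult:
  fixes f g :: "(nat \<Rightarrow> real) \<Rightarrow> 'a::real_normed_algebra"
  shows "gsmooth n U f \<Longrightarrow> gsmooth n U g \<Longrightarrow> gsmooth n U (\<lambda>x. f x * g x)"
  by (simp add: gsmooth_def gCk_mult)

lemma gsmooth_minus: "gsmooth n U f \<Longrightarrow> gsmooth n U (\<lambda>x. - f x)"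
  by (rule gsmooth_linear[OF bounded_linear_minus[OF bounded_linear_ident]])

lemma gsmooth_diff: "gsmooth n U f \<Longrightarrow> gsmooth n U g \<Longrightarrow> gsmooth n U (\<lambda>x. f x - g x)"
  using gsmooth_add[of n U f "\<lambda>x. - g x"] by (simp add: gsmooth_minus)

lemma gCk_sum:
  "(\<And>i. i \<in> I \<Longrightarrow> gCk n U k (f i)) \<Longrightarrow> gCk n U k (\<lambda>x. \<Sum>i\<in>I. f i x)"
proof (induction I rule: infinite_finite_induct)
  case (insert i I)
  then show ?case by (simp add: gCk_add)
qed (simp_all add: gCk_const)

lemma gsmooth_sum:
  "(\<And>i. i \<in> I \<Longrightarrow> gsmooth n U (f i)) \<Longrightarrow> gsmooth n U (\<lambda>x. \<Sum>i\<in>I. f i x)"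
  by (simp add: gsmooth_def gCk_sum)

text \<open>The derivative of 1/f is minus the product of 1/f, a partial derivative of f and 1/f
  again. All factors are of class C^k by induction, so 1/f gains one order.\<close>

lemma gCk_inverse:
  fixes f :: "(nat \<Rightarrow> real) \<Rightarrow> real"
  assumes nz: "\<And>x. x \<in> U \<Longrightarrow> f x \<noteq> 0"
  shows "gCk n U k f \<Longrightarrow> gCk n U k (\<lambda>x. inverse (f x))"
proof (induction k)
  case 0
  then show ?case using nz by (simp add: continuous_on_inverse)
next
  case (Suc k)
  show ?case
  proof (rule gCk_SucI)
    show "continuous_on U (\<lambda>x. inverse (f x))"
      using gCk_cont[OF Suc.prems] nz by (intro continuous_on_inverse) auto
    fix i assume i: "i < n"
    obtain D where D: "\<And>x. x \<in> U \<Longrightarrow> ((\<lambda>t. f (x(i := t))) has_vector_derivative D x) (at (x i))" "gCk n U k D"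
      using gCk_SucE[OF Suc.prems i] by blast
    have I: "gCk n U k (\<lambda>x. inverse (f x))" by (rule Suc.IH[OF gCk_Suc_imp[OF Suc.prems]])
    have "((\<lambda>t. inverse (f (x(i := t)))) has_vector_derivative - (inverse (f x) * D x * inverse (f x))) (at (x i))" if "x \<in> U" for x
      using DERIV_inverse'[of "\<lambda>t. f (x(i := t))" "D x" "x i" UNIV] D(1)[OF that] nz[OF that]
      by (simp add: has_real_derivative_iff_has_vector_derivative)
    moreover have "gCk n U k (\<lambda>x. - (inverse (f x) * D x * inverse (f x)))"
      by (intro gCk_linear[OF bounded_linear_minus[OF bounded_linear_ident]] gCk_mult I D(2))
    ultimately show "\<exists>D. (\<forall>x\<in>U. ((\<lambda>t. inverse (f (x(i := t)))) has_vector_derivative D x) (at (x i))) \<and> gCk n U k D"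
      by (intro exI[of _ "\<lambda>x. - (inverse (f x) * D x * inverse (f x))"] conjI ballI)
  qed
qed

lemma gsmooth_inverse:
  fixes f :: "(nat \<Rightarrow> real) \<Rightarrow> real"
  shows "(\<And>x. x \<in> U \<Longrightarrow> f x \<noteq> 0) \<Longrightarrow> gsmooth n U f \<Longrightarrow> gsmooth n U (\<lambda>x. inverse (f x))"
  by (simp add: gsmooth_def gCk_inverse)

section \<open>Locality of partial derivatives and the passage to \<open>smooth_fun\<close>\<close>

lemma line_eventually_in:
  assumes U: "openin (Euclidean_space n) U" and x: "x \<in> U" and i: "i < n"
  shows "\<forall>\<^sub>F t in nhds (x i). x(i := t) \<in> U"
proof -
  obtain T where T: "open T" "U = {x. \<forall>i\<ge>n. x i = 0} \<inter> T"
    using U by (auto simp: Euclidean_space_eq openin_open)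
  have "continuous_on UNIV (\<lambda>t. x(i := t))"
  proof (rule continuous_on_coordinatewise_then_product)
    fix j show "continuous_on UNIV (\<lambda>t. (x(i := t)) j)"
      by (cases "j = i") (auto intro: continuous_intros)
  qed
  then have "open ((\<lambda>t. x(i := t)) -` T)"
    using T(1) by (simp add: continuous_on_open_vimage)
  moreover have "x i \<in> (\<lambda>t. x(i := t)) -` T"
    using x T by simp
  ultimately have "\<forall>\<^sub>F t in nhds (x i). t \<in> (\<lambda>t. x(i := t)) -` T"
    by (rule eventually_nhds_in_open)
  then show ?thesis
    by eventually_elim (use x T i in \<open>auto simp: mem_Rn\<close>)
qed

text \<open>Coordinate expressions such as \<open>rep\<close> contain \<open>inv_into\<close> and
  are under control on the chart image only. Openness makes that enough for derivatives along
  coordinate lines.\<close>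

lemma has_vector_derivative_line_cong:
  assumes U: "openin (Euclidean_space n) U" and x: "x \<in> U" and i: "i < n"
    and eq: "\<And>y. y \<in> U \<Longrightarrow> f y = g y"
    and d: "((\<lambda>t. f (x(i := t))) has_vector_derivative D) (at (x i))"
  shows "((\<lambda>t. g (x(i := t))) has_vector_derivative D) (at (x i))"
proof -
  have ev: "\<forall>\<^sub>F t in nhds (x i). f (x(i := t)) = g (x(i := t))"
    using line_eventually_in[OF U x i] by eventually_elim (rule eq)
  show ?thesis
    using has_vector_derivative_cong_ev[of UNIV "\<lambda>t. f (x(i := t))" "\<lambda>t. g (x(i := t))" "x i" D] d ev eq[OF x]
    by simp
qed

lemma pd_eqI:
  assumes "((\<lambda>t. f (x(i := t))) has_vector_derivative D) (at (x i))"
  shows "pd i f x = D"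
  using assms unfolding pd_def
  by (simp add: DERIV_imp_deriv has_real_derivative_iff_has_vector_derivative)

text \<open>\<open>Ck\<close> recurses through \<open>pd i g\<close>, whose values off U are
  arbitrary. The induction therefore runs over pairs of functions that agree on U, the derivative D
  taking the place of f and \<open>pd i g\<close> that of g.\<close>

lemma gCk_imp_Ck:
  assumes U: "openin (Euclidean_space n) U"
  shows "gCk n U k f \<Longrightarrow> (\<And>x. x \<in> U \<Longrightarrow> f x = g x) \<Longrightarrow> Ck n U k g"
proof (induction k arbitrary: f g)
  case 0
  then show ?case
    using openin_Rn_subset[OF U] by (simp add: subtopology_Rn continuous_on_eq[of U f g])
next
  case (Suc k)
  have c: "continuous_map (subtopology (Euclidean_space n) U) euclideanreal g"
    using continuous_on_eq[OF gCk_cont[OF Suc.prems(1)] Suc.prems(2)] openin_Rn_subset[OF U]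
    by (simp add: subtopology_Rn)
  have "(\<forall>x\<in>U. (\<lambda>t. g (x(i := t))) field_differentiable at (x i)) \<and> Ck n U k (pd i g)" if i: "i < n" for i
  proof -
    obtain D where D: "\<And>x. x \<in> U \<Longrightarrow> ((\<lambda>t. f (x(i := t))) has_vector_derivative D x) (at (x i))" "gCk n U k D"
      using gCk_SucE[OF Suc.prems(1) i] by blast
    have D': "((\<lambda>t. g (x(i := t))) has_vector_derivative D x) (at (x i))" if "x \<in> U" for x
      using has_vector_derivative_line_cong[OF U that i _ D(1)[OF that]] Suc.prems(2) by blast
    have "Ck n U k (pd i g)"
      by (rule Suc.IH[OF D(2)]) (simp add: pd_eqI[OF D'])
    moreover have "(\<lambda>t. g (x(i := t))) field_differentiable at (x i)" if "x \<in> U" for x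
      using D'[OF that] unfolding field_differentiable_def has_real_derivative_iff_has_vector_derivative by blast
    ultimately show ?thesis by blast
  qed
  then show ?case using c by simp
qed

lemma gsmooth_imp_smooth_fun:
  assumes "openin (Euclidean_space n) U" "gsmooth n U f" "\<And>x. x \<in> U \<Longrightarrow> f x = g x"
  shows "smooth_fun n U g"
  unfolding smooth_fun_def
proof
  fix k
  show "Ck n U k g"
    using assms(2) by (intro gCk_imp_Ck[OF assms(1) _ assms(3)]) (simp_all add: gsmooth_def)
qed

section \<open>Manifolds with a single chart\<close>

text \<open>The carrier is the image of a parametrisation \<psi> and the chart \<phi> undoes it. For
  the tube both are the identity. The embedded half plane needs them to differ, because the points
  of a submanifold have to be points of the ambient manifold.\<close>

definition onechart ::
    "nat \<Rightarrow> (nat \<Rightarrow> real) set \<Rightarrow> ((nat \<Rightarrow> real) \<Rightarrow> nat \<Rightarrow> real) \<Rightarrow> ((nat \<Rightarrow> real) \<Rightarrow> nat \<Rightarrow> real) \<Rightarrow>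
     ((nat \<Rightarrow> real) \<Rightarrow> nat \<Rightarrow> nat \<Rightarrow> real) \<Rightarrow> (nat \<Rightarrow> real) mfd" where
  "onechart N U \<psi> \<phi> g = \<lparr>dimen = N, space_of = top_of_set (\<psi> ` U), atlas = {(\<psi> ` U, \<phi>)}, metric = (\<lambda>_. g)\<rparr>"

lemma onechart_simps [simp]:
  "dimen (onechart N U \<psi> \<phi> g) = N"
  "space_of (onechart N U \<psi> \<phi> g) = top_of_set (\<psi> ` U)"
  "atlas (onechart N U \<psi> \<phi> g) = {(\<psi> ` U, \<phi>)}"
  "metric (onechart N U \<psi> \<phi> g) c = g"
  by (simp_all add: onechart_def)

lemma second_countable_top_of_set:
  fixes S :: "'a::second_countable_topology set"
  shows "second_countable (top_of_set S)"
proof (rule second_countable_subtopology)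
  obtain B :: "'a set set" where B: "countable B" "topological_basis B"
    using ex_countable_basis by auto
  show "second_countable (euclidean :: 'a topology)"
    unfolding second_countable_def
  proof (intro exI[of _ B] conjI allI impI ballI)
    show "countable B" by (rule B)
    show "openin euclidean V" if "V \<in> B" for V
      using topological_basis_open[OF B(2) that] by simp
    show "\<exists>V\<in>B. x \<in> V \<and> V \<subseteq> U" if "openin euclidean U \<and> x \<in> U" for U x
      using that topological_basisE[OF B(2), of U x] by (metis open_openin)
  qed
qed

lemma Hausdorff_space_top_of_set: "Hausdorff_space (top_of_set (S :: (nat \<Rightarrow> real) set))"
  using Hausdorff_space_product_topology[of "\<lambda>i::nat. euclideanreal" UNIV]
  by (intro Hausdorff_space_subtopology) (simp add: euclidean_product_topology)

lemma connected_space_segments: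
  fixes S :: "(nat \<Rightarrow> real) set"
  assumes "\<And>x y t. x \<in> S \<Longrightarrow> y \<in> S \<Longrightarrow> t \<in> {0..1} \<Longrightarrow> (\<lambda>i. (1 - t) * x i + t * y i) \<in> S"
  shows "connected_space (top_of_set S)"
proof -
  have "path_connected S"
    unfolding path_connected_def
  proof (intro ballI)
    fix x y assume xy: "x \<in> S" "y \<in> S"
    define g where "g = (\<lambda>t::real. \<lambda>i. (1 - t) * x i + t * y i)"
    have "continuous_on {0..1} g"
      unfolding g_def by (rule continuous_on_coordinatewise_then_product) (intro continuous_intros)
    then show "\<exists>g. path g \<and> path_image g \<subseteq> S \<and> pathstart g = x \<and> pathfinish g = y"
      using assms[OF xy]
      by (intro exI[of _ g]) (auto simp: path_def path_image_def pathstart_def pathfinish_def g_def)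
  qed
  then have "connectedin euclidean S"
    by (simp add: connectedin_iff_connected path_connected_imp_connected)
  then show ?thesis by (simp add: connectedin_def)
qed

lemma sum_delta_mult:
  fixes f :: "nat \<Rightarrow> 'a::semiring_1"
  shows "(\<Sum>j<n. (if i = j then 1 else 0) * f j) = (if i < n then f i else 0)"
    "(\<Sum>j<n. f j * (if i = j then 1 else 0)) = (if i < n then f i else 0)"
proof -
  have "(if i = j then 1 else 0) * f j = (if i = j then f j else 0)"
    "f j * (if i = j then 1 else 0) = (if i = j then f j else 0)" for j
    by simp_all
  then show "(\<Sum>j<n. (if i = j then 1 else 0) * f j) = (if i < n then f i else 0)"
    "(\<Sum>j<n. f j * (if i = j then 1 else 0)) = (if i < n then f i else 0)"
    by simp_all
qed

section \<open>Recognising differentials, inverse metrics and Christoffel symbols\<close>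

lemma differential_eqI:
  assumes U: "openin (Euclidean_space n) U" and x: "x \<in> U"
    and eq: "\<And>y. y \<in> U \<Longrightarrow> R y = F y"
    and d: "\<And>i j. j < n \<Longrightarrow> ((\<lambda>t. F (x(j := t)) i) has_vector_derivative D j i) (at (x j))"
  shows "differential n R x v = (\<lambda>i. \<Sum>j<n. D j i * v j)"
proof
  fix i
  have "pd j (\<lambda>y. R y i) x = D j i" if "j < n" for j
    by (rule pd_eqI, rule has_vector_derivative_line_cong[OF U x that, of "\<lambda>y. F y i"])
       (simp_all add: eq d that)
  then show "differential n R x v i = (\<Sum>j<n. D j i * v j)"
    by (simp add: differential_def)
qed

text \<open>The definition asks for a left inverse. Symmetry of g and h turns the left inverse h
  into a right inverse as well, and then any left inverse h' equals h' g h = h.\<close>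

lemma inv_metric_eqI:
  assumes h0: "\<And>i j. i \<ge> n \<or> j \<ge> n \<Longrightarrow> h i j = 0"
    and hg: "\<And>i j. i < n \<Longrightarrow> j < n \<Longrightarrow> (\<Sum>k<n. h i k * g k j) = (if i = j then 1 else 0)"
    and g: "\<And>i j. i < n \<Longrightarrow> j < n \<Longrightarrow> g i j = g j i"
    and h: "\<And>i j. i < n \<Longrightarrow> j < n \<Longrightarrow> h i j = h j i"
  shows "inv_metric n g = h"
  unfolding inv_metric_def
proof (rule the_equality)
  show "(\<forall>i j. n \<le> i \<or> n \<le> j \<longrightarrow> h i j = 0) \<and>
    (\<forall>i<n. \<forall>j<n. (\<Sum>k<n. h i k * g k j) = (if i = j then 1 else 0))"
    using h0 hg by simp
  fix h' assume h': "(\<forall>i j. n \<le> i \<or> n \<le> j \<longrightarrow> h' i j = 0) \<and>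
    (\<forall>i<n. \<forall>j<n. (\<Sum>k<n. h' i k * g k j) = (if i = j then 1 else 0))"
  have gh: "(\<Sum>l<n. g k l * h l j) = (if j = k then 1 else 0)" if "k < n" "j < n" for k j
    unfolding hg[OF that(2,1), symmetric] by (rule sum.cong) (use that in \<open>simp_all add: g[of k] h[of _ j]\<close>)
  show "h' = h"
  proof (intro ext)
    fix i j
    show "h' i j = h i j"
    proof (cases "i < n \<and> j < n")
      case True
      have "h' i j = (\<Sum>k<n. h' i k * (if j = k then 1 else 0))"
        using True by (simp add: sum_delta_mult)
      also have "\<dots> = (\<Sum>k<n. h' i k * (\<Sum>l<n. g k l * h l j))"
        by (rule sum.cong) (use True in \<open>simp_all add: gh\<close>)
      also have "\<dots> = (\<Sum>l<n. (\<Sum>k<n. h' i k * g k l) * h l j)"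
        unfolding sum_distrib_left sum_distrib_right mult.assoc by (rule sum.swap)
      also have "\<dots> = (\<Sum>l<n. (if i = l then 1 else 0) * h l j)"
        by (rule sum.cong) (use True h' in simp_all)
      also have "\<dots> = h i j"
        using True by (simp add: sum_delta_mult)
      finally show ?thesis .
    next
      case False
      then show ?thesis using h' h0 by (metis not_less)
    qed
  qed
qed

text \<open>The Koszul formula with lowered index characterises \<Gamma>, so a guessed \<Gamma> can
  be checked without multiplying by the inverse metric. \<open>G i j l\<close> stands for the
  derivative of g_jl in direction i.\<close>

lemma christoffel_eqI:
  assumes h0: "\<And>i j. i \<ge> n \<or> j \<ge> n \<Longrightarrow> h i j = 0"
    and hg: "\<And>i j. i < n \<Longrightarrow> j < n \<Longrightarrow> (\<Sum>k<n. h i k * g x k j) = (if i = j then 1 else 0)"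
    and g: "\<And>i j. i < n \<Longrightarrow> j < n \<Longrightarrow> g x i j = g x j i"
    and h: "\<And>i j. i < n \<Longrightarrow> j < n \<Longrightarrow> h i j = h j i"
    and d: "\<And>i j l. i < n \<Longrightarrow> j < n \<Longrightarrow> l < n \<Longrightarrow>
      ((\<lambda>t. g (x(i := t)) j l) has_vector_derivative G i j l) (at (x i))"
    and koszul: "\<And>l. l < n \<Longrightarrow> G i j l + G j i l - G l i j = 2 * (\<Sum>m<n. g x l m * \<Gamma> m)"
    and k: "k < n" "i < n" "j < n"
  shows "christoffel (onechart n U \<psi> \<phi> g) c k i j x = \<Gamma> k"
proof -
  have inv: "inv_metric n (g x) = h"
    by (rule inv_metric_eqI[OF h0 hg g h])
  have pd: "pd i (\<lambda>y. g y j l) x = G i j l" if "i < n" "j < n" "l < n" for i j l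
    by (rule pd_eqI[OF d[OF that]])
  have "christoffel (onechart n U \<psi> \<phi> g) c k i j x = (\<Sum>l<n. h k l * (G i j l + G j i l - G l i j)) / 2"
    unfolding christoffel_def using k by (simp add: inv pd)
  also have "\<dots> = (\<Sum>l<n. h k l * (2 * (\<Sum>m<n. g x l m * \<Gamma> m))) / 2"
    by (simp add: koszul)
  also have "\<dots> = (\<Sum>l<n. \<Sum>m<n. h k l * g x l m * \<Gamma> m)"
    by (simp add: sum_distrib_left sum_divide_distrib mult_ac)
  also have "\<dots> = (\<Sum>m<n. (\<Sum>l<n. h k l * g x l m) * \<Gamma> m)"
    by (subst sum.swap) (simp add: sum_distrib_right)
  also have "\<dots> = (\<Sum>m<n. (if k = m then 1 else 0) * \<Gamma> m)"
    by (rule sum.cong) (use k hg in simp_all)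
  also have "\<dots> = \<Gamma> k" using k by (simp add: sum_delta_mult)
  finally show ?thesis .
qed

locale onechart_manifold =
  fixes N :: nat and U :: "(nat \<Rightarrow> real) set" and \<psi> \<phi> :: "(nat \<Rightarrow> real) \<Rightarrow> nat \<Rightarrow> real"
    and g :: "(nat \<Rightarrow> real) \<Rightarrow> nat \<Rightarrow> nat \<Rightarrow> real"
  assumes U_open: "openin (Euclidean_space N) U"
    and \<phi>\<psi>: "\<And>x. x \<in> U \<Longrightarrow> \<phi> (\<psi> x) = x"
    and \<psi>_cont: "continuous_on U \<psi>"
    and \<phi>_cont: "continuous_on (\<psi> ` U) \<phi>"
    and g_smooth: "\<And>i j. i < N \<Longrightarrow> j < N \<Longrightarrow> gsmooth N U (\<lambda>x. g x i j)"
    and g_sym: "\<And>x i j. x \<in> U \<Longrightarrow> i < N \<Longrightarrow> j < N \<Longrightarrow> g x i j = g x j i"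
    and g_pos: "\<And>x v. x \<in> U \<Longrightarrow> v \<in> Rn N \<Longrightarrow> v \<noteq> (\<lambda>i. 0) \<Longrightarrow> bilin N (g x) v v > 0"
begin

abbreviation "M \<equiv> onechart N U \<psi> \<phi> g"

lemma image_chart: "\<phi> ` \<psi> ` U = U"
  using \<phi>\<psi> by force

lemma inv_chart: "x \<in> U \<Longrightarrow> inv_into (\<psi> ` U) \<phi> x = \<psi> x"
  by (rule inv_into_f_eq) (auto simp: \<phi>\<psi> inj_on_def)

lemma rep_eq: "x \<in> U \<Longrightarrow> rep (\<psi> ` U, \<phi>) d F x = snd d (F (\<psi> x))"
  by (simp add: rep_def inv_chart)

lemma is_chart: "is_chart M (\<psi> ` U, \<phi>)"
proof -
  have "homeomorphic_maps (top_of_set (\<psi> ` U)) (top_of_set U) \<phi> \<psi>"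
    unfolding homeomorphic_maps_def using \<phi>\<psi> \<psi>_cont \<phi>_cont image_chart by auto
  then show ?thesis
    unfolding is_chart_def homeomorphic_map_maps
    using U_open openin_Rn_subset[OF U_open]
    by (auto simp: image_chart subtopology_Rn subtopology_subtopology)
qed

lemma identity_derivative:
  "((\<lambda>t. (x(j := t)) i) has_vector_derivative (if i = j then 1 else 0)) (at (x j))" for x :: "nat \<Rightarrow> real"
  by (cases "i = j") auto

lemma identity_differential:
  assumes "x \<in> U" "v \<in> Rn N"
  shows "differential N (rep (\<psi> ` U, \<phi>) (\<psi> ` U, \<phi>) (\<lambda>p. p)) x v = v"
proof -
  have "differential N (rep (\<psi> ` U, \<phi>) (\<psi> ` U, \<phi>) (\<lambda>p. p)) x v = (\<lambda>i. \<Sum>j<N. (if i = j then 1 else 0) * v j)"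
    by (rule differential_eqI[OF U_open assms(1), where F = "\<lambda>x. x"])
       (simp_all add: rep_eq \<phi>\<psi> identity_derivative)
  also have "\<dots> = v"
    using assms(2) by (auto simp: fun_eq_iff mem_Rn sum_delta_mult)
  finally show ?thesis .
qed

lemma riemannian: "riemannian_manifold M"
proof -
  have "smooth_fun N U (\<lambda>x. rep (\<psi> ` U, \<phi>) (\<psi> ` U, \<phi>) (\<lambda>p. p) x i)" for i
    by (rule gsmooth_imp_smooth_fun[OF U_open gsmooth_coord[of N U i]]) (simp add: rep_eq \<phi>\<psi>)
  then have "smooth_manifold M"
    unfolding smooth_manifold_def smooth_reps_def
    using is_chart by (simp add: Hausdorff_space_top_of_set second_countable_top_of_set image_chart)
  moreover have "preserves_metric M M (\<lambda>p. p)"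
    unfolding preserves_metric_def by (auto simp: \<phi>\<psi> identity_differential inner_at_def)
  moreover have "smooth_fun N U (\<lambda>x. g x i j)" if "i < N" "j < N" for i j
    by (rule gsmooth_imp_smooth_fun[OF U_open g_smooth[OF that]]) simp
  ultimately show ?thesis
    unfolding riemannian_manifold_def
    using g_sym g_pos by (auto simp: image_chart inner_at_def)
qed

lemma smooth_mapI:
  assumes "continuous_on (\<psi> ` U) F" "F ` \<psi> ` U \<subseteq> \<psi>' ` U'"
    and "\<And>i. gsmooth N U (\<lambda>x. \<phi>' (F (\<psi> x)) i)"
  shows "smooth_map M (onechart N' U' \<psi>' \<phi>' g') F"
proof -
  have "{p \<in> \<psi> ` U. F p \<in> \<psi>' ` U'} = \<psi> ` U" using assms(2) by auto
  moreover have "smooth_fun N U (\<lambda>x. rep (\<psi> ` U, \<phi>) (\<psi>' ` U', \<phi>') F x i)" for i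
    by (rule gsmooth_imp_smooth_fun[OF U_open assms(3)]) (simp add: rep_eq)
  ultimately show ?thesis
    using assms(1,2) by (auto simp: smooth_map_def smooth_reps_def image_chart)
qed

lemma differential_rep:
  assumes "x \<in> U"
    and "\<And>i j. j < N \<Longrightarrow> ((\<lambda>t. \<phi>' (F (\<psi> (x(j := t)))) i) has_vector_derivative D j i) (at (x j))"
  shows "differential N (rep (\<psi> ` U, \<phi>) (V, \<phi>') F) x v = (\<lambda>i. \<Sum>j<N. D j i * v j)"
  by (rule differential_eqI[OF U_open assms(1), where F = "\<lambda>x. \<phi>' (F (\<psi> x))"])
     (simp_all add: rep_eq assms(2))

end

section \<open>Square matrices\<close>

type_synonym cmat = "nat \<Rightarrow> nat \<Rightarrow> complex"

definition adj :: "cmat \<Rightarrow> cmat" where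
  "adj A = (\<lambda>i j. cnj (A j i))"

definition smul :: "complex \<Rightarrow> cmat \<Rightarrow> cmat" (infixr "*\<^sub>C" 75) where
  "c *\<^sub>C A = (\<lambda>i j. c * A i j)"

text \<open>This is Y in Z = X + i Y with X and Y Hermitian, not the matrix of the imaginary parts
  of the entries.\<close>

definition im_part :: "cmat \<Rightarrow> cmat" where
  "im_part A = (1 / (2 * \<i>)) *\<^sub>C (A - adj A)"

lemma adj_apply: "adj A i j = cnj (A j i)"
  by (simp add: adj_def)

lemma smul_apply: "(c *\<^sub>C A) i j = c * A i j"
  by (simp add: smul_def)

lemma adj_simps [simp]:
  "adj (adj A) = A" "adj (A + B) = adj A + adj B" "adj (A - B) = adj A - adj B" "adj (- A) = - adj A"
  "adj (c *\<^sub>C A) = cnj c *\<^sub>C adj A" "adj 0 = 0"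
  by (simp_all add: adj_def smul_def fun_eq_iff)

lemma smul_simps:
  "c *\<^sub>C (A + B) = c *\<^sub>C A + c *\<^sub>C B" "c *\<^sub>C (A - B) = c *\<^sub>C A - c *\<^sub>C B"
  "(c + d) *\<^sub>C A = c *\<^sub>C A + d *\<^sub>C A" "(c - d) *\<^sub>C A = c *\<^sub>C A - d *\<^sub>C A"
  "c *\<^sub>C d *\<^sub>C A = (c * d) *\<^sub>C A" "c *\<^sub>C (- A) = (- c) *\<^sub>C A" "- (c *\<^sub>C A) = (- c) *\<^sub>C A"
  "1 *\<^sub>C A = A" "0 *\<^sub>C A = 0" "c *\<^sub>C 0 = 0"
  by (simp_all add: smul_def fun_eq_iff algebra_simps)

lemma im_part_hermitian: "adj (im_part A) = im_part A"
  by (simp add: im_part_def smul_def fun_eq_iff adj_def field_simps)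

lemma im_part_apply: "im_part A i j = (A i j - cnj (A j i)) / (2 * \<i>)"
  by (simp add: im_part_def smul_def adj_def)

lemma im_part_add: "im_part (A + B) = im_part A + im_part B"
proof -
  have "A + B - adj (A + B) = (A - adj A) + (B - adj B)" by (simp add: fun_eq_iff adj_def)
  then show ?thesis by (simp only: im_part_def smul_simps(1))
qed

definition posdef :: "nat \<Rightarrow> cmat \<Rightarrow> bool" where
  "posdef n A \<longleftrightarrow> (\<forall>i<n. \<forall>j<n. A i j = cnj (A j i)) \<and>
     (\<forall>v. (\<exists>i<n. v i \<noteq> 0) \<longrightarrow> 0 < Re (\<Sum>i<n. \<Sum>j<n. cnj (v i) * A i j * v j))"

text \<open>The last variable is eliminated by completing the square.\<close>

lemma cholesky:
  "posdef n A \<Longrightarrow> \<exists>C. \<forall>i<n. \<forall>j<n. A i j = (\<Sum>k<n. cnj (C k i) * C k j)"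
proof (induction n arbitrary: A)
  case 0
  then show ?case by simp
next
  case (Suc n)
  have herm: "A i j = cnj (A j i)" if "i \<le> n" "j \<le> n" for i j
  proof -
    have "\<forall>i<Suc n. \<forall>j<Suc n. A i j = cnj (A j i)"
      using Suc.prems unfolding posdef_def by (rule conjunct1)
    then have "i < Suc n \<Longrightarrow> j < Suc n \<Longrightarrow> A i j = cnj (A j i)" by blast
    moreover have "i < Suc n" "j < Suc n" using that by simp_all
    ultimately show ?thesis by blast
  qed
  have pos: "0 < Re (\<Sum>i<Suc n. \<Sum>j<Suc n. cnj (v i) * A i j * v j)" if "\<exists>i<Suc n. v i \<noteq> 0" for v
    using Suc.prems that unfolding posdef_def by blast
  \<comment> \<open>Testing on the last unit vector shows that the pivot is positive.\<close>
  have "0 < Re (\<Sum>i<Suc n. \<Sum>j<Suc n. cnj (if i = n then 1 else 0) * A i j * (if j = n then 1 else 0))"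
    by (rule pos) auto
  also have "(\<Sum>i<Suc n. \<Sum>j<Suc n. cnj (if i = n then 1 else 0) * A i j * (if j = n then 1 else 0)) = A n n"
    by simp
  finally have Re_a: "0 < Re (A n n)" .
  define a where "a = Re (A n n)"
  have "Im (A n n) = 0"
    using arg_cong[OF herm[of n n], of Im] by simp
  then have a: "A n n = of_real a" "a > 0"
    using Re_a by (simp_all add: a_def complex_eq_iff)
  \<comment> \<open>The Schur complement of the pivot.\<close>
  define B where "B = (\<lambda>i j. A i j - A i n * A n j / of_real a)"
  have "posdef n B"
    unfolding posdef_def
  proof (intro conjI allI impI)
    fix i j assume "i < n" "j < n"
    then show "B i j = cnj (B j i)"
      using herm[of i j] herm[of i n] herm[of n j] by (simp add: B_def)
  next
    fix v :: "nat \<Rightarrow> complex" assume v: "\<exists>i<n. v i \<noteq> 0"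
    define s where "s = (\<Sum>j<n. A n j * v j)"
    \<comment> \<open>The last entry is the one that minimises the form of A over all extensions of
      v; at this w the form of A equals that of B at v.\<close>
    define w where "w = v(n := - s / of_real a)"
    have w: "w i = v i" if "i < n" for i using that by (simp add: w_def)
    have s': "(\<Sum>i<n. cnj (v i) * A i n) = cnj s"
      unfolding s_def cnj_sum by (rule sum.cong) (use herm[of _ n] in \<open>auto simp: mult.commute\<close>)
    have "(\<Sum>i<n. \<Sum>j<n. cnj (v i) * B i j * v j) =
      (\<Sum>i<n. \<Sum>j<n. cnj (v i) * A i j * v j) - (\<Sum>i<n. \<Sum>j<n. (cnj (v i) * A i n) * (A n j * v j)) / of_real a"
      by (simp add: B_def sum_subtractf sum_divide_distrib left_diff_distrib right_diff_distrib mult.assoc)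
    also have "(\<Sum>i<n. \<Sum>j<n. (cnj (v i) * A i n) * (A n j * v j)) = cnj s * s"
      by (subst s'[symmetric]) (simp add: s_def sum_product)
    finally have B: "(\<Sum>i<n. \<Sum>j<n. cnj (v i) * B i j * v j) =
      (\<Sum>i<n. \<Sum>j<n. cnj (v i) * A i j * v j) - cnj s * s / of_real a" .
    have "(\<Sum>i<Suc n. \<Sum>j<Suc n. cnj (w i) * A i j * w j) =
      (\<Sum>i<n. \<Sum>j<n. cnj (v i) * A i j * v j) + (\<Sum>i<n. cnj (v i) * A i n) * w n
      + cnj (w n) * s + cnj (w n) * A n n * w n"
      by (simp add: w sum.distrib s_def sum_distrib_left sum_distrib_right mult.assoc)
    also have "\<dots> = (\<Sum>i<n. \<Sum>j<n. cnj (v i) * B i j * v j)"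
    proof -
      have "w n = - s / of_real a" "cnj (w n) = - cnj s / of_real a" by (simp_all add: w_def)
      then show ?thesis unfolding B s' using a by (simp add: field_simps)
    qed
    finally have eq: "(\<Sum>i<Suc n. \<Sum>j<Suc n. cnj (w i) * A i j * w j) = (\<Sum>i<n. \<Sum>j<n. cnj (v i) * B i j * v j)" .
    obtain i where "i < n" "v i \<noteq> 0" using v by blast
    then have "\<exists>i<Suc n. w i \<noteq> 0" using w[of i] by (intro exI[of _ i]) simp
    then show "0 < Re (\<Sum>i<n. \<Sum>j<n. cnj (v i) * B i j * v j)"
      using pos[of w] unfolding eq by blast
  qed
  then obtain C where C: "\<And>i j. i < n \<Longrightarrow> j < n \<Longrightarrow> B i j = (\<Sum>k<n. cnj (C k i) * C k j)"
    using Suc.IH by blast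
  \<comment> \<open>The factor of B is bordered by a zero column and by the last row of A divided by
    the root of the pivot. That row restores exactly the rank-one term subtracted in B.\<close>
  define D where "D = (\<lambda>k j. if k < n then if j < n then C k j else 0 else A n j / of_real (sqrt a))"
  have sq: "of_real (sqrt a) * of_real (sqrt a) = (of_real a :: complex)"
    using a(2) by (simp flip: of_real_mult)
  have "A i j = (\<Sum>k<Suc n. cnj (D k i) * D k j)" if "i < Suc n" "j < Suc n" for i j
  proof -
    have last: "cnj (D n i) * D n j = A i n * A n j / of_real a"
    proof -
      have "A i n = cnj (A n i)" using that by (intro herm) simp_all
      then have "cnj (D n i) * D n j = A i n * A n j / (of_real (sqrt a) * of_real (sqrt a))"
        by (simp add: D_def)
      then show ?thesis unfolding sq .
    qed
    have "(\<Sum>k<n. cnj (D k i) * D k j) = A i j - A i n * A n j / of_real a"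
    proof (cases "i < n \<and> j < n")
      case True
      then show ?thesis using C[of i j] by (simp add: D_def B_def)
    next
      case False
      then have ij: "i = n \<or> j = n" using that by linarith
      then have "D k i = 0 \<or> D k j = 0" if "k < n" for k
        using that by (elim disjE) (simp_all add: D_def)
      then have "(\<Sum>k<n. cnj (D k i) * D k j) = 0"
        by (intro sum.neutral ballI) auto
      moreover have "A i j - A i n * A n j / of_real a = 0"
        using ij a(2) by (elim disjE) (simp_all add: a(1))
      ultimately show ?thesis by simp
    qed
    then show ?thesis by (simp add: last)
  qed
  then show ?case by (intro exI[of _ D] allI impI)
qed

locale square_matrices =
  fixes n :: nat
begin

text \<open>Truncation to the n by n block makes associativity and distributivity hold for arbitrary
  arguments. Membership in \<open>Mat\<close> matters only where \<open>idm\<close> has to act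
  trivially.\<close>

definition mm :: "cmat \<Rightarrow> cmat \<Rightarrow> cmat" (infixr "\<star>" 70) where
  "A \<star> B = (\<lambda>i j. if i < n \<and> j < n then \<Sum>k<n. A i k * B k j else 0)"

definition idm :: cmat where
  "idm = (\<lambda>i j. if i = j \<and> i < n then 1 else 0)"

definition tr :: "cmat \<Rightarrow> complex" where
  "tr A = (\<Sum>i<n. A i i)"

definition Mat :: "cmat set" where
  "Mat = {A. \<forall>i j. i \<ge> n \<or> j \<ge> n \<longrightarrow> A i j = 0}"

definition nonsing :: "cmat \<Rightarrow> bool" where
  "nonsing A \<longleftrightarrow> Determinant.det (mat n n (\<lambda>(i, j). A i j)) \<noteq> 0"

text \<open>The adjugate formula makes every entry a quotient of polynomials in the entries of A,
  from which continuity of inversion can be read off.\<close>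

definition minv :: "cmat \<Rightarrow> cmat" where
  "minv A = (\<lambda>i j. if i < n \<and> j < n then
     adj_mat (mat n n (\<lambda>(i, j). A i j)) $$ (i, j) / Determinant.det (mat n n (\<lambda>(i, j). A i j)) else 0)"

definition mv :: "cmat \<Rightarrow> (nat \<Rightarrow> complex) \<Rightarrow> nat \<Rightarrow> complex" where
  "mv A v = (\<lambda>i. \<Sum>j<n. A i j * v j)"

definition qform :: "cmat \<Rightarrow> (nat \<Rightarrow> complex) \<Rightarrow> complex" where
  "qform A v = (\<Sum>i<n. cnj (v i) * mv A v i)"

lemma mm_apply: "i < n \<Longrightarrow> j < n \<Longrightarrow> (A \<star> B) i j = (\<Sum>k<n. A i k * B k j)"
  by (simp add: mm_def)

lemma Mat_zero: "A \<in> Mat \<Longrightarrow> i \<ge> n \<or> j \<ge> n \<Longrightarrow> A i j = 0"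
  by (auto simp: Mat_def)

lemma Mat_eqI:
  assumes "A \<in> Mat" "B \<in> Mat" "\<And>i j. i < n \<Longrightarrow> j < n \<Longrightarrow> A i j = B i j"
  shows "A = B"
proof (intro ext)
  fix i j
  show "A i j = B i j"
    by (cases "i < n \<and> j < n") (use assms Mat_zero[of A i j] Mat_zero[of B i j] in \<open>auto simp: not_less\<close>)
qed

lemma Mat_intros [simp, intro]:
  "A \<star> B \<in> Mat" "idm \<in> Mat" "minv A \<in> Mat" "0 \<in> Mat"
  "A \<in> Mat \<Longrightarrow> B \<in> Mat \<Longrightarrow> A + B \<in> Mat"
  "A \<in> Mat \<Longrightarrow> B \<in> Mat \<Longrightarrow> A - B \<in> Mat"
  "A \<in> Mat \<Longrightarrow> - A \<in> Mat" "A \<in> Mat \<Longrightarrow> c *\<^sub>C A \<in> Mat" "A \<in> Mat \<Longrightarrow> adj A \<in> Mat"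
  "A \<in> Mat \<Longrightarrow> im_part A \<in> Mat"
  by (auto simp: Mat_def mm_def idm_def minv_def smul_def adj_def im_part_def)

lemma mm_assoc: "(A \<star> B) \<star> C = A \<star> B \<star> C"
proof (rule Mat_eqI)
  fix i j assume ij: "i < n" "j < n"
  have "((A \<star> B) \<star> C) i j = (\<Sum>k<n. \<Sum>l<n. A i l * B l k * C k j)"
    using ij by (simp add: mm_apply sum_distrib_right)
  also have "\<dots> = (\<Sum>l<n. \<Sum>k<n. A i l * B l k * C k j)" by (rule sum.swap)
  also have "\<dots> = (A \<star> B \<star> C) i j"
    using ij by (simp add: mm_apply sum_distrib_left mult.assoc)
  finally show "((A \<star> B) \<star> C) i j = (A \<star> B \<star> C) i j" .
qed auto

lemma mm_simps:
  "(A + B) \<star> C = A \<star> C + B \<star> C" "C \<star> (A + B) = C \<star> A + C \<star> B"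
  "(A - B) \<star> C = A \<star> C - B \<star> C" "C \<star> (A - B) = C \<star> A - C \<star> B"
  "(- A) \<star> C = - (A \<star> C)" "C \<star> (- A) = - (C \<star> A)"
  "(c *\<^sub>C A) \<star> B = c *\<^sub>C (A \<star> B)" "A \<star> (c *\<^sub>C B) = c *\<^sub>C (A \<star> B)"
  "0 \<star> A = 0" "A \<star> 0 = 0"
  by (auto simp: mm_def fun_eq_iff smul_def algebra_simps sum.distrib sum_subtractf sum_negf sum_distrib_left)

lemma adj_mm [simp]: "adj (A \<star> B) = adj B \<star> adj A"
  by (auto simp: mm_def adj_def fun_eq_iff mult.commute)

lemma adj_idm [simp]: "adj idm = idm"
  by (auto simp: adj_def idm_def fun_eq_iff)

lemma idm_mm: "A \<in> Mat \<Longrightarrow> idm \<star> A = A" "A \<in> Mat \<Longrightarrow> A \<star> idm = A"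
proof -
  assume A: "A \<in> Mat"
  have "(idm \<star> A) i j = A i j" "(A \<star> idm) i j = A i j" if ij: "i < n" "j < n" for i j
  proof -
    have "(\<Sum>k<n. idm i k * A k j) = (\<Sum>k<n. if k = i then A i j else 0)"
      by (rule sum.cong) (use ij in \<open>auto simp: idm_def\<close>)
    then show "(idm \<star> A) i j = A i j" using ij by (simp add: mm_apply)
    have "(\<Sum>k<n. A i k * idm k j) = (\<Sum>k<n. if k = j then A i j else 0)"
      by (rule sum.cong) (use ij in \<open>auto simp: idm_def\<close>)
    then show "(A \<star> idm) i j = A i j" using ij by (simp add: mm_apply)
  qed
  then show "idm \<star> A = A" "A \<star> idm = A"
    using A by (auto intro!: Mat_eqI)
qed

lemma idm_mm_mm [simp]: "idm \<star> A \<star> B = A \<star> B" "(A \<star> B) \<star> idm = A \<star> B"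
  by (rule idm_mm, simp)+

lemma mm_idm_mm [simp]: "A \<star> idm \<star> B = A \<star> B"
proof (rule Mat_eqI)
  fix i j assume ij: "i < n" "j < n"
  have "(\<Sum>k<n. A i k * (idm \<star> B) k j) = (\<Sum>k<n. A i k * B k j)"
  proof (rule sum.cong)
    fix k assume k: "k \<in> {..<n}"
    have "(\<Sum>l<n. idm k l * B l j) = (\<Sum>l<n. if l = k then B k j else 0)"
      by (rule sum.cong) (use k in \<open>auto simp: idm_def\<close>)
    then show "A i k * (idm \<star> B) k j = A i k * B k j"
      using k ij by (simp add: mm_apply)
  qed simp
  then show "(A \<star> idm \<star> B) i j = (A \<star> B) i j" using ij by (simp add: mm_apply)
qed auto

lemma tr_simps:
  "tr (A + B) = tr A + tr B" "tr (A - B) = tr A - tr B" "tr (- A) = - tr A" "tr (c *\<^sub>C A) = c * tr A"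
  "tr (adj A) = cnj (tr A)" "tr 0 = 0"
  by (simp_all add: tr_def sum.distrib sum_subtractf sum_negf smul_def sum_distrib_left adj_def)

lemma tr_commute: "tr (A \<star> B) = tr (B \<star> A)"
proof -
  have "tr (A \<star> B) = (\<Sum>i<n. \<Sum>k<n. A i k * B k i)"
    by (simp add: tr_def mm_apply)
  also have "\<dots> = (\<Sum>k<n. \<Sum>i<n. A i k * B k i)" by (rule sum.swap)
  also have "\<dots> = tr (B \<star> A)" by (simp add: tr_def mm_apply mult.commute)
  finally show ?thesis .
qed

lemma mat_mm: "mat n n (\<lambda>(i, j). (A \<star> B) i j) = mat n n (\<lambda>(i, j). A i j) * mat n n (\<lambda>(i, j). B i j)"
  by (rule eq_matI) (auto simp: mm_apply scalar_prod_def atLeast0LessThan)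

lemma mat_eq_one:
  assumes "mat n n (\<lambda>(i, j). A i j) = 1\<^sub>m n" "A \<in> Mat"
  shows "A = idm"
proof (rule Mat_eqI)
  fix i j assume ij: "i < n" "j < n"
  have "mat n n (\<lambda>(i, j). A i j) $$ (i, j) = 1\<^sub>m n $$ (i, j)"
    by (simp only: assms(1))
  then show "A i j = idm i j" using ij by (simp add: idm_def)
qed (use assms(2) in auto)

lemma minv_mm:
  assumes "nonsing A"
  shows "A \<star> minv A = idm" "minv A \<star> A = idm"
proof -
  let ?A = "mat n n (\<lambda>(i, j). A i j)"
  have c: "?A \<in> carrier_mat n n" by simp
  have i: "mat n n (\<lambda>(i, j). minv A i j) = (1 / Determinant.det ?A) \<cdot>\<^sub>m adj_mat ?A"
    using adj_mat(1)[OF c] by (intro eq_matI) (auto simp: minv_def)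
  have "mat n n (\<lambda>(i, j). (A \<star> minv A) i j) = 1\<^sub>m n"
    unfolding mat_mm i using adj_mat[OF c] assms
    by (subst mult_smult_distrib[of _ n n _ n]) (auto simp: nonsing_def)
  then show "A \<star> minv A = idm" by (rule mat_eq_one) simp
  have "mat n n (\<lambda>(i, j). (minv A \<star> A) i j) = 1\<^sub>m n"
    unfolding mat_mm i using adj_mat[OF c] assms
    by (subst mult_smult_assoc_mat[of _ n n _ n]) (auto simp: nonsing_def)
  then show "minv A \<star> A = idm" by (rule mat_eq_one) simp
qed

text \<open>Products are nested to the right, so an inverse pair inside a chain is followed by the
  rest of the chain. A further factor on either side makes the result a product again, which lies in
  \<open>Mat\<close> by itself.\<close>

lemma minv_cancel:
  assumes "nonsing A"
  shows "A \<star> minv A \<star> B \<star> C = B \<star> C" "minv A \<star> A \<star> B \<star> C = B \<star> C"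
    "B \<in> Mat \<Longrightarrow> A \<star> minv A \<star> B = B" "B \<in> Mat \<Longrightarrow> minv A \<star> A \<star> B = B"
    "C \<star> A \<star> minv A \<star> B = C \<star> B" "C \<star> minv A \<star> A \<star> B = C \<star> B"
proof -
  have eq: "A \<star> minv A \<star> B = idm \<star> B" "minv A \<star> A \<star> B = idm \<star> B" for B
    using minv_mm[OF assms] by (simp_all flip: mm_assoc)
  show "A \<star> minv A \<star> B \<star> C = B \<star> C" "minv A \<star> A \<star> B \<star> C = B \<star> C"
    "B \<in> Mat \<Longrightarrow> A \<star> minv A \<star> B = B" "B \<in> Mat \<Longrightarrow> minv A \<star> A \<star> B = B"
    "C \<star> A \<star> minv A \<star> B = C \<star> B" "C \<star> minv A \<star> A \<star> B = C \<star> B"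
    by (simp_all add: eq idm_mm)
qed

lemma nonsingI:
  assumes "\<And>v. (\<And>i. i < n \<Longrightarrow> mv A v i = 0) \<Longrightarrow> (\<And>i. i < n \<Longrightarrow> v i = 0)"
  shows "nonsing A"
  unfolding nonsing_def
proof
  let ?A = "mat n n (\<lambda>(i, j). A i j)"
  assume "Determinant.det ?A = 0"
  then obtain v where v: "v \<in> carrier_vec n" "v \<noteq> 0\<^sub>v n" "?A *\<^sub>v v = 0\<^sub>v n"
    using det_0_iff_vec_prod_zero_field[of ?A n] by auto
  have "mv A (\<lambda>j. vec_index v j) i = 0" if i: "i < n" for i
  proof -
    have "mv A (\<lambda>j. vec_index v j) i = vec_index (?A *\<^sub>v v) i"
      using i v(1) by (simp add: mv_def scalar_prod_def atLeast0LessThan)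
    then show ?thesis using i v(3) by simp
  qed
  then have "vec_index v i = 0" if "i < n" for i
    using assms[of "\<lambda>j. vec_index v j"] that by blast
  then have "v = 0\<^sub>v n" using v(1) by (intro eq_vecI) auto
  then show False using v(2) by simp
qed

lemma mv_mm: "i < n \<Longrightarrow> mv (A \<star> B) v i = mv A (mv B v) i"
proof -
  assume i: "i < n"
  have "mv (A \<star> B) v i = (\<Sum>j<n. \<Sum>k<n. A i k * B k j * v j)"
    using i by (simp add: mv_def mm_apply sum_distrib_right)
  also have "\<dots> = (\<Sum>k<n. \<Sum>j<n. A i k * B k j * v j)" by (rule sum.swap)
  also have "\<dots> = mv A (mv B v) i"
    by (simp add: mv_def sum_distrib_left mult.assoc)
  finally show ?thesis .
qed

lemma mv_idm: "i < n \<Longrightarrow> mv idm v i = v i"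
proof -
  assume i: "i < n"
  have "mv idm v i = (\<Sum>j<n. if j = i then v i else 0)"
    unfolding mv_def by (rule sum.cong) (use i in \<open>auto simp: idm_def\<close>)
  then show ?thesis using i by simp
qed

lemma mv_cong: "(\<And>j. j < n \<Longrightarrow> v j = w j) \<Longrightarrow> mv A v i = mv A w i"
  by (simp add: mv_def)

lemma nonsing_left_inverse:
  assumes "B \<star> A = idm"
  shows "nonsing A"
proof (rule nonsingI)
  fix v i assume v: "\<And>i. i < n \<Longrightarrow> mv A v i = 0" and i: "i < n"
  have "v i = mv B (mv A v) i" using i by (simp add: mv_mm[symmetric] assms mv_idm)
  also have "\<dots> = mv B (\<lambda>_. 0) i" by (rule mv_cong) (rule v)
  finally show "v i = 0" by (simp add: mv_def)
qed

lemma minv_eqI: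
  assumes "B \<star> A = idm" "B \<in> Mat"
  shows "minv A = B"
proof -
  have "B = B \<star> A \<star> minv A" using assms minv_mm[OF nonsing_left_inverse[OF assms(1)]] by (simp add: idm_mm)
  also have "\<dots> = minv A" using assms(1) by (simp add: mm_assoc[symmetric] idm_mm)
  finally show ?thesis ..
qed

lemma nonsing_minv: "nonsing A \<Longrightarrow> nonsing (minv A)"
  by (rule nonsing_left_inverse[OF minv_mm(1)])

lemma nonsing_mm:
  assumes "nonsing A" "nonsing B"
  shows "nonsing (A \<star> B)"
  by (rule nonsing_left_inverse[of "minv B \<star> minv A"])
     (simp add: mm_assoc minv_cancel[OF assms(1)] minv_mm[OF assms(2)] minv_cancel[OF assms(2)])

lemma nonsing_adj: "nonsing A \<Longrightarrow> nonsing (adj A)"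
  using arg_cong[OF minv_mm(1), of A adj] by (intro nonsing_left_inverse[of "adj (minv A)"]) simp

lemma minv_adj: "nonsing A \<Longrightarrow> minv (adj A) = adj (minv A)"
  using arg_cong[OF minv_mm(1), of A adj] by (intro minv_eqI) simp_all

end

section \<open>Continuity and smoothness of matrix inversion\<close>

lemma has_vector_derivative_iff_quotient:
  fixes f :: "real \<Rightarrow> 'a::real_normed_vector"
  shows "(f has_vector_derivative D) (at x) \<longleftrightarrow> ((\<lambda>t. (f t - f x) /\<^sub>R (t - x)) \<longlongrightarrow> D) (at x)"
proof -
  have eq: "norm (f t - f x - (t - x) *\<^sub>R D) / norm (t - x) = norm ((f t - f x) /\<^sub>R (t - x) - D)"
    if "t \<noteq> x" for t
  proof -
    have "(f t - f x) /\<^sub>R (t - x) - D = (f t - f x - (t - x) *\<^sub>R D) /\<^sub>R (t - x)"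
      using that by (simp add: scaleR_diff_right)
    then show ?thesis by (simp add: divide_inverse mult.commute)
  qed
  have "((\<lambda>t. norm (f t - f x - (t - x) *\<^sub>R D) / norm (t - x)) \<longlongrightarrow> 0) (at x) \<longleftrightarrow>
    ((\<lambda>t. norm ((f t - f x) /\<^sub>R (t - x) - D)) \<longlongrightarrow> 0) (at x)"
    by (rule filterlim_cong[OF refl refl]) (unfold eventually_at_filter, intro always_eventually allI impI eq)
  also have "\<dots> \<longleftrightarrow> ((\<lambda>t. (f t - f x) /\<^sub>R (t - x)) \<longlongrightarrow> D) (at x)"
    unfolding tendsto_norm_zero_iff by (rule Lim_null[symmetric])
  finally show ?thesis
    unfolding has_vector_derivative_def has_derivative_iff_norm
    by (simp add: bounded_linear_scaleR_left)
qed

context square_matrices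
begin

text \<open>By the Leibniz formula the determinant is a polynomial in the entries. The size is a
  parameter because minors of size n - 1 are needed too.\<close>

lemma tendsto_det:
  fixes F :: "'b \<Rightarrow> nat \<Rightarrow> nat \<Rightarrow> complex"
  assumes "\<And>i j. i < m \<Longrightarrow> j < m \<Longrightarrow> ((\<lambda>t. F t i j) \<longlongrightarrow> A i j) net"
  shows "((\<lambda>t. Determinant.det (mat m m (\<lambda>(i, j). F t i j))) \<longlongrightarrow> Determinant.det (mat m m (\<lambda>(i, j). A i j))) net"
proof -
  have *: "mat m m (\<lambda>(i, j). B i j) $$ (i, p i) = B i (p i)" if "p permutes {0..<m}" "i \<in> {0..<m}" for B :: cmat and p i
    using that permutes_in_image[OF that(1), of i] by simp
  have d: "Determinant.det (mat m m (\<lambda>(i, j). B i j)) =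
      (\<Sum>p\<in>{p. p permutes {0..<m}}. signof p * (\<Prod>i = 0..<m. B i (p i)))" for B :: cmat
    by (subst det_def'[of _ m]) (auto intro!: sum.cong prod.cong simp: *)
  show ?thesis
    unfolding d
  proof (intro tendsto_sum tendsto_mult tendsto_const tendsto_prod assms)
    fix p i assume "p \<in> {p. p permutes {0..<m}}" "i \<in> {0..<m}"
    then show "i < m" "p i < m"
      using permutes_in_image[of p "{0..<m}" i] by simp_all
  qed
qed

lemma tendsto_minv:
  assumes F: "\<And>i j. i < n \<Longrightarrow> j < n \<Longrightarrow> ((\<lambda>t. F t i j) \<longlongrightarrow> A i j) net" and A: "nonsing A"
  shows "((\<lambda>t. minv (F t) a b) \<longlongrightarrow> minv A a b) net"
proof (cases "a < n \<and> b < n")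
  case True
  let ?d = "\<lambda>B i. if i < b then i else Suc i"
  \<comment> \<open>\<open>?e\<close> skips column a and \<open>?f\<close> skips row b. The cofactor
    becomes the determinant of a matrix given by a function, to which \<open>tendsto_det\<close>
    applies.\<close>
  let ?e = "\<lambda>i. if i < a then i else Suc i"
  let ?f = "\<lambda>i. if i < b then i else Suc i"
  have "adj_mat (mat n n (\<lambda>(i, j). B i j)) $$ (a, b) =
      (-1) ^ (b + a) * Determinant.det (mat (n - 1) (n - 1) (\<lambda>(i, j). (\<lambda>i j. B (?f i) (?e j)) i j))" for B
  proof -
    have "mat_delete (mat n n (\<lambda>(i, j). B i j)) b a = mat (n - 1) (n - 1) (\<lambda>(i, j). (\<lambda>i j. B (?f i) (?e j)) i j)"
      by (rule eq_matI) (auto simp: mat_delete_def)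
    then show ?thesis using True by (simp add: adj_mat_def cofactor_def)
  qed
  note adj = this
  have eq: "minv B a b = (-1) ^ (b + a) * Determinant.det (mat (n - 1) (n - 1) (\<lambda>(i, j). (\<lambda>i j. B (?f i) (?e j)) i j))
      / Determinant.det (mat n n (\<lambda>(i, j). B i j))" for B
    using True by (simp only: minv_def if_True simp_thms adj[of B])
  show ?thesis
    unfolding eq
  proof (intro tendsto_divide tendsto_mult tendsto_const tendsto_det F)
    show "Determinant.det (mat n n (\<lambda>(i, j). A i j)) \<noteq> 0" using A by (simp add: nonsing_def)
  qed (use True in auto)
next
  case False
  then have "minv B a b = 0" for B by (auto simp: minv_def)
  then show ?thesis by simp
qed

lemma eventually_nonsing:
  assumes F: "\<And>i j. i < n \<Longrightarrow> j < n \<Longrightarrow> ((\<lambda>t. F t i j) \<longlongrightarrow> A i j) net" and A: "nonsing A"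
  shows "\<forall>\<^sub>F t in net. nonsing (F t)"
  unfolding nonsing_def
  by (rule tendsto_imp_eventually_ne[OF tendsto_det[OF F]]) (use A in \<open>simp_all add: nonsing_def\<close>)

text \<open>The resolvent identity \<open>B\<^sup>-\<^sup>1 - A\<^sup>-\<^sup>1 = - B\<^sup>-\<^sup>1 (B - A) A\<^sup>-\<^sup>1\<close> reduces differentiability to continuity.\<close>

lemma minv_has_vector_derivative:
  assumes F: "\<And>i j. i < n \<Longrightarrow> j < n \<Longrightarrow> ((\<lambda>t. F t i j) has_vector_derivative F' i j) (at t0)"
    and A: "nonsing (F t0)"
  shows "((\<lambda>t. minv (F t) a b) has_vector_derivative (- (minv (F t0) \<star> F' \<star> minv (F t0))) a b) (at t0)"
proof -
  have lim: "((\<lambda>t. F t i j) \<longlongrightarrow> F t0 i j) (at t0)" if "i < n" "j < n" for i j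
    using has_vector_derivative_continuous[OF F[OF that]] by (simp add: continuous_within)
  have ev: "\<forall>\<^sub>F t in at t0. nonsing (F t)"
    by (rule eventually_nonsing[OF lim A])
  have q: "((\<lambda>t. (F t i j - F t0 i j) /\<^sub>R (t - t0)) \<longlongrightarrow> F' i j) (at t0)" if "i < n" "j < n" for i j
    using F[OF that] by (simp only: has_vector_derivative_iff_quotient)
  let ?Q = "\<lambda>t i j. (F t i j - F t0 i j) /\<^sub>R (t - t0)"
  have "((\<lambda>t. (- (minv (F t) \<star> ?Q t \<star> minv (F t0))) a b) \<longlongrightarrow> (- (minv (F t0) \<star> F' \<star> minv (F t0))) a b) (at t0)"
  proof (cases "a < n \<and> b < n")
    case True
    have e: "(- (X \<star> Y \<star> Z)) a b = - (\<Sum>k<n. X a k * (\<Sum>l<n. Y k l * Z l b))" for X Y Z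
      using True by (simp add: mm_apply)
    show ?thesis unfolding e
      by (intro tendsto_minus tendsto_sum tendsto_mult tendsto_minv[OF lim A] tendsto_const q) simp_all
  next
    case False
    then have "(- (X \<star> Y)) a b = 0" for X Y by (auto simp: mm_def)
    then show ?thesis by simp
  qed
  moreover have "\<forall>\<^sub>F t in at t0. (- (minv (F t) \<star> ?Q t \<star> minv (F t0))) a b = (minv (F t) a b - minv (F t0) a b) /\<^sub>R (t - t0)"
    using ev
  proof eventually_elim
    case (elim t)
    have "?Q t = of_real (inverse (t - t0)) *\<^sub>C (F t - F t0)"
      by (simp add: smul_def fun_eq_iff scaleR_conv_of_real)
    then have "- (minv (F t) \<star> ?Q t \<star> minv (F t0)) = of_real (inverse (t - t0)) *\<^sub>C (minv (F t) - minv (F t0))"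
      by (simp add: mm_simps smul_simps minv_cancel[OF elim] minv_mm[OF A] idm_mm)
    then show ?case by (simp add: smul_def scaleR_conv_of_real)
  qed
  ultimately show ?thesis
    unfolding has_vector_derivative_iff_quotient by (rule Lim_transform_eventually)
qed

text \<open>As for 1/f: the derivative is built from entries of the inverse and first derivatives of
  F, all of class C^k by induction. The hypothesis is needed for all entries at once, hence a and b
  are generalised.\<close>

lemma gCk_minv:
  assumes U: "\<And>x. x \<in> U \<Longrightarrow> nonsing (F x)"
  shows "(\<And>i j. i < n \<Longrightarrow> j < n \<Longrightarrow> gCk N U k (\<lambda>x. F x i j)) \<Longrightarrow> gCk N U k (\<lambda>x. minv (F x) a b)"
proof (induction k arbitrary: a b)
  case 0
  have "((\<lambda>y. F y i j) \<longlongrightarrow> F x i j) (at x within U)" if "x \<in> U" "i < n" "j < n" for x i j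
    using 0[OF that(2,3)] that(1) by (simp add: continuous_on_def)
  then show ?case
    using U by (simp add: continuous_on_def tendsto_minv)
next
  case (Suc k)
  have c: "((\<lambda>y. F y i j) \<longlongrightarrow> F x i j) (at x within U)" if "x \<in> U" "i < n" "j < n" for x i j
    using gCk_cont[OF Suc.prems[OF that(2,3)]] that(1) by (simp add: continuous_on_def)
  show ?case
  proof (rule gCk_SucI)
    show "continuous_on U (\<lambda>x. minv (F x) a b)"
      using U c by (simp add: continuous_on_def tendsto_minv)
    fix l assume l: "l < N"
    define P where "P = (\<lambda>i j D. (\<forall>x\<in>U. ((\<lambda>t. F (x(l := t)) i j) has_vector_derivative D x) (at (x l))) \<and> gCk N U k D)"
    define D where "D = (\<lambda>i j. SOME D. P i j D)"
    have P: "P i j (D i j)" if ij: "i < n" "j < n" for i j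
    proof -
      obtain E where E: "\<And>x. x \<in> U \<Longrightarrow> ((\<lambda>t. F (x(l := t)) i j) has_vector_derivative E x) (at (x l))" "gCk N U k E"
        using gCk_SucE[OF Suc.prems[OF ij] l] by blast
      have "P i j E" using E by (simp add: P_def)
      then show ?thesis unfolding D_def by (rule someI[of "P i j" E])
    qed
    have D: "\<And>i j x. i < n \<Longrightarrow> j < n \<Longrightarrow> x \<in> U \<Longrightarrow> ((\<lambda>t. F (x(l := t)) i j) has_vector_derivative D i j x) (at (x l))"
      "\<And>i j. i < n \<Longrightarrow> j < n \<Longrightarrow> gCk N U k (D i j)"
      using P by (simp_all add: P_def)
    have "((\<lambda>t. minv (F (x(l := t))) a b) has_vector_derivative
        (- (minv (F x) \<star> (\<lambda>i j. D i j x) \<star> minv (F x))) a b) (at (x l))" if "x \<in> U" for x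
      using minv_has_vector_derivative[of "\<lambda>t. F (x(l := t))" "\<lambda>i j. D i j x" "x l"] D(1)[OF _ _ that] U[OF that]
      by simp
    moreover have "gCk N U k (\<lambda>x. (- (minv (F x) \<star> (\<lambda>i j. D i j x) \<star> minv (F x))) a b)"
    proof (cases "a < n \<and> b < n")
      case True
      have e: "(- (X \<star> Y \<star> Z)) a b = (\<Sum>k<n. (- X a k) * (\<Sum>l<n. Y k l * Z l b))" for X Y Z
        using True by (simp add: mm_apply sum_negf)
      have "gCk N U k (\<lambda>x. - minv (F x) i j)" for i j
        by (rule gCk_linear[OF bounded_linear_minus[OF bounded_linear_ident]])
           (rule Suc.IH, rule gCk_Suc_imp, rule Suc.prems)
      then show ?thesis unfolding e
        by (intro gCk_sum gCk_mult Suc.IH gCk_Suc_imp[OF Suc.prems] D(2)) auto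
    next
      case False
      then have "(- (X \<star> Y)) a b = 0" for X Y by (auto simp: mm_def)
      then show ?thesis by (simp add: gCk_const)
    qed
    ultimately show "\<exists>D. (\<forall>x\<in>U. ((\<lambda>t. minv (F (x(l := t))) a b) has_vector_derivative D x) (at (x l))) \<and> gCk N U k D"
      by (intro exI[of _ "\<lambda>x. (- (minv (F x) \<star> (\<lambda>i j. D i j x) \<star> minv (F x))) a b"] conjI ballI)
  qed
qed

lemma gsmooth_minv:
  assumes "\<And>x. x \<in> U \<Longrightarrow> nonsing (F x)" "\<And>i j. i < n \<Longrightarrow> j < n \<Longrightarrow> gsmooth N U (\<lambda>x. F x i j)"
  shows "gsmooth N U (\<lambda>x. minv (F x) a b)"
  unfolding gsmooth_def
  by (intro allI gCk_minv assms(1)) (use assms(2) in \<open>simp_all add: gsmooth_def\<close>)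

lemma gsmooth_mm:
  assumes "\<And>i j. i < n \<Longrightarrow> j < n \<Longrightarrow> gsmooth N U (\<lambda>x. A x i j)"
    and "\<And>i j. i < n \<Longrightarrow> j < n \<Longrightarrow> gsmooth N U (\<lambda>x. B x i j)"
  shows "gsmooth N U (\<lambda>x. (A x \<star> B x) i j)"
proof (cases "i < n \<and> j < n")
  case True
  then have "(X \<star> Y) i j = (\<Sum>k<n. X i k * Y k j)" for X Y by (simp add: mm_apply)
  then show ?thesis using True by (simp only:) (intro gsmooth_sum gsmooth_mult assms, auto)
next
  case False
  then have "(X \<star> Y) i j = 0" for X Y by (auto simp: mm_def)
  then show ?thesis by (simp add: gsmooth_const)
qed

lemma mm_has_vector_derivative:
  assumes "\<And>i j. i < n \<Longrightarrow> j < n \<Longrightarrow> ((\<lambda>t. A t i j) has_vector_derivative A' i j) (at t0 within S)"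
    and "\<And>i j. i < n \<Longrightarrow> j < n \<Longrightarrow> ((\<lambda>t. B t i j) has_vector_derivative B' i j) (at t0 within S)"
  shows "((\<lambda>t. (A t \<star> B t) i j) has_vector_derivative (A' \<star> B t0 + A t0 \<star> B') i j) (at t0 within S)"
proof (cases "i < n \<and> j < n")
  case True
  have "((\<lambda>t. \<Sum>k<n. A t i k * B t k j) has_vector_derivative (\<Sum>k<n. A t0 i k * B' k j + A' i k * B t0 k j)) (at t0 within S)"
    by (intro has_vector_derivative_sum has_vector_derivative_mult assms) (use True in auto)
  moreover have "(A' \<star> B t0 + A t0 \<star> B') i j = (\<Sum>k<n. A t0 i k * B' k j + A' i k * B t0 k j)"
    using True by (simp add: mm_apply sum.distrib)
  ultimately show ?thesis using True by (simp add: mm_apply)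
next
  case False
  then have "(X \<star> Y) i j = 0" for X Y by (auto simp: mm_def)
  then show ?thesis by simp
qed

section \<open>Positive definite matrices and the trace form\<close>

lemma qform_eq: "qform A v = (\<Sum>i<n. \<Sum>j<n. cnj (v i) * A i j * v j)"
  by (simp add: qform_def mv_def sum_distrib_left mult.assoc)

lemma posdef_qform: "posdef n A \<Longrightarrow> i < n \<Longrightarrow> v i \<noteq> 0 \<Longrightarrow> 0 < Re (qform A v)"
  unfolding posdef_def qform_eq by blast

lemma posdef_adj:
  assumes "posdef n A" "A \<in> Mat"
  shows "adj A = A"
proof (rule Mat_eqI)
  fix i j assume "i < n" "j < n"
  then have "A i j = cnj (A j i)" using assms(1) unfolding posdef_def by blast
  then show "adj A i j = A i j" by (simp only: adj_apply)
qed (use assms in auto)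

lemma posdefI: "adj A = A \<Longrightarrow> (\<And>v i. i < n \<Longrightarrow> v i \<noteq> 0 \<Longrightarrow> 0 < Re (qform A v)) \<Longrightarrow> posdef n A"
proof -
  assume A: "adj A = A" and pos: "\<And>v i. i < n \<Longrightarrow> v i \<noteq> 0 \<Longrightarrow> 0 < Re (qform A v)"
  have "A i j = cnj (A j i)" for i j
    using fun_cong[OF fun_cong[OF A], of i j] by (simp only: adj_apply)
  then show "posdef n A"
    unfolding posdef_def qform_eq[symmetric] using pos by blast
qed

lemma qform_adj: "qform (adj A) v = cnj (qform A v)"
proof -
  have "qform (adj A) v = (\<Sum>i<n. \<Sum>j<n. cnj (cnj (v j) * A j i * v i))"
    by (simp add: qform_eq adj_apply mult_ac)
  also have "\<dots> = (\<Sum>j<n. \<Sum>i<n. cnj (cnj (v j) * A j i * v i))" by (rule sum.swap)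
  finally show ?thesis by (simp add: qform_eq)
qed

lemma qform_im_part: "qform (im_part A) v = of_real (Im (qform A v))"
proof -
  have "qform (im_part A) v = (qform A v - qform (adj A) v) / (2 * \<i>)"
    unfolding qform_eq im_part_apply adj_apply sum_subtractf[symmetric] sum_divide_distrib
    by (intro sum.cong refl) (simp add: field_simps)
  then show ?thesis by (simp add: qform_adj complex_eq_iff)
qed

text \<open>At a kernel vector of A the form of A vanishes, while its imaginary part is the form of
  \<open>im_part A\<close>. This makes Z - X0 invertible on the whole tube, so the geodesic
  symmetries are globally defined.\<close>

lemma im_posdef_nonsing:
  assumes "posdef n (im_part A)"
  shows "nonsing A"
proof (rule nonsingI, rule ccontr)
  fix v :: "nat \<Rightarrow> complex" and i assume "\<And>i. i < n \<Longrightarrow> mv A v i = 0" "i < n" "v i \<noteq> 0"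
  then show False
    using posdef_qform[OF assms, of i v] unfolding qform_im_part by (simp add: qform_def)
qed

lemma posdef_nonsing:
  assumes "posdef n A"
  shows "nonsing A"
proof (rule nonsingI, rule ccontr)
  fix v :: "nat \<Rightarrow> complex" and i assume "\<And>i. i < n \<Longrightarrow> mv A v i = 0" "i < n" "v i \<noteq> 0"
  then show False
    using posdef_qform[OF assms, of i v] by (simp add: qform_def)
qed

lemma qform_congruence: "qform (adj P \<star> A \<star> P) v = qform A (mv P v)"
proof -
  have "qform (adj P \<star> A \<star> P) v = (\<Sum>i<n. cnj (v i) * mv (adj P) (mv (A \<star> P) v) i)"
    unfolding qform_def by (rule sum.cong) (simp_all add: mv_mm)
  also have "\<dots> = (\<Sum>i<n. \<Sum>k<n. cnj (P k i * v i) * mv (A \<star> P) v k)"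
    by (simp add: mv_def[of "adj P"] adj_apply sum_distrib_left mult_ac)
  also have "\<dots> = (\<Sum>k<n. \<Sum>i<n. cnj (P k i * v i) * mv (A \<star> P) v k)" by (rule sum.swap)
  also have "\<dots> = (\<Sum>k<n. cnj (mv P v k) * mv (A \<star> P) v k)"
    by (simp add: mv_def[of P] sum_distrib_right)
  also have "\<dots> = qform A (mv P v)"
    unfolding qform_def by (rule sum.cong) (simp_all add: mv_mm)
  finally show ?thesis .
qed

lemma posdef_congruence:
  assumes A: "posdef n A" "A \<in> Mat" and P: "nonsing P"
  shows "posdef n (adj P \<star> A \<star> P)"
proof (rule posdefI)
  show "adj (adj P \<star> A \<star> P) = adj P \<star> A \<star> P" by (simp add: posdef_adj[OF A] mm_assoc)
  fix v :: "nat \<Rightarrow> complex" and i assume i: "i < n" "v i \<noteq> 0"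
  have "\<exists>k<n. mv P v k \<noteq> 0"
  proof (rule ccontr)
    assume "\<not> (\<exists>k<n. mv P v k \<noteq> 0)"
    then have "mv (minv P) (mv P v) i = mv (minv P) (\<lambda>_. 0) i" by (intro mv_cong) auto
    then show False using i by (simp add: mv_mm[symmetric] minv_mm[OF P] mv_idm) (simp add: mv_def)
  qed
  then show "0 < Re (qform (adj P \<star> A \<star> P) v)"
    unfolding qform_congruence using posdef_qform[OF A(1)] by blast
qed

lemma posdef_minv:
  assumes A: "posdef n A" "A \<in> Mat"
  shows "posdef n (minv A)" "adj (minv A) = minv A"
proof -
  note ns = posdef_nonsing[OF A(1)]
  show adj: "adj (minv A) = minv A"
    using minv_adj[OF ns] posdef_adj[OF A] by simp
  have "posdef n (adj (minv A) \<star> A \<star> minv A)"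
    by (rule posdef_congruence[OF A nonsing_minv[OF ns]])
  then show "posdef n (minv A)"
    by (simp add: adj minv_mm[OF ns] minv_cancel[OF ns] idm_mm)
qed

text \<open>The Cholesky factor is cut off outside the block to lie in \<open>Mat\<close>. It is
  invertible because its kernel is contained in that of A.\<close>

lemma posdef_factor:
  assumes A: "posdef n A" "A \<in> Mat"
  obtains C where "C \<in> Mat" "nonsing C" "A = adj C \<star> C"
proof -
  obtain C0 where C0: "\<And>i j. i < n \<Longrightarrow> j < n \<Longrightarrow> A i j = (\<Sum>k<n. cnj (C0 k i) * C0 k j)"
    using cholesky[OF A(1)] by blast
  define C where "C = (\<lambda>i j. if i < n \<and> j < n then C0 i j else 0)"
  have C: "C \<in> Mat" by (auto simp: C_def Mat_def)
  have eq: "A = adj C \<star> C"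
    by (rule Mat_eqI) (simp_all add: A(2) C0 mm_apply adj_apply C_def)
  have "nonsing C"
  proof (rule nonsingI, rule ccontr)
    fix v :: "nat \<Rightarrow> complex" and i assume z: "\<And>i. i < n \<Longrightarrow> mv C v i = 0" and i: "i < n" "v i \<noteq> 0"
    have "mv A v j = 0" if "j < n" for j
    proof -
      have "mv A v j = mv (adj C) (mv C v) j" unfolding eq by (rule mv_mm[OF that])
      also have "\<dots> = mv (adj C) (\<lambda>_. 0) j" by (rule mv_cong) (rule z)
      finally show ?thesis by (simp add: mv_def)
    qed
    then show False using posdef_qform[OF A(1), of i v] i by (simp add: qform_def)
  qed
  then show thesis using that C eq by blast
qed

lemma tr_mm_adj: "tr (A \<star> adj A) = of_real (\<Sum>i<n. \<Sum>j<n. (cmod (A i j))\<^sup>2)"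
  by (simp add: tr_def mm_apply adj_apply complex_norm_square flip: of_real_power)

text \<open>If the inverse of Y is B \<open>adj B\<close>, cyclicity of the trace turns the form
  into the squared Frobenius norm of X = \<open>adj B\<close> A B, and A is recovered from X because
  B is invertible.\<close>

lemma tr_posdef:
  assumes Y: "posdef n Y" "Y \<in> Mat" and A: "A \<in> Mat" "A \<noteq> 0"
  shows "0 < Re (tr (minv Y \<star> A \<star> minv Y \<star> adj A))"
proof -
  obtain C where C: "C \<in> Mat" "nonsing C" "Y = adj C \<star> C"
    using posdef_factor[OF Y] by blast
  define B where "B = minv C"
  have H: "minv Y = B \<star> adj B"
    unfolding C(3) B_def minv_adj[OF C(2), symmetric]
    by (rule minv_eqI) (simp_all add: mm_assoc minv_cancel[OF nonsing_adj[OF C(2)]] minv_mm[OF C(2)])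
  define X where "X = adj B \<star> A \<star> B"
  have "tr (minv Y \<star> A \<star> minv Y \<star> adj A) = tr (B \<star> (adj B \<star> A \<star> B \<star> adj B \<star> adj A))"
    by (simp add: H mm_assoc)
  also have "\<dots> = tr (X \<star> adj X)"
    by (subst tr_commute) (simp add: X_def mm_assoc)
  finally have eq: "tr (minv Y \<star> A \<star> minv Y \<star> adj A) = of_real (\<Sum>i<n. \<Sum>j<n. (cmod (X i j))\<^sup>2)"
    by (simp only: tr_mm_adj)
  have "\<exists>i<n. \<exists>j<n. X i j \<noteq> 0"
  proof (rule ccontr)
    assume "\<not> (\<exists>i<n. \<exists>j<n. X i j \<noteq> 0)"
    then have "X = 0" by (intro Mat_eqI) (auto simp: X_def)
    then have "adj C \<star> X \<star> C = 0" by (simp add: mm_simps)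
    moreover have "adj C \<star> X \<star> C = A"
      by (simp add: X_def B_def minv_adj[OF C(2), symmetric] mm_assoc minv_mm[OF C(2)]
          minv_cancel[OF nonsing_adj[OF C(2)]] minv_mm[OF nonsing_adj[OF C(2)]] A(1) idm_mm)
    ultimately show False using A(2) by simp
  qed
  then obtain a b where ab: "a < n" "b < n" "X a b \<noteq> 0" by blast
  have "0 < (cmod (X a b))\<^sup>2" using ab by simp
  also have "\<dots> \<le> (\<Sum>j<n. (cmod (X a j))\<^sup>2)"
    by (rule member_le_sum) (use ab in auto)
  also have "\<dots> \<le> (\<Sum>i<n. \<Sum>j<n. (cmod (X i j))\<^sup>2)"
    by (rule member_le_sum[of a _ "\<lambda>i. \<Sum>j<n. (cmod (X i j))\<^sup>2"]) (use ab in \<open>auto intro!: sum_nonneg\<close>)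
  finally show ?thesis unfolding eq by simp
qed

text \<open>Write A = \<open>adj C\<close> C and let Q be the squared length of C v, which is the
  form of A at v. As v is recovered by the inverse of C, each of its entries is at most \<beta> sqrt
  Q. A perturbation of total size s then changes the form by at most \<beta>^2 Q s, uniformly in
  v.\<close>

lemma posdef_open:
  assumes A: "posdef n A" "A \<in> Mat"
  obtains \<epsilon> where "\<epsilon> > 0"
    "\<And>B. adj B = B \<Longrightarrow> (\<Sum>i<n. \<Sum>j<n. cmod (B i j - A i j)) < \<epsilon> \<Longrightarrow> posdef n B"
proof -
  obtain C where C: "C \<in> Mat" "nonsing C" "A = adj C \<star> C"
    using posdef_factor[OF A] by blast
  define \<beta> where "\<beta> = (\<Sum>i<n. \<Sum>k<n. cmod (minv C i k))"
  have \<beta>0: "\<beta> \<ge> 0" unfolding \<beta>_def by (intro sum_nonneg) simp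
  show thesis
  \<comment> \<open>The summand 1 in the denominator makes \<beta>^2 / (1 + \<beta>^2) strictly less
    than 1.\<close>
  proof (rule that[of "1 / (1 + \<beta>\<^sup>2)"])
    show "1 / (1 + \<beta>\<^sup>2) > 0" by (simp add: add_pos_nonneg)
    fix B assume B: "adj B = B" "(\<Sum>i<n. \<Sum>j<n. cmod (B i j - A i j)) < 1 / (1 + \<beta>\<^sup>2)"
    let ?s = "\<Sum>i<n. \<Sum>j<n. cmod (B i j - A i j)"
    show "posdef n B"
    proof (rule posdefI[OF B(1)])
      fix v :: "nat \<Rightarrow> complex" and i assume vi: "i < n" "v i \<noteq> 0"
      define Q where "Q = (\<Sum>k<n. (cmod (mv C v k))\<^sup>2)"
      have "qform A v = (\<Sum>k<n. cnj (mv C v k) * mv C v k)"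
      proof -
        have "qform A v = qform (adj C \<star> idm \<star> C) v" by (simp add: C)
        also have "\<dots> = qform idm (mv C v)" by (rule qform_congruence)
        also have "\<dots> = (\<Sum>k<n. cnj (mv C v k) * mv C v k)"
          unfolding qform_def by (rule sum.cong) (simp_all add: mv_idm)
        finally show ?thesis .
      qed
      also have "\<dots> = of_real Q"
        by (simp add: Q_def complex_norm_square mult.commute flip: of_real_power)
      finally have qA: "qform A v = of_real Q" .
      have Q: "Q > 0" using posdef_qform[OF A(1), of i v] vi qA by simp
      have "cmod (mv C v k) \<le> sqrt Q" if "k < n" for k
      proof (rule real_le_rsqrt)
        show "(cmod (mv C v k))\<^sup>2 \<le> Q" unfolding Q_def by (rule member_le_sum) (use that in auto)
      qed
      note le_sqrt = this
      have v: "cmod (v j) \<le> \<beta> * sqrt Q" if j: "j < n" for j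
      proof -
        have "v j = mv (minv C) (mv C v) j"
          using j by (simp add: mv_mm[symmetric] minv_mm[OF C(2)] mv_idm)
        also have "cmod \<dots> \<le> (\<Sum>k<n. cmod (minv C j k) * cmod (mv C v k))"
          unfolding mv_def[of "minv C"] by (rule order_trans[OF norm_sum]) (simp add: norm_mult)
        also have "\<dots> \<le> (\<Sum>k<n. cmod (minv C j k) * sqrt Q)"
          by (intro sum_mono mult_left_mono le_sqrt) auto
        also have "\<dots> = (\<Sum>k<n. cmod (minv C j k)) * sqrt Q" by (simp add: sum_distrib_right)
        also have "\<dots> \<le> \<beta> * sqrt Q"
          unfolding \<beta>_def using Q j
          by (intro mult_right_mono member_le_sum[of j _ "\<lambda>i. \<Sum>k<n. cmod (minv C i k)"]) (auto intro!: sum_nonneg)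
        finally show ?thesis .
      qed
      have "cmod (qform B v - qform A v) = cmod (\<Sum>i<n. \<Sum>j<n. cnj (v i) * (B i j - A i j) * v j)"
        by (simp add: qform_eq sum_subtractf algebra_simps)
      also have "\<dots> \<le> (\<Sum>i<n. \<Sum>j<n. cmod (v i) * cmod (B i j - A i j) * cmod (v j))"
        by (intro order_trans[OF norm_sum] sum_mono) (simp add: norm_mult)
      also have "\<dots> \<le> (\<Sum>i<n. \<Sum>j<n. (\<beta> * sqrt Q) * cmod (B i j - A i j) * (\<beta> * sqrt Q))"
        using \<beta>0 Q by (intro sum_mono mult_mono v) (auto intro!: mult_nonneg_nonneg)
      also have "\<dots> = (\<beta> * sqrt Q) * (\<beta> * sqrt Q) * ?s"
        by (simp only: sum_distrib_left mult_ac)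
      also have "(\<beta> * sqrt Q) * (\<beta> * sqrt Q) = \<beta>\<^sup>2 * Q"
        using Q by (simp add: power2_eq_square mult_ac)
      also have "\<beta>\<^sup>2 * Q * ?s \<le> \<beta>\<^sup>2 * Q * (1 / (1 + \<beta>\<^sup>2))"
        using Q B(2) by (intro mult_left_mono) auto
      also have "\<dots> < Q"
      proof -
        have "0 < 1 + \<beta>\<^sup>2" by (simp add: add_pos_nonneg)
        then show ?thesis using Q by (simp add: field_simps)
      qed
      finally have "cmod (qform B v - qform A v) < Q" .
      moreover have "\<bar>Re (qform B v - qform A v)\<bar> \<le> cmod (qform B v - qform A v)"
        by (rule abs_Re_le_cmod)
      ultimately show "0 < Re (qform B v)" unfolding qA by simp
    qed
  qed
qed

lemma posdef_add: "posdef n A \<Longrightarrow> posdef n B \<Longrightarrow> A \<in> Mat \<Longrightarrow> B \<in> Mat \<Longrightarrow> posdef n (A + B)"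
proof (rule posdefI)
  assume A: "posdef n A" "A \<in> Mat" and B: "posdef n B" "B \<in> Mat"
  show "adj (A + B) = A + B" using posdef_adj[OF A] posdef_adj[OF B] by simp
  fix v :: "nat \<Rightarrow> complex" and i assume v: "i < n" "v i \<noteq> 0"
  have "qform (A + B) v = qform A v + qform B v"
    by (simp add: qform_eq algebra_simps sum.distrib)
  then show "0 < Re (qform (A + B) v)"
    using posdef_qform[OF A(1), of i v] posdef_qform[OF B(1), of i v] v by simp
qed

lemma posdef_scale: "posdef n A \<Longrightarrow> A \<in> Mat \<Longrightarrow> r > 0 \<Longrightarrow> posdef n (of_real r *\<^sub>C A)"
proof (rule posdefI)
  assume A: "posdef n A" "A \<in> Mat" and r: "r > 0"
  show "adj (of_real r *\<^sub>C A) = of_real r *\<^sub>C A" by (simp add: posdef_adj[OF A])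
  fix v :: "nat \<Rightarrow> complex" and i assume v: "i < n" "v i \<noteq> 0"
  have "qform (of_real r *\<^sub>C A) v = of_real r * qform A v"
    by (simp add: qform_eq smul_apply sum_distrib_left mult_ac)
  then show "0 < Re (qform (of_real r *\<^sub>C A) v)"
    using posdef_qform[OF A(1), of i v] v r by simp
qed

lemma minv_scale:
  assumes "nonsing A" "r \<noteq> 0"
  shows "minv (r *\<^sub>C A) = (1 / r) *\<^sub>C minv A"
  by (rule minv_eqI) (use assms in \<open>simp_all add: mm_simps minv_mm smul_simps\<close>)

lemma tr_cnj: "Re (tr A) = Re (tr (adj A))"
  by (simp add: tr_simps)

text \<open>Passing to the adjoint keeps the real part of the trace and reverses the factors; cyclic
  rotation then restores the order. It serves both the metric (K = H) and its inverse (K =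
  Y).\<close>

lemma trace_form_commute:
  assumes "adj K = K"
  shows "Re (tr (K \<star> A \<star> K \<star> adj B)) = Re (tr (K \<star> B \<star> K \<star> adj A))"
proof -
  have "Re (tr (K \<star> A \<star> K \<star> adj B)) = Re (tr (adj (K \<star> A \<star> K \<star> adj B)))"
    by (rule tr_cnj)
  also have "\<dots> = Re (tr (B \<star> (K \<star> adj A \<star> K)))" by (simp add: assms mm_assoc)
  also have "\<dots> = Re (tr ((K \<star> adj A) \<star> (K \<star> B)))" by (subst tr_commute) (simp add: mm_assoc)
  also have "\<dots> = Re (tr (K \<star> B \<star> K \<star> adj A))" by (subst tr_commute) (simp add: mm_assoc)
  finally show ?thesis .
qed

lemma tr_has_vector_derivative:
  assumes "\<And>i j. i < n \<Longrightarrow> j < n \<Longrightarrow> ((\<lambda>t. F t i j) has_vector_derivative F' i j) (at t0 within S)"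
  shows "((\<lambda>t. Re (tr (F t))) has_vector_derivative Re (tr F')) (at t0 within S)"
  unfolding tr_def
  by (intro bounded_linear.has_vector_derivative[OF bounded_linear_Re] has_vector_derivative_sum assms) auto

section \<open>Matrix units and ideals of the Jordan algebra of all matrices\<close>

definition munit :: "nat \<Rightarrow> nat \<Rightarrow> cmat" where
  "munit a b = (\<lambda>i j. if i = a \<and> j = b then 1 else 0)"

lemma munit_Mat [simp]: "a < n \<Longrightarrow> b < n \<Longrightarrow> munit a b \<in> Mat"
  by (auto simp: munit_def Mat_def)

lemma munit_mm_apply:
  assumes "b < n" "i < n" "j < n"
  shows "(munit a b \<star> A) i j = (if i = a then A b j else 0)" "(A \<star> munit b a) i j = (if j = a then A i b else 0)"
proof -
  have "(\<Sum>k<n. munit a b i k * A k j) = (\<Sum>k<n. if k = b then (if i = a then A b j else 0) else 0)"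
    by (intro sum.cong refl) (auto simp: munit_def)
  then show "(munit a b \<star> A) i j = (if i = a then A b j else 0)" using assms by (simp add: mm_apply)
  have "(\<Sum>k<n. A i k * munit b a k j) = (\<Sum>k<n. if k = b then (if j = a then A i b else 0) else 0)"
    by (intro sum.cong refl) (auto simp: munit_def)
  then show "(A \<star> munit b a) i j = (if j = a then A i b else 0)" using assms by (simp add: mm_apply)
qed

lemma munit_munit:
  assumes "a < n" "b < n" "c < n" "d < n"
  shows "munit a b \<star> munit c d = (if b = c then munit a d else 0)"
proof (rule Mat_eqI)
  fix i j assume ij: "i < n" "j < n"
  show "(munit a b \<star> munit c d) i j = (if b = c then munit a d else 0) i j"
    unfolding munit_mm_apply(1)[OF assms(2) ij] by (auto simp: munit_def)
qed (use assms in auto)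

lemma munit_sandwich:
  assumes "a < n" "b < n"
  shows "munit a b \<star> A \<star> munit a b = A b a *\<^sub>C munit a b"
  by (rule Mat_eqI) (use assms in \<open>auto simp: munit_mm_apply smul_apply\<close>, auto simp: munit_def)

text \<open>Jordan products generate the quadratic maps A \<mapsto> C A C. With C a matrix unit such
  a map extracts a single nonzero entry of A, and from one matrix unit all others are reached by
  Jordan products.\<close>

lemma jordan_simple:
  assumes sub: "S \<subseteq> Mat"
    and add: "\<And>A B. A \<in> S \<Longrightarrow> B \<in> S \<Longrightarrow> A + B \<in> S"
    and smul: "\<And>A c. A \<in> S \<Longrightarrow> c *\<^sub>C A \<in> S"
    and jordan: "\<And>A C. A \<in> S \<Longrightarrow> C \<in> Mat \<Longrightarrow> C \<star> A + A \<star> C \<in> S"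
    and A: "A \<in> S" "A \<noteq> 0"
    and ab: "a < n" "b < n"
  shows "munit a b \<in> S"
proof -
  have diff: "A - B \<in> S" if "A \<in> S" "B \<in> S" for A B
    using add[OF that(1) smul[OF that(2), of "- 1"]] by (simp add: smul_simps(7)[symmetric] smul_simps)
  have quad: "C \<star> A \<star> C \<in> S" if "A \<in> S" "C \<in> Mat" for A C
  proof -
    \<comment> \<open>Twice the Jordan product with C minus the one with the square of C leaves 2 C
      A C.\<close>
    have "C \<star> (C \<star> A + A \<star> C) + (C \<star> A + A \<star> C) \<star> C - ((C \<star> C) \<star> A + A \<star> (C \<star> C)) = 2 *\<^sub>C (C \<star> A \<star> C)"
      by (simp add: mm_simps mm_assoc) (simp add: smul_def fun_eq_iff)
    moreover have "C \<star> (C \<star> A + A \<star> C) + (C \<star> A + A \<star> C) \<star> C - ((C \<star> C) \<star> A + A \<star> (C \<star> C)) \<in> S"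
      using that by (intro diff jordan) auto
    ultimately have "(1 / 2) *\<^sub>C 2 *\<^sub>C (C \<star> A \<star> C) \<in> S" using smul by metis
    then show ?thesis by (simp add: smul_simps)
  qed
  obtain i j where "A i j \<noteq> 0" using A(2) by (auto simp: fun_eq_iff)
  then have ij: "i < n" "j < n" "A i j \<noteq> 0"
    using sub A(1) Mat_zero[of A i j] by (auto simp: not_less[symmetric])
  have "munit j i \<in> S"
  proof -
    have "munit j i \<star> A \<star> munit j i \<in> S" using quad A ij by simp
    then have "(1 / A i j) *\<^sub>C (A i j *\<^sub>C munit j i) \<in> S"
      by (intro smul[of "A i j *\<^sub>C munit j i"]) (simp add: munit_sandwich ij)
    then show ?thesis using ij by (simp add: smul_simps)
  qed
  \<comment> \<open>If the unit found is off-diagonal, its Jordan product with the transposed unit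
    is the sum of two diagonal units, and compression by one of them separates it.\<close>
  have diag: "munit j j \<in> S"
  proof (cases "i = j")
    case True
    then show ?thesis using \<open>munit j i \<in> S\<close> by simp
  next
    case False
    have "munit i j \<star> munit j i + munit j i \<star> munit i j \<in> S"
      by (rule jordan) (use ij \<open>munit j i \<in> S\<close> in auto)
    then have "munit i i + munit j j \<in> S" using ij by (simp add: munit_munit)
    then have "munit j j \<star> (munit i i + munit j j) \<star> munit j j \<in> S" by (rule quad) (use ij in simp)
    then show ?thesis using False ij by (simp add: mm_simps munit_munit)
  qed
  have off: "munit k l \<in> S" if "munit l l \<in> S" "k < n" "l < n" "k \<noteq> l" for k l
    using jordan[OF that(1), of "munit k l"] that by (simp add: munit_munit)
  have off': "munit l k \<in> S" if "munit l l \<in> S" "k < n" "l < n" "k \<noteq> l" for k l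
    using jordan[OF that(1), of "munit l k"] that by (simp add: munit_munit)
  have "munit k k \<in> S" if k: "k < n" for k
  proof (cases "k = j")
    case True
    then show ?thesis using diag by simp
  next
    case False
    have "munit j k \<star> munit k j + munit k j \<star> munit j k \<in> S"
      by (rule jordan[OF off[OF diag]]) (use k ij False in auto)
    then have "(munit j j + munit k k) - munit j j \<in> S" using k ij diag by (intro diff) (simp_all add: munit_munit)
    then show ?thesis by simp
  qed
  then show ?thesis using off ab by (cases "a = b") auto
qed

end

section \<open>The tube domain over the cone of positive definite Hermitian matrices\<close>

definition basis_vector :: "nat \<Rightarrow> nat \<Rightarrow> real" where
  "basis_vector k = (\<lambda>i. if i = k then 1 else 0)"

locale tube = square_matrices +
  assumes n_pos: "0 < n"
begin

text \<open>The entry \<open>(a, b)\<close> of a matrix is the complex coordinate with index \<open>a n + b\<close>.\<close>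

abbreviation "N \<equiv> 2 * (n * n)"

definition mat_of :: "(nat \<Rightarrow> real) \<Rightarrow> cmat" where
  "mat_of x = (\<lambda>a b. if a < n \<and> b < n then Complex (x (2 * (a * n + b))) (x (2 * (a * n + b) + 1)) else 0)"

definition coords :: "cmat \<Rightarrow> nat \<Rightarrow> real" where
  "coords A = (\<lambda>k. if k < N then (if even k then Re else Im) (A (k div 2 div n) (k div 2 mod n)) else 0)"

definition E :: "nat \<Rightarrow> cmat" where
  "E k = mat_of (basis_vector k)"

lemma index_less: "a < n \<Longrightarrow> b < n \<Longrightarrow> a * n + b < n * n"
proof -
  assume ab: "a < n" "b < n"
  have "a * n + b < (a + 1) * n" using ab by simp
  also have "\<dots> \<le> n * n" using ab by (intro mult_le_mono1) simp
  finally show ?thesis .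
qed

lemma index_less_N:
  assumes "a < n" "b < n"
  shows "2 * (a * n + b) < N" "Suc (2 * (a * n + b)) < N"
proof -
  have double: "2 * m < 2 * k" "Suc (2 * m) < 2 * k" if "m < k" for m k :: nat
    using that by simp_all
  show "2 * (a * n + b) < N" "Suc (2 * (a * n + b)) < N"
    by (rule double[OF index_less[OF assms]])+
qed

lemma index_split:
  assumes "k < N"
  shows "k div 2 div n < n" "k div 2 mod n < n" "k div 2 div n * n + k div 2 mod n = k div 2"
proof -
  have "k div 2 < n * n" using assms by auto
  then show "k div 2 div n < n" "k div 2 mod n < n" "k div 2 div n * n + k div 2 mod n = k div 2"
    using n_pos by (simp_all add: less_mult_imp_div_less)
qed

lemma mat_of_Mat [simp]: "mat_of x \<in> Mat"
  by (auto simp: mat_of_def Mat_def)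

lemma E_Mat [simp]: "E k \<in> Mat"
  by (simp add: E_def)

lemma coords_Rn [simp]: "coords A \<in> Rn N"
  by (simp add: coords_def mem_Rn)

lemma mat_of_coords:
  assumes "A \<in> Mat"
  shows "mat_of (coords A) = A"
proof (rule Mat_eqI)
  fix i j assume ij: "i < n" "j < n"
  define m where "m = i * n + j"
  have m: "m div n = i" "m mod n = j" "2 * m < N" "Suc (2 * m) < N"
    using ij index_less_N[OF ij] by (simp_all add: m_def)
  have "mat_of (coords A) i j = Complex (coords A (2 * m)) (coords A (Suc (2 * m)))"
    using ij by (simp add: mat_of_def m_def)
  also have "\<dots> = A i j"
    using m by (simp add: coords_def)
  finally show "mat_of (coords A) i j = A i j" .
qed (use assms in auto)

lemma coords_mat_of:
  assumes "x \<in> Rn N"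
  shows "coords (mat_of x) = x"
proof
  fix k
  show "coords (mat_of x) k = x k"
  proof (cases "k < N")
    case True
    define m where "m = k div 2"
    have m: "m div n < n" "m mod n < n" "m div n * n + m mod n = m"
      using index_split[OF True] by (simp_all only: m_def)
    have k: "k = 2 * m \<or> k = 2 * m + 1" by (auto simp: m_def)
    show ?thesis
      unfolding coords_def mat_of_def m_def[symmetric] using True m k by auto
  next
    case False
    then show ?thesis using assms by (simp add: coords_def mem_Rn)
  qed
qed

lemma mat_of_add: "mat_of (\<lambda>i. x i + y i) = mat_of x + mat_of y"
  and mat_of_diff: "mat_of (\<lambda>i. x i - y i) = mat_of x - mat_of y"
  and mat_of_minus: "mat_of (\<lambda>i. - x i) = - mat_of x"
  and mat_of_scale: "mat_of (\<lambda>i. r * x i) = of_real r *\<^sub>C mat_of x"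
  and mat_of_zero: "mat_of (\<lambda>i. 0) = 0"
  by (auto simp: mat_of_def fun_eq_iff smul_def complex_eq_iff)

lemma mat_of_eq_0: "x \<in> Rn N \<Longrightarrow> mat_of x = 0 \<Longrightarrow> x = (\<lambda>i. 0)"
  using coords_mat_of[of x] by (auto simp: coords_def)

lemma mat_of_upd: "mat_of (x(k := t)) = mat_of x + of_real (t - x k) *\<^sub>C E k"
proof -
  have "x(k := t) = (\<lambda>i. x i + (t - x k) * basis_vector k i)"
    by (auto simp: basis_vector_def fun_eq_iff)
  then show ?thesis by (simp only: mat_of_add mat_of_scale E_def)
qed

lemma mat_of_Jstd: "mat_of (Jstd v) = \<i> *\<^sub>C mat_of v"
  by (auto simp: mat_of_def fun_eq_iff smul_def complex_eq_iff Jstd_def)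

lemma Jstd_Rn: "v \<in> Rn N \<Longrightarrow> Jstd v \<in> Rn N"
proof -
  assume v: "v \<in> Rn N"
  have "Jstd v i = 0" if i: "N \<le> i" for i
  proof (cases "even i")
    case True
    then show ?thesis using i v by (simp add: Jstd_def mem_Rn)
  next
    case False
    then obtain k where k: "i = 2 * k + 1" by (elim oddE)
    then have "n * n \<le> k" using i by linarith
    then have "N \<le> i - 1" using k by simp
    then show ?thesis using False v by (simp add: Jstd_def mem_Rn)
  qed
  then show ?thesis by (simp add: mem_Rn)
qed

lemma E_apply:
  assumes "a < n" "b < n"
  shows "E k a b = (if k = 2 * (a * n + b) then 1 else 0) + (if k = 2 * (a * n + b) + 1 then \<i> else 0)"
  using assms by (auto simp: E_def mat_of_def basis_vector_def complex_eq_iff)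

lemma mat_of_expand: "mat_of v = (\<Sum>k<N. of_real (v k) *\<^sub>C E k)"
proof (rule Mat_eqI)
  have Mat_sum: "(\<Sum>k\<in>K. of_real (v k) *\<^sub>C E k) \<in> Mat" for K
    by (induction K rule: infinite_finite_induct)
       (simp_all only: sum.infinite sum.empty sum.insert Mat_intros E_Mat simp_thms)
  then show "(\<Sum>k<N. of_real (v k) *\<^sub>C E k) \<in> Mat" .
  fix a b assume ab: "a < n" "b < n"
  have app: "(\<Sum>k\<in>K. of_real (v k) *\<^sub>C E k) a b = (\<Sum>k\<in>K. of_real (v k) * E k a b)" for K
    by (induction K rule: infinite_finite_induct) (auto simp: smul_apply)
  have "(\<Sum>k<N. of_real (v k) * E k a b) =
      (\<Sum>k<N. if k = 2 * (a * n + b) then of_real (v k) else 0) + (\<Sum>k<N. if k = 2 * (a * n + b) + 1 then \<i> * of_real (v k) else 0)"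
    unfolding sum.distrib[symmetric] by (rule sum.cong) (auto simp: E_apply[OF ab])
  also have "\<dots> = mat_of v a b"
    using ab index_less_N[OF ab] by (simp add: mat_of_def Complex_eq)
  finally show "mat_of v a b = (\<Sum>k<N. of_real (v k) *\<^sub>C E k) a b"
    unfolding app ..
qed simp

section \<open>Real-linear functionals in the real basis \<open>E k\<close>\<close>

definition rlin :: "(cmat \<Rightarrow> real) \<Rightarrow> bool" where
  "rlin L \<longleftrightarrow> (\<forall>A B. L (A + B) = L A + L B) \<and> (\<forall>r A. L (of_real r *\<^sub>C A) = r * L A)"

lemma rlin_mat_of:
  assumes L: "rlin L"
  shows "L (mat_of v) = (\<Sum>k<N. v k * L (E k))"
proof -
  have "L (of_real 0 *\<^sub>C 0) = 0 * L 0" using L unfolding rlin_def by blast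
  then have L0: "L 0 = 0" by (simp add: smul_simps)
  have "L (\<Sum>k\<in>K. of_real (v k) *\<^sub>C E k) = (\<Sum>k\<in>K. v k * L (E k))" for K
    by (induction K rule: infinite_finite_induct)
       (use L in \<open>simp_all only: sum.infinite sum.empty sum.insert L0 rlin_def simp_thms\<close>)
  then show ?thesis unfolding mat_of_expand .
qed

text \<open>The matrices \<open>E k\<close> are orthonormal for Re tr (A \<open>adj B\<close>), so
  coordinates are inner products with them. This is what turns index sums into traces.\<close>

lemma coords_eq_tr: "A \<in> Mat \<Longrightarrow> k < N \<Longrightarrow> coords A k = Re (tr (A \<star> adj (E k)))"
proof -
  assume A: "A \<in> Mat" and k: "k < N"
  define m where "m = k div 2"
  have m: "m div n < n" "m mod n < n" "m div n * n + m mod n = m"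
    using index_split[OF k] by (simp_all only: m_def)
  have k2: "k = 2 * m \<or> k = 2 * m + 1" by (auto simp: m_def)
  have inj: "a * n + b = m \<longleftrightarrow> a = m div n \<and> b = m mod n" if "b < n" for a b
    using that m(3) by auto
  have E: "E k a b = (if b = m mod n then if a = m div n then (if even k then 1 else \<i>) else 0 else 0)" if "a < n" "b < n" for a b
    unfolding E_apply[OF that] using k2 inj[OF that(2), of a] by auto
  have "tr (A \<star> adj (E k)) = (\<Sum>a<n. \<Sum>b<n. A a b * cnj (E k a b))"
    by (simp add: tr_def mm_apply adj_apply)
  also have "\<dots> = (\<Sum>a<n. \<Sum>b<n. if b = m mod n then if a = m div n then A a b * cnj (if even k then 1 else \<i>) else 0 else 0)"
    by (intro sum.cong refl) (simp add: E)
  also have "\<dots> = A (m div n) (m mod n) * cnj (if even k then 1 else \<i>)"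
    using m by simp
  finally show ?thesis using k by (auto simp: coords_def m_def)
qed

lemma coords_E: "i < N \<Longrightarrow> j < N \<Longrightarrow> coords (E i) j = (if i = j then 1 else 0)"
  unfolding E_def by (subst coords_mat_of) (auto simp: basis_vector_def mem_Rn)

lemma rlin_intros:
  "rlin (\<lambda>A. Re (tr (P \<star> A \<star> Q)))" "rlin (\<lambda>A. Re (tr (P \<star> Q \<star> adj A)))"
  "rlin (\<lambda>A. Re (tr (P \<star> Q \<star> R \<star> adj A)))" "rlin (\<lambda>A. Re (tr (P \<star> adj A)))"
  by (simp_all add: rlin_def mm_simps tr_simps)

lemma sum_coords_coords:
  assumes "A \<in> Mat" "B \<in> Mat"
  shows "(\<Sum>k<N. coords A k * coords B k) = Re (tr (A \<star> adj B))"
proof -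
  have "Re (tr (A \<star> adj (mat_of (coords B)))) = (\<Sum>k<N. coords B k * Re (tr (A \<star> adj (E k))))"
    by (rule rlin_mat_of[OF rlin_intros(4)])
  then show ?thesis
    unfolding mat_of_coords[OF assms(2)] by (simp add: coords_eq_tr[OF assms(1)] mult.commute)
qed

section \<open>The domain with its invariant metric\<close>

definition Ymat :: "(nat \<Rightarrow> real) \<Rightarrow> cmat" where
  "Ymat x = im_part (mat_of x)"

definition Hmat :: "(nat \<Rightarrow> real) \<Rightarrow> cmat" where
  "Hmat x = minv (Ymat x)"

definition dom :: "(nat \<Rightarrow> real) set" where
  "dom = {x \<in> Rn N. posdef n (Ymat x)}"

definition ip :: "(nat \<Rightarrow> real) \<Rightarrow> cmat \<Rightarrow> cmat \<Rightarrow> real" where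
  "ip x A B = Re (tr (Hmat x \<star> A \<star> Hmat x \<star> adj B))"

definition gmet :: "(nat \<Rightarrow> real) \<Rightarrow> nat \<Rightarrow> nat \<Rightarrow> real" where
  "gmet x i j = ip x (E i) (E j)"

lemma Ymat_Mat [simp]: "Ymat x \<in> Mat"
  by (simp add: Ymat_def)

lemma Hmat_Mat [simp]: "Hmat x \<in> Mat"
  by (simp add: Hmat_def)

lemma dom_posdef: "x \<in> dom \<Longrightarrow> posdef n (Ymat x)"
  and dom_Rn: "x \<in> dom \<Longrightarrow> x \<in> Rn N"
  by (simp_all add: dom_def)

lemma dom_nonsing: "x \<in> dom \<Longrightarrow> nonsing (Ymat x)"
  by (rule posdef_nonsing[OF dom_posdef])

lemma adj_Ymat [simp]: "adj (Ymat x) = Ymat x"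
  by (simp add: Ymat_def im_part_hermitian)

lemma adj_Hmat: "x \<in> dom \<Longrightarrow> adj (Hmat x) = Hmat x"
  unfolding Hmat_def by (rule posdef_minv[OF dom_posdef Ymat_Mat])

lemma YH:
  assumes "x \<in> dom"
  shows "Ymat x \<star> Hmat x = idm" "Hmat x \<star> Ymat x = idm"
    "Ymat x \<star> Hmat x \<star> A \<star> B = A \<star> B" "Hmat x \<star> Ymat x \<star> A \<star> B = A \<star> B"
    "A \<in> Mat \<Longrightarrow> Ymat x \<star> Hmat x \<star> A = A" "A \<in> Mat \<Longrightarrow> Hmat x \<star> Ymat x \<star> A = A"
    "C \<star> Ymat x \<star> Hmat x \<star> A = C \<star> A" "C \<star> Hmat x \<star> Ymat x \<star> A = C \<star> A"
  unfolding Hmat_def using minv_mm[OF dom_nonsing[OF assms]] minv_cancel[OF dom_nonsing[OF assms]] by simp_all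

lemma ip_simps:
  "ip x (A + B) C = ip x A C + ip x B C" "ip x C (A + B) = ip x C A + ip x C B"
  "ip x (A - B) C = ip x A C - ip x B C" "ip x C (A - B) = ip x C A - ip x C B"
  "ip x (of_real r *\<^sub>C A) B = r * ip x A B" "ip x A (of_real r *\<^sub>C B) = r * ip x A B"
  "ip x 0 A = 0" "ip x A 0 = 0"
  by (simp_all add: ip_def mm_simps tr_simps)

lemma rlin_ip: "rlin (ip x A)" "rlin (\<lambda>A. ip x A B)"
  by (simp_all add: rlin_def ip_simps)

lemma bilin_gmet: "bilin N (gmet x) v w = ip x (mat_of v) (mat_of w)"
proof -
  have "ip x (mat_of v) (mat_of w) = (\<Sum>i<N. v i * ip x (E i) (mat_of w))"
    by (rule rlin_mat_of[OF rlin_ip(2)])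
  also have "\<dots> = (\<Sum>i<N. v i * (\<Sum>j<N. w j * ip x (E i) (E j)))"
    by (simp add: rlin_mat_of[OF rlin_ip(1)])
  also have "\<dots> = bilin N (gmet x) v w"
    by (simp add: bilin_def gmet_def sum_distrib_left mult_ac)
  finally show ?thesis ..
qed

lemma ip_commute: "x \<in> dom \<Longrightarrow> ip x A B = ip x B A"
  unfolding ip_def by (rule trace_form_commute[OF adj_Hmat])

lemma ip_pos: "x \<in> dom \<Longrightarrow> A \<in> Mat \<Longrightarrow> A \<noteq> 0 \<Longrightarrow> 0 < ip x A A"
  unfolding ip_def Hmat_def by (rule tr_posdef[OF dom_posdef Ymat_Mat])

lemma gsmooth_mat_of: "gsmooth K V (\<lambda>x. mat_of x i j)"
proof (cases "i < n \<and> j < n")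
  case True
  then have "(\<lambda>x. mat_of x i j) = (\<lambda>x. of_real (x (2 * (i * n + j))) + \<i> * of_real (x (2 * (i * n + j) + 1)))"
    by (simp add: mat_of_def Complex_eq)
  then show ?thesis
    by (simp only:) (intro gsmooth_add gsmooth_mult gsmooth_const gsmooth_linear[OF bounded_linear_of_real] gsmooth_coord)
next
  case False
  then have "(\<lambda>x. mat_of x i j) = (\<lambda>x. 0)" by (auto simp: mat_of_def)
  then show ?thesis by (simp only: gsmooth_const)
qed

lemma gsmooth_Ymat: "gsmooth K V (\<lambda>x. Ymat x i j)"
proof -
  have "(\<lambda>x. Ymat x i j) = (\<lambda>x. (mat_of x i j - cnj (mat_of x j i)) * (1 / (2 * \<i>)))"
    by (simp only: Ymat_def im_part_apply times_divide_eq_right mult_1_right)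
  then show ?thesis
    by (simp only:) (intro gsmooth_mult gsmooth_diff gsmooth_const gsmooth_linear[OF bounded_linear_cnj] gsmooth_mat_of)
qed

lemma gsmooth_Hmat: "gsmooth K dom (\<lambda>x. Hmat x i j)"
  unfolding Hmat_def by (rule gsmooth_minv[OF dom_nonsing gsmooth_Ymat])

lemma gsmooth_Re: "gsmooth K V f \<Longrightarrow> gsmooth K V (\<lambda>x. Re (f x))"
  by (rule gsmooth_linear[OF bounded_linear_Re])

lemma gsmooth_Im: "gsmooth K V f \<Longrightarrow> gsmooth K V (\<lambda>x. Im (f x))"
  by (rule gsmooth_linear[OF bounded_linear_Im])

lemma gsmooth_coords:
  assumes "\<And>i j. gsmooth K V (\<lambda>x. F x i j)"
  shows "gsmooth K V (\<lambda>x. coords (F x) k)"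
  by (cases "k < N"; cases "even k") (simp_all add: coords_def gsmooth_Re gsmooth_Im assms gsmooth_const)

lemma gsmooth_gmet: "gsmooth K dom (\<lambda>x. gmet x i j)"
  unfolding gmet_def ip_def tr_def
  by (intro gsmooth_Re gsmooth_sum gsmooth_mm gsmooth_Hmat gsmooth_const)

lemma dom_open: "openin (Euclidean_space N) dom"
proof (subst openin_subopen, intro ballI)
  fix x assume x: "x \<in> dom"
  obtain \<epsilon> where \<epsilon>: "\<epsilon> > 0"
    "\<And>B. adj B = B \<Longrightarrow> (\<Sum>i<n. \<Sum>j<n. cmod (B i j - Ymat x i j)) < \<epsilon> \<Longrightarrow> posdef n B"
    using posdef_open[OF dom_posdef[OF x] Ymat_Mat] by blast
  define T where "T = {y. (\<Sum>i<n. \<Sum>j<n. cmod (Ymat y i j - Ymat x i j)) < \<epsilon>}"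
  have "continuous_on UNIV (\<lambda>y. Ymat y i j)" for i j
    using gsmooth_Ymat[of 0 UNIV i j] gCk_cont unfolding gsmooth_def by blast
  then have "open T" unfolding T_def
    by (intro open_Collect_less continuous_on_sum continuous_on_norm continuous_on_diff continuous_on_const)
  then have "openin (Euclidean_space N) (Rn N \<inter> T)"
    unfolding Euclidean_space_eq topspace_euclidean_subtopology by (auto simp: openin_open)
  moreover have "x \<in> Rn N \<inter> T" using x \<epsilon>(1) by (simp add: T_def dom_def)
  moreover have "Rn N \<inter> T \<subseteq> dom" using \<epsilon>(2) by (auto simp: T_def dom_def)
  ultimately show "\<exists>S. openin (Euclidean_space N) S \<and> x \<in> S \<and> S \<subseteq> dom" by blast
qed

sublocale onechart_manifold N dom "\<lambda>p. p" "\<lambda>p. p" gmet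
proof
  show "openin (Euclidean_space N) dom" by (rule dom_open)
  show "gsmooth N dom (\<lambda>x. gmet x i j)" for i j by (rule gsmooth_gmet)
  show "gmet x i j = gmet x j i" if "x \<in> dom" for x i j
    unfolding gmet_def by (rule ip_commute[OF that])
  show "0 < bilin N (gmet x) v v" if "x \<in> dom" "v \<in> Rn N" "v \<noteq> (\<lambda>i. 0)" for x v
    unfolding bilin_gmet using mat_of_eq_0[OF that(2)] that(3) by (intro ip_pos[OF that(1)]) auto
qed simp_all

lemma ip_Jstd: "ip x (mat_of (Jstd v)) (mat_of (Jstd w)) = ip x (mat_of v) (mat_of w)"
  by (simp add: ip_def mat_of_Jstd mm_simps tr_simps smul_simps)

lemma hermitian: "hermitian_manifold M"
  unfolding hermitian_manifold_def
proof (intro conjI)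
  show "holomorphic_reps M M (\<lambda>p. p)"
    unfolding holomorphic_reps_def using identity_differential Jstd_Rn by auto
qed (use riemannian in \<open>auto simp: inner_at_def bilin_gmet ip_Jstd\<close>)

lemma dom_connected: "connected_space (top_of_set dom)"
proof (rule connected_space_segments)
  fix x y and t :: real assume x: "x \<in> dom" and y: "y \<in> dom" and t: "t \<in> {0..1}"
  let ?g = "\<lambda>i. (1 - t) * x i + t * y i"
  have Y: "Ymat ?g = of_real (1 - t) *\<^sub>C Ymat x + of_real t *\<^sub>C Ymat y"
    unfolding Ymat_def mat_of_add mat_of_scale
    by (simp add: im_part_def fun_eq_iff smul_def adj_def field_simps)
  have "posdef n (Ymat ?g)"
  proof (rule posdefI)
    fix v :: "nat \<Rightarrow> complex" and i assume v: "i < n" "v i \<noteq> 0"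
    have eq: "Re (qform (Ymat ?g) v) = (1 - t) * Re (qform (Ymat x) v) + t * Re (qform (Ymat y) v)"
      unfolding Y by (simp add: qform_eq smul_def algebra_simps sum.distrib sum_distrib_left sum_subtractf)
    have p: "Re (qform (Ymat x) v) > 0" "Re (qform (Ymat y) v) > 0"
      using posdef_qform[OF dom_posdef[OF x], of i v] posdef_qform[OF dom_posdef[OF y], of i v] v by simp_all
    show "0 < Re (qform (Ymat ?g) v)"
      unfolding eq using p t by (cases "t = 0") (auto intro!: add_nonneg_pos)
  qed simp
  moreover have "?g \<in> Rn N" using x y by (simp add: dom_def mem_Rn)
  ultimately show "?g \<in> dom" by (simp add: dom_def)
qed

lemma Jstd_coords: "A \<in> Mat \<Longrightarrow> Jstd (coords A) = coords (\<i> *\<^sub>C A)"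
  using coords_mat_of[OF Jstd_Rn[OF coords_Rn], of A] by (simp add: mat_of_Jstd mat_of_coords)

lemma coords_has_vector_derivative:
  assumes "\<And>i j. i < n \<Longrightarrow> j < n \<Longrightarrow> ((\<lambda>t. F t i j) has_vector_derivative F' i j) (at t0 within S)"
  shows "((\<lambda>t. coords (F t) k) has_vector_derivative coords F' k) (at t0 within S)"
proof (cases "k < N")
  case True
  have "((\<lambda>t. F t (k div 2 div n) (k div 2 mod n)) has_vector_derivative F' (k div 2 div n) (k div 2 mod n)) (at t0 within S)"
    by (intro assms index_split True)
  then show ?thesis
    using True by (cases "even k")
      (simp_all add: coords_def bounded_linear.has_vector_derivative[OF bounded_linear_Re]
        bounded_linear.has_vector_derivative[OF bounded_linear_Im])
next
  case False
  then show ?thesis by (simp add: coords_def)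
qed

lemma mat_of_line_derivative: "((\<lambda>t. mat_of (x(k := t)) i j) has_vector_derivative E k i j) (at t0)"
proof -
  have "((\<lambda>t. mat_of x i j + of_real (t - x k) * E k i j) has_vector_derivative 0 + of_real (1 - 0) * E k i j) (at t0)"
    by (intro has_vector_derivative_add has_vector_derivative_const has_vector_derivative_mult_left
        has_vector_derivative_of_real DERIV_diff DERIV_ident DERIV_const)
  then show ?thesis
    unfolding mat_of_upd by (simp add: smul_apply)
qed

lemma coords_linear_sum:
  "(\<Sum>j<N. coords (P \<star> E j \<star> Q) i * v j) = coords (P \<star> mat_of v \<star> Q) i"
proof (cases "i < N")
  case True
  have "rlin (\<lambda>A. coords (P \<star> A \<star> Q) i)"
    unfolding rlin_def
    by (auto simp: mm_simps coords_def smul_apply True)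
  from rlin_mat_of[OF this, of v] show ?thesis by (simp add: mult.commute)
next
  case False
  then show ?thesis by (simp add: coords_def)
qed

end

section \<open>Geodesic symmetries\<close>

text \<open>The geodesic symmetry \<open>Z \<mapsto> X\<^sub>0 - Y\<^sub>0 (Z - X\<^sub>0)\<^sup>-\<^sup>1 Y\<^sub>0\<close> at the point \<open>X\<^sub>0 + i Y\<^sub>0\<close>.\<close>

locale tube_point = tube +
  fixes p :: "nat \<Rightarrow> real"
  assumes p: "p \<in> dom"
begin

abbreviation "Y0 \<equiv> Ymat p"
abbreviation "H0 \<equiv> Hmat p"

definition X0 :: cmat where "X0 = mat_of p - \<i> *\<^sub>C Y0"
definition Wmat :: "(nat \<Rightarrow> real) \<Rightarrow> cmat" where "Wmat x = mat_of x - X0"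
definition Vmat :: "(nat \<Rightarrow> real) \<Rightarrow> cmat" where "Vmat x = minv (Wmat x)"
definition symm :: "(nat \<Rightarrow> real) \<Rightarrow> nat \<Rightarrow> real" where "symm x = coords (X0 - Y0 \<star> Vmat x \<star> Y0)"

lemma X0_Mat [simp]: "X0 \<in> Mat" and W_Mat [simp]: "Wmat x \<in> Mat" and V_Mat [simp]: "Vmat x \<in> Mat"
  by (simp_all add: X0_def Wmat_def Vmat_def)

lemma adj_X0: "adj X0 = X0"
  by (simp add: X0_def Ymat_def im_part_def smul_def fun_eq_iff adj_def field_simps)

lemma im_part_W: "im_part (Wmat x) = Ymat x"
  by (simp add: Wmat_def Ymat_def im_part_def adj_X0)

lemma W_nonsing: "x \<in> dom \<Longrightarrow> nonsing (Wmat x)"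
  by (rule im_posdef_nonsing) (simp add: im_part_W dom_posdef)

lemma mat_of_symm: "mat_of (symm x) = X0 - Y0 \<star> Vmat x \<star> Y0"
  unfolding symm_def by (rule mat_of_coords) simp

lemma W_diff: "Wmat x - adj (Wmat x) = (2 * \<i>) *\<^sub>C Ymat x"
  unfolding im_part_W[symmetric] im_part_def by (simp add: smul_simps)

context
  fixes x assumes x: "x \<in> dom"
begin

lemmas VW = minv_mm[OF W_nonsing[OF x], folded Vmat_def] minv_cancel[OF W_nonsing[OF x], folded Vmat_def]
lemmas VW_adj = minv_mm[OF nonsing_adj[OF W_nonsing[OF x]], unfolded minv_adj[OF W_nonsing[OF x]], folded Vmat_def]
  minv_cancel[OF nonsing_adj[OF W_nonsing[OF x]], unfolded minv_adj[OF W_nonsing[OF x]], folded Vmat_def]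

text \<open>Write V for \<open>Vmat x\<close> and W for \<open>Wmat x\<close>, its inverse. Then
  \<open>adj V\<close> - V can be written with the difference W - \<open>adj W\<close> between
  \<open>adj V\<close> and V, or between V and \<open>adj V\<close>. Both forms are kept: in
  \<open>symm_isometry\<close> each occurrence of \<open>Hmat (symm x)\<close> must cancel against
  the factor next to it, which is V in one case and \<open>adj V\<close> in the other.\<close>

lemma Ymat_symm:
  "Ymat (symm x) = Y0 \<star> adj (Vmat x) \<star> Ymat x \<star> Vmat x \<star> Y0"
  "Ymat (symm x) = Y0 \<star> Vmat x \<star> Ymat x \<star> adj (Vmat x) \<star> Y0"
proof -
  have 1: "Ymat (symm x) = (1 / (2 * \<i>)) *\<^sub>C (Y0 \<star> (adj (Vmat x) - Vmat x) \<star> Y0)"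
    by (simp add: Ymat_def[of "symm x"] im_part_def mat_of_symm adj_X0 mm_simps mm_assoc smul_simps)
  have "adj (Vmat x) \<star> (Wmat x - adj (Wmat x)) \<star> Vmat x = adj (Vmat x) - Vmat x"
    by (simp add: mm_simps VW VW_adj idm_mm)
  then have 2: "adj (Vmat x) - Vmat x = (2 * \<i>) *\<^sub>C (adj (Vmat x) \<star> Ymat x \<star> Vmat x)"
    unfolding W_diff by (simp add: mm_simps)
  have "Vmat x \<star> (Wmat x - adj (Wmat x)) \<star> adj (Vmat x) = adj (Vmat x) - Vmat x"
    by (simp add: mm_simps VW VW_adj idm_mm)
  then have 3: "adj (Vmat x) - Vmat x = (2 * \<i>) *\<^sub>C (Vmat x \<star> Ymat x \<star> adj (Vmat x))"
    unfolding W_diff by (simp add: mm_simps)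
  show "Ymat (symm x) = Y0 \<star> adj (Vmat x) \<star> Ymat x \<star> Vmat x \<star> Y0"
    unfolding 1 2 by (simp add: mm_simps smul_simps mm_assoc)
  show "Ymat (symm x) = Y0 \<star> Vmat x \<star> Ymat x \<star> adj (Vmat x) \<star> Y0"
    unfolding 1 3 by (simp add: mm_simps smul_simps mm_assoc)
qed

lemma Hmat_symm:
  "Hmat (symm x) = H0 \<star> Wmat x \<star> Hmat x \<star> adj (Wmat x) \<star> H0"
  "Hmat (symm x) = H0 \<star> adj (Wmat x) \<star> Hmat x \<star> Wmat x \<star> H0"
proof -
  show "Hmat (symm x) = H0 \<star> Wmat x \<star> Hmat x \<star> adj (Wmat x) \<star> H0"
    unfolding Hmat_def[of "symm x"] Ymat_symm(1)
    by (rule minv_eqI) (simp_all add: mm_assoc YH[OF p] VW VW_adj YH[OF x])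
  show "Hmat (symm x) = H0 \<star> adj (Wmat x) \<star> Hmat x \<star> Wmat x \<star> H0"
    unfolding Hmat_def[of "symm x"] Ymat_symm(2)
    by (rule minv_eqI) (simp_all add: mm_assoc YH[OF p] VW VW_adj YH[OF x])
qed

lemma symm_dom: "symm x \<in> dom"
proof -
  have "posdef n (adj (Vmat x \<star> Y0) \<star> Ymat x \<star> (Vmat x \<star> Y0))"
    unfolding Vmat_def
    by (intro posdef_congruence dom_posdef x Ymat_Mat nonsing_mm nonsing_minv W_nonsing dom_nonsing p)
  then have "posdef n (Ymat (symm x))"
    unfolding Ymat_symm(1) by (simp add: mm_assoc)
  then show ?thesis by (simp add: dom_def symm_def)
qed

lemma W_symm: "Wmat (symm x) = - (Y0 \<star> Vmat x \<star> Y0)"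
  by (simp add: Wmat_def mat_of_symm)

lemma V_symm: "Vmat (symm x) = - (H0 \<star> Wmat x \<star> H0)"
  unfolding Vmat_def[of "symm x"] W_symm
  by (rule minv_eqI) (simp_all add: mm_simps mm_assoc YH[OF p] VW)

lemma symm_symm: "symm (symm x) = x"
  unfolding symm_def[of "symm x"] V_symm
  by (simp add: mm_simps mm_assoc YH[OF p] idm_mm Wmat_def coords_mat_of dom_Rn x)

text \<open>At a fixed point W H0 W = - Y0, that is (W - i Y0) H0 (W + i Y0) = 0. The last factor
  has imaginary part Y + Y0 and is invertible, so W = i Y0. The fixed point is unique in the whole
  domain, so all of it serves as the isolating neighbourhood.\<close>

lemma symm_fixed: "symm x = x \<Longrightarrow> x = p"
proof -
  assume fx: "symm x = x"
  have W: "Wmat x = - (Y0 \<star> Vmat x \<star> Y0)" using W_symm unfolding fx .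
  have "Wmat x \<star> H0 \<star> Wmat x = Wmat x \<star> H0 \<star> (- (Y0 \<star> Vmat x \<star> Y0))"
    by (rule arg_cong[OF W])
  also have "\<dots> = - Y0"
    by (simp add: mm_simps YH[OF p] VW)
  finally have WHW: "Wmat x \<star> H0 \<star> Wmat x = - Y0" .
  have "(Wmat x - \<i> *\<^sub>C Y0) \<star> H0 \<star> (Wmat x + \<i> *\<^sub>C Y0) =
      (Wmat x \<star> H0 \<star> Wmat x - \<i> *\<^sub>C Wmat x) + (\<i> *\<^sub>C Wmat x - \<i> *\<^sub>C \<i> *\<^sub>C Y0)"
    by (simp only: mm_simps YH[OF p] idm_mm W_Mat Ymat_Mat smul_simps(2))
  also have "\<dots> = 0"
    unfolding WHW by (simp add: smul_def fun_eq_iff)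
  finally have "(Wmat x - \<i> *\<^sub>C Y0) \<star> H0 \<star> (Wmat x + \<i> *\<^sub>C Y0) = 0" .
  note zero = this
  have "im_part (Wmat x + \<i> *\<^sub>C Y0) = Ymat x + Y0"
  proof -
    have "im_part (Wmat x + \<i> *\<^sub>C Y0) = im_part (Wmat x) + im_part (\<i> *\<^sub>C Y0)"
      by (rule im_part_add)
    also have "im_part (\<i> *\<^sub>C Y0) = Y0"
      unfolding im_part_def adj_simps adj_Ymat by (simp add: smul_def fun_eq_iff)
    finally show ?thesis by (simp only: im_part_W)
  qed
  then have ns: "nonsing (Wmat x + \<i> *\<^sub>C Y0)"
    using posdef_add[OF dom_posdef[OF x] dom_posdef[OF p] Ymat_Mat Ymat_Mat]
    by (intro im_posdef_nonsing) (simp only:)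
  have "((Wmat x - \<i> *\<^sub>C Y0) \<star> H0 \<star> (Wmat x + \<i> *\<^sub>C Y0)) \<star> minv (Wmat x + \<i> *\<^sub>C Y0) \<star> Y0 = (Wmat x - \<i> *\<^sub>C Y0)"
    unfolding mm_assoc minv_cancel(5)[OF ns] by (simp add: minv_cancel[OF ns] YH[OF p] idm_mm)
  then have "Wmat x - \<i> *\<^sub>C Y0 = 0" unfolding zero by (simp only: mm_simps)
  then have "Wmat x = \<i> *\<^sub>C Y0" by (simp only: right_minus_eq)
  then have "mat_of x = X0 + \<i> *\<^sub>C Y0" unfolding Wmat_def by (simp only: diff_eq_eq add.commute)
  then have "coords (mat_of x) = coords (mat_of p)" by (simp only: X0_def diff_add_cancel)
  then show "x = p" unfolding coords_mat_of[OF dom_Rn[OF x]] coords_mat_of[OF dom_Rn[OF p]] .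
qed

text \<open>The sign from differentiating the inverse cancels the sign in the symmetry. The
  differential is complex linear in the direction, which gives holomorphy.\<close>

lemma symm_derivative:
  assumes "j < N"
  shows "((\<lambda>t. symm (x(j := t)) i) has_vector_derivative coords ((Y0 \<star> Vmat x) \<star> E j \<star> (Vmat x \<star> Y0)) i) (at (x j))"
proof -
  have V: "((\<lambda>t. Vmat (x(j := t)) a b) has_vector_derivative (- (Vmat x \<star> E j \<star> Vmat x)) a b) (at (x j))" for a b
    using minv_has_vector_derivative[of "\<lambda>t. Wmat (x(j := t))" "E j" "x j" a b] W_nonsing[OF x]
    by (simp add: Vmat_def Wmat_def has_vector_derivative_diff_const mat_of_line_derivative)
  have "((\<lambda>t. X0 a b - (Y0 \<star> Vmat (x(j := t)) \<star> Y0) a b) has_vector_derivative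
      0 - (0 \<star> Vmat (x(j := x j)) \<star> Y0 + Y0 \<star> (- (Vmat x \<star> E j \<star> Vmat x) \<star> Y0 + Vmat (x(j := x j)) \<star> 0)) a b) (at (x j))" for a b
    by (intro has_vector_derivative_diff has_vector_derivative_const mm_has_vector_derivative V)
       (simp_all)
  then have "((\<lambda>t. (X0 - Y0 \<star> Vmat (x(j := t)) \<star> Y0) a b) has_vector_derivative
      (Y0 \<star> Vmat x \<star> E j \<star> Vmat x \<star> Y0) a b) (at (x j))" for a b
    by (simp add: mm_simps mm_assoc)
  then show ?thesis
    unfolding symm_def by (simp add: mm_assoc coords_has_vector_derivative)
qed

lemma symm_differential:
  "differential N (rep (dom, \<lambda>p. p) (dom, \<lambda>p. p) symm) x v = coords (Y0 \<star> Vmat x \<star> mat_of v \<star> Vmat x \<star> Y0)"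
proof -
  have "differential N (rep (dom, \<lambda>p. p) (dom, \<lambda>p. p) symm) x v =
      (\<lambda>i. \<Sum>j<N. coords ((Y0 \<star> Vmat x) \<star> E j \<star> (Vmat x \<star> Y0)) i * v j)"
    using differential_rep[OF x, of "\<lambda>p. p" symm "\<lambda>j i. coords ((Y0 \<star> Vmat x) \<star> E j \<star> (Vmat x \<star> Y0)) i" dom v]
      symm_derivative by simp
  then show ?thesis
    unfolding coords_linear_sum by (simp add: mm_assoc)
qed

text \<open>One H is expanded with W on its right, the other with \<open>adj W\<close>. What is left
  outside the old inner product is a conjugation, which the trace does not see.\<close>

lemma symm_isometry:
  "B \<in> Mat \<Longrightarrow> ip (symm x) (Y0 \<star> Vmat x \<star> A \<star> Vmat x \<star> Y0) (Y0 \<star> Vmat x \<star> B \<star> Vmat x \<star> Y0) = ip x A B"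
proof -
  assume BM: "B \<in> Mat"
  let ?A = "Y0 \<star> Vmat x \<star> A \<star> Vmat x \<star> Y0" and ?B = "Y0 \<star> adj (Vmat x) \<star> adj B \<star> adj (Vmat x) \<star> Y0"
  have A: "Hmat (symm x) \<star> ?A = H0 \<star> adj (Wmat x) \<star> Hmat x \<star> A \<star> Vmat x \<star> Y0"
    by (simp add: Hmat_symm(2) mm_assoc YH[OF p] VW)
  have B: "Hmat (symm x) \<star> ?B = H0 \<star> Wmat x \<star> Hmat x \<star> adj B \<star> adj (Vmat x) \<star> Y0"
    by (simp add: Hmat_symm(1) mm_assoc YH[OF p] VW_adj)
  have "ip (symm x) ?A (Y0 \<star> Vmat x \<star> B \<star> Vmat x \<star> Y0) = Re (tr ((Hmat (symm x) \<star> ?A) \<star> Hmat (symm x) \<star> ?B))"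
    by (simp add: ip_def mm_assoc)
  also have "\<dots> = Re (tr ((H0 \<star> adj (Wmat x)) \<star> (Hmat x \<star> A \<star> Hmat x \<star> adj B \<star> adj (Vmat x) \<star> Y0)))"
    unfolding A B by (simp add: mm_assoc YH[OF p] VW)
  also have "\<dots> = Re (tr (Hmat x \<star> A \<star> Hmat x \<star> adj B))"
    by (subst tr_commute) (simp add: mm_assoc YH[OF p] VW_adj idm_mm BM)
  finally show ?thesis by (simp add: ip_def)
qed

end

lemma gsmooth_symm: "gsmooth N dom (\<lambda>x. symm x i)"
  unfolding symm_def
proof (rule gsmooth_coords)
  fix i j
  have "gsmooth N dom (\<lambda>x. mat_of x a b - X0 a b)" for a b
    by (intro gsmooth_diff gsmooth_mat_of gsmooth_const)
  then have "gsmooth N dom (\<lambda>x. Vmat x a b)" for a b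
    unfolding Vmat_def by (intro gsmooth_minv W_nonsing) (simp_all add: Wmat_def)
  then have "gsmooth N dom (\<lambda>x. X0 i j - (Y0 \<star> Vmat x \<star> Y0) i j)"
    by (intro gsmooth_diff gsmooth_mm gsmooth_const)
  then show "gsmooth N dom (\<lambda>x. (X0 - Y0 \<star> Vmat x \<star> Y0) i j)" by simp
qed

lemma symm_cont: "continuous_on dom symm"
proof (rule continuous_on_coordinatewise_then_product)
  show "continuous_on dom (\<lambda>x. symm x i)" for i
    using gsmooth_symm[of i] gCk_cont unfolding gsmooth_def by blast
qed

lemma symm_point: "symm p = p"
proof -
  have "Wmat p = \<i> *\<^sub>C Y0" by (simp add: Wmat_def X0_def)
  then have "Vmat p = (- \<i>) *\<^sub>C H0"
    unfolding Vmat_def by (intro minv_eqI) (simp_all add: mm_simps smul_simps YH[OF p])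
  then have "Y0 \<star> Vmat p \<star> Y0 = (- \<i>) *\<^sub>C Y0"
    by (simp add: mm_simps YH[OF p] idm_mm)
  then have "symm p = coords (mat_of p)"
    unfolding symm_def X0_def by (simp add: smul_def fun_diff_def)
  then show ?thesis by (simp add: coords_mat_of dom_Rn p)
qed

lemma geodesic_symmetry:
  "\<exists>s. smooth_map M M s \<and> preserves_metric M M s \<and> holomorphic_reps M M s \<and>
     (\<forall>q\<in>topspace (space_of M). s (s q) = q) \<and>
     s p = p \<and> (\<exists>U. openin (space_of M) U \<and> p \<in> U \<and> (\<forall>q\<in>U. s q = q \<longrightarrow> q = p))"
proof (intro exI[of _ symm] conjI)
  show "smooth_map M M symm"
    by (rule smooth_mapI) (use symm_cont symm_dom gsmooth_symm in auto)
  show "preserves_metric M M symm"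
    unfolding preserves_metric_def
    by (auto simp: inner_at_def symm_differential bilin_gmet mat_of_coords symm_isometry)
  show "holomorphic_reps M M symm"
    unfolding holomorphic_reps_def
    by (auto simp: symm_differential mat_of_Jstd Jstd_coords mm_simps)
  show "\<forall>q\<in>topspace (space_of M). symm (symm q) = q" using symm_symm by simp
  show "symm p = p" by (rule symm_point)
  show "\<exists>U. openin (space_of M) U \<and> p \<in> U \<and> (\<forall>q\<in>U. symm q = q \<longrightarrow> q = p)"
    using symm_fixed p by (intro exI[of _ dom]) auto
qed

end

lemma (in tube) hermitian_symmetric: "hermitian_symmetric_space M"
  unfolding hermitian_symmetric_space_def
proof (intro conjI ballI)
  show "hermitian_manifold M" by (rule hermitian)
  show "connected_space (space_of M)" using dom_connected by simp
  fix p assume "p \<in> topspace (space_of M)"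
  then interpret tube_point n p by unfold_locales simp
  show "\<exists>s. smooth_map M M s \<and> preserves_metric M M s \<and> holomorphic_reps M M s \<and>
     (\<forall>q\<in>topspace (space_of M). s (s q) = q) \<and>
     s p = p \<and> (\<exists>U. openin (space_of M) U \<and> p \<in> U \<and> (\<forall>q\<in>U. s q = q \<longrightarrow> q = p))"
    by (rule geodesic_symmetry)
qed

section \<open>Levi-Civita connection, curvature and holonomy\<close>

context tube
begin

definition Gam :: "(nat \<Rightarrow> real) \<Rightarrow> cmat \<Rightarrow> cmat \<Rightarrow> cmat" where
  "Gam x A B = (\<i> / 2) *\<^sub>C (A \<star> Hmat x \<star> B + B \<star> Hmat x \<star> A)"

text \<open>The metric dual to Re tr (H A H \<open>adj B\<close>) is the same expression with Y in
  place of H.\<close>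

definition hinv :: "(nat \<Rightarrow> real) \<Rightarrow> nat \<Rightarrow> nat \<Rightarrow> real" where
  "hinv x i j = (if i < N \<and> j < N then Re (tr (Ymat x \<star> E i \<star> Ymat x \<star> adj (E j))) else 0)"

definition tr3 :: "(nat \<Rightarrow> real) \<Rightarrow> cmat \<Rightarrow> cmat \<Rightarrow> cmat \<Rightarrow> complex" where
  "tr3 x A B C = tr (Hmat x \<star> A \<star> Hmat x \<star> B \<star> Hmat x \<star> C)"

text \<open>The derivative of the inner product of B and C in direction A: the derivative of H is -
  H (\<open>im_part A\<close>) H, and H occurs twice.\<close>

definition gmet_deriv :: "(nat \<Rightarrow> real) \<Rightarrow> cmat \<Rightarrow> cmat \<Rightarrow> cmat \<Rightarrow> real" where
  "gmet_deriv x A B C = - Re (tr3 x (im_part A) B (adj C) + tr3 x B (im_part A) (adj C))"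

lemma Gam_Mat [simp]: "Gam x A B \<in> Mat"
  by (simp add: Gam_def)

lemma tr3_cyclic: "tr3 x A B C = tr3 x B C A"
proof -
  have "tr3 x A B C = tr ((Hmat x \<star> A) \<star> (Hmat x \<star> B \<star> Hmat x \<star> C))"
    by (simp add: tr3_def mm_assoc)
  also have "\<dots> = tr3 x B C A" by (subst tr_commute) (simp add: tr3_def mm_assoc)
  finally show ?thesis .
qed

lemma tr3_adj:
  assumes "x \<in> dom"
  shows "cnj (tr3 x A B C) = tr3 x (adj C) (adj B) (adj A)"
proof -
  have "cnj (tr3 x A B C) = tr (adj (Hmat x \<star> A \<star> Hmat x \<star> B \<star> Hmat x \<star> C))"
    by (simp only: tr3_def tr_simps)
  also have "\<dots> = tr (adj C \<star> (Hmat x \<star> adj B \<star> Hmat x \<star> adj A \<star> Hmat x))"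
    by (simp add: adj_Hmat[OF assms] mm_assoc)
  also have "\<dots> = tr3 x (adj B) (adj A) (adj C)" by (subst tr_commute) (simp add: tr3_def mm_assoc)
  also have "\<dots> = tr3 x (adj C) (adj B) (adj A)" by (rule tr3_cyclic[symmetric])
  finally show ?thesis .
qed

lemma tr3_im_part:
  "tr3 x (im_part A) B C = (1 / (2 * \<i>)) * (tr3 x A B C - tr3 x (adj A) B C)"
  "tr3 x B (im_part A) C = (1 / (2 * \<i>)) * (tr3 x B A C - tr3 x B (adj A) C)"
  by (simp_all only: tr3_def im_part_def mm_simps tr_simps)

text \<open>Expanding each \<open>im_part\<close> gives four traces per derivative. Those containing
  \<open>adj A\<close> or \<open>adj B\<close> cancel in the alternating sum, by cyclicity or by
  complex conjugation. The remaining terms are complex bilinear in A and B, as expected of a Kaehler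
  metric.\<close>

lemma koszul:
  assumes "x \<in> dom"
  shows "gmet_deriv x A B C + gmet_deriv x B A C - gmet_deriv x C A B = 2 * ip x C (Gam x A B)"
proof -
  have Re_half: "Re ((1 / (2 * \<i>)) * z) = Im z / 2" for z
    by simp
  have 1: "tr3 x C A (adj B) = cnj (tr3 x B (adj A) (adj C))" "tr3 x A C (adj B) = cnj (tr3 x (adj A) B (adj C))"
    using tr3_adj[OF assms, of B "adj A" "adj C"] tr3_adj[OF assms, of "adj A" B "adj C"] tr3_cyclic[of x C "adj B" A]
      tr3_cyclic[of x A C "adj B"] by simp_all
  have 2: "tr3 x (adj C) A (adj B) = tr3 x A (adj B) (adj C)" "tr3 x A (adj C) (adj B) = tr3 x (adj B) A (adj C)"
    using tr3_cyclic[of x "adj C" A "adj B"] tr3_cyclic[of x "adj B" A "adj C"] by simp_all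
  have "ip x C (Gam x A B) = Re ((- \<i> / 2) * (tr3 x C (adj B) (adj A) + tr3 x C (adj A) (adj B)))"
    by (simp add: ip_def Gam_def mm_simps tr_simps tr3_def adj_Hmat[OF assms] mm_assoc distrib_left)
  moreover have "tr3 x C (adj B) (adj A) = cnj (tr3 x A B (adj C))" "tr3 x C (adj A) (adj B) = cnj (tr3 x B A (adj C))"
    using tr3_adj[OF assms, of A B "adj C"] tr3_adj[OF assms, of B A "adj C"] by simp_all
  ultimately have "2 * ip x C (Gam x A B) = - Im (tr3 x A B (adj C)) - Im (tr3 x B A (adj C))"
    by (simp add: field_simps)
  moreover have "gmet_deriv x A B C + gmet_deriv x B A C - gmet_deriv x C A B = - Im (tr3 x A B (adj C)) - Im (tr3 x B A (adj C))"
    unfolding gmet_deriv_def tr3_im_part distrib_left[symmetric] Re_half minus_complex.sel plus_complex.sel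
    by (simp only: 1 2 cnj.sel) (simp add: field_simps)
  ultimately show ?thesis by simp
qed

text \<open>The two rows are the coordinate vectors of Y E_i Y and H E_j H. Their contraction is a
  trace in which Y and H cancel, leaving the inner product of two basis matrices.\<close>

lemma hinv_gmet:
  assumes x: "x \<in> dom" and ij: "i < N" "j < N"
  shows "(\<Sum>k<N. hinv x i k * gmet x k j) = (if i = j then 1 else 0)"
proof -
  have h: "hinv x i k = coords (Ymat x \<star> E i \<star> Ymat x) k" if "k < N" for k
    using that ij by (simp add: hinv_def coords_eq_tr mm_assoc)
  have g: "gmet x k j = coords (Hmat x \<star> E j \<star> Hmat x) k" if "k < N" for k
    using that by (simp only: gmet_def ip_commute[OF x, of "E k" "E j"]) (simp add: ip_def coords_eq_tr mm_assoc)
  have "(\<Sum>k<N. hinv x i k * gmet x k j) = Re (tr ((Ymat x \<star> E i \<star> Ymat x) \<star> adj (Hmat x \<star> E j \<star> Hmat x)))"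
    by (subst sum_coords_coords[symmetric]) (auto intro!: sum.cong simp: h g)
  also have "\<dots> = Re (tr (Ymat x \<star> (E i \<star> adj (E j) \<star> Hmat x)))"
    by (simp add: mm_assoc adj_Hmat[OF x] YH[OF x])
  also have "\<dots> = Re (tr (E i \<star> adj (E j)))"
    by (subst tr_commute) (simp add: mm_assoc YH[OF x] idm_mm)
  also have "\<dots> = (if i = j then 1 else 0)"
    using coords_E[OF ij] by (simp add: coords_eq_tr ij)
  finally show ?thesis .
qed

lemma Ymat_line_derivative:
  "((\<lambda>t. Ymat (x(k := t)) i j) has_vector_derivative im_part (E k) i j) (at t0)"
proof -
  have "((\<lambda>t. (1 / (2 * \<i>)) * (mat_of (x(k := t)) i j - cnj (mat_of (x(k := t)) j i)))
      has_vector_derivative (1 / (2 * \<i>)) * (E k i j - cnj (E k j i))) (at t0)"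
    by (intro has_vector_derivative_mult_right has_vector_derivative_diff has_vector_derivative_cnj mat_of_line_derivative)
  then show ?thesis
    unfolding Ymat_def im_part_def smul_apply adj_apply minus_apply .
qed

lemma Hmat_line_derivative:
  assumes "x \<in> dom"
  shows "((\<lambda>t. Hmat (x(k := t)) i j) has_vector_derivative (- (Hmat x \<star> im_part (E k) \<star> Hmat x)) i j) (at (x k))"
  using minv_has_vector_derivative[of "\<lambda>t. Ymat (x(k := t))" "im_part (E k)" "x k" i j]
    Ymat_line_derivative dom_nonsing[OF assms]
  by (simp add: Hmat_def)

lemma gmet_derivative:
  assumes x: "x \<in> dom"
  shows "((\<lambda>t. gmet (x(i := t)) j l) has_vector_derivative gmet_deriv x (E i) (E j) (E l)) (at (x i))"
proof -
  let ?H' = "- (Hmat x \<star> im_part (E i) \<star> Hmat x)"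
  have "((\<lambda>t. Re (tr (Hmat (x(i := t)) \<star> E j \<star> Hmat (x(i := t)) \<star> adj (E l)))) has_vector_derivative
      Re (tr (?H' \<star> (E j \<star> Hmat (x(i := x i)) \<star> adj (E l)) + Hmat (x(i := x i)) \<star> (0 \<star> (Hmat (x(i := x i)) \<star> adj (E l))
        + E j \<star> (?H' \<star> adj (E l) + Hmat (x(i := x i)) \<star> 0))))) (at (x i))"
    by (intro tr_has_vector_derivative mm_has_vector_derivative Hmat_line_derivative x) simp_all
  also have "Re (tr (?H' \<star> (E j \<star> Hmat (x(i := x i)) \<star> adj (E l)) + Hmat (x(i := x i)) \<star> (0 \<star> (Hmat (x(i := x i)) \<star> adj (E l))
        + E j \<star> (?H' \<star> adj (E l) + Hmat (x(i := x i)) \<star> 0)))) = gmet_deriv x (E i) (E j) (E l)"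
    by (simp add: mm_simps tr_simps mm_assoc gmet_deriv_def tr3_def)
  finally show ?thesis unfolding gmet_def ip_def .
qed

lemma christoffel_tube:
  assumes x: "x \<in> dom" and k: "k < N" and i: "i < N" and j: "j < N"
  shows "christoffel M c k i j x = coords (Gam x (E i) (E j)) k"
proof (rule christoffel_eqI[where h = "hinv x" and G = "\<lambda>i j l. gmet_deriv x (E i) (E j) (E l)"])
  show "hinv x i j = 0" if "N \<le> i \<or> N \<le> j" for i j
    using that by (auto simp: hinv_def)
  show "(\<Sum>k<N. hinv x i k * gmet x k j) = (if i = j then 1 else 0)" if "i < N" "j < N" for i j
    by (rule hinv_gmet[OF x that])
  show "gmet x i j = gmet x j i" for i j
    unfolding gmet_def by (rule ip_commute[OF x])
  show "hinv x i j = hinv x j i" for i j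
    unfolding hinv_def using trace_form_commute[OF adj_Ymat, of x "E i" "E j"] by auto
  show "((\<lambda>t. gmet (x(i := t)) j l) has_vector_derivative gmet_deriv x (E i) (E j) (E l)) (at (x i))" for i j l
    by (rule gmet_derivative[OF x])
  fix l assume "l < N"
  have "gmet_deriv x (E i) (E j) (E l) + gmet_deriv x (E j) (E i) (E l) - gmet_deriv x (E l) (E i) (E j) = 2 * ip x (E l) (mat_of (coords (Gam x (E i) (E j))))"
    by (simp add: koszul[OF x] mat_of_coords)
  also have "\<dots> = 2 * (\<Sum>m<N. gmet x l m * coords (Gam x (E i) (E j)) m)"
    by (simp add: rlin_mat_of[OF rlin_ip(1)] gmet_def mult.commute)
  finally show "gmet_deriv x (E i) (E j) (E l) + gmet_deriv x (E j) (E i) (E l) - gmet_deriv x (E l) (E i) (E j)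
      = 2 * (\<Sum>m<N. gmet x l m * coords (Gam x (E i) (E j)) m)" .
qed (use k i j in auto)

lemma Gam_add: "Gam x (A + B) C = Gam x A C + Gam x B C" "Gam x C (A + B) = Gam x C A + Gam x C B"
  by (simp_all only: Gam_def mm_simps smul_simps(1) add_ac)

lemma Gam_smul: "Gam x (c *\<^sub>C A) B = c *\<^sub>C Gam x A B" "Gam x A (c *\<^sub>C B) = c *\<^sub>C Gam x A B"
  by (simp_all only: Gam_def mm_simps smul_simps(1,5) mult.commute)

lemma coords_add: "coords (A + B) k = coords A k + coords B k"
  and coords_of_real: "coords (of_real r *\<^sub>C A) k = r * coords A k"
  by (simp_all add: coords_def smul_apply)

lemma rlin_Gam: "rlin (\<lambda>A. coords (Gam x A B) k)" "rlin (\<lambda>A. coords (Gam x B A) k)"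
  by (simp_all only: rlin_def Gam_add Gam_smul coords_add coords_of_real simp_thms)

lemma christoffel_sum:
  assumes x: "x \<in> dom" and k: "k < N"
  shows "(\<Sum>i<N. \<Sum>j<N. christoffel M c k i j x * u i * w j) = coords (Gam x (mat_of u) (mat_of w)) k"
proof -
  have 1: "coords (Gam x (mat_of u) (mat_of w)) k = (\<Sum>i<N. u i * coords (Gam x (E i) (mat_of w)) k)"
    by (rule rlin_mat_of[where L = "\<lambda>A. coords (Gam x A (mat_of w)) k", OF rlin_Gam(1)])
  have 2: "coords (Gam x (E i) (mat_of w)) k = (\<Sum>j<N. w j * coords (Gam x (E i) (E j)) k)" for i
    by (rule rlin_mat_of[where L = "\<lambda>A. coords (Gam x (E i) A) k", OF rlin_Gam(2)])
  have "coords (Gam x (mat_of u) (mat_of w)) k = (\<Sum>i<N. u i * (\<Sum>j<N. w j * coords (Gam x (E i) (E j)) k))"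
    unfolding 1 2 ..
  also have "\<dots> = (\<Sum>i<N. \<Sum>j<N. christoffel M c k i j x * u i * w j)"
    unfolding sum_distrib_left
  proof (intro sum.cong refl)
    fix i j assume "i \<in> {..<N}" "j \<in> {..<N}"
    then have "christoffel M c k i j x = coords (Gam x (E i) (E j)) k"
      by (intro christoffel_tube x k) simp_all
    then show "u i * (w j * coords (Gam x (E i) (E j)) k) = christoffel M c k i j x * u i * w j"
      by (simp only: mult.assoc mult.commute mult.left_commute)
  qed
  finally show ?thesis ..
qed

section \<open>Curvature at the point i times the identity\<close>

definition base :: "nat \<Rightarrow> real" where
  "base = coords (\<i> *\<^sub>C idm)"

lemma Ymat_base: "Ymat base = idm"
proof -
  have eq: "mat_of base = \<i> *\<^sub>C idm" unfolding base_def by (rule mat_of_coords) simp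
  show ?thesis unfolding Ymat_def im_part_def eq adj_simps adj_idm by (simp add: fun_eq_iff smul_def)
qed

lemma Hmat_base: "Hmat base = idm"
  unfolding Hmat_def Ymat_base by (rule minv_eqI) (simp_all add: idm_mm)

lemma posdef_idm: "posdef n idm"
proof (rule posdefI)
  fix v :: "nat \<Rightarrow> complex" and i assume v: "i < n" "v i \<noteq> 0"
  have "qform idm v = (\<Sum>i<n. cnj (v i) * v i)"
    by (simp add: qform_def mv_idm)
  also have "\<dots> = of_real (\<Sum>i<n. (cmod (v i))\<^sup>2)"
    by (simp add: complex_norm_square mult.commute flip: of_real_power)
  finally have "Re (qform idm v) = (\<Sum>i<n. (cmod (v i))\<^sup>2)" by simp
  moreover have "0 < (cmod (v i))\<^sup>2" using v by simp
  moreover have "(cmod (v i))\<^sup>2 \<le> (\<Sum>i<n. (cmod (v i))\<^sup>2)" by (rule member_le_sum) (use v in auto)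
  ultimately show "0 < Re (qform idm v)" by linarith
qed simp

lemma base_dom: "base \<in> dom"
  by (simp add: dom_def Ymat_base posdef_idm) (simp add: base_def)

lemma E0_mm: "E 0 \<star> A \<star> E 0 = A 0 0 *\<^sub>C E 0"
proof (rule Mat_eqI)
  have E0: "E 0 a b = (if a = 0 then if b = 0 then 1 else 0 else 0)" if "a < n" "b < n" for a b
    unfolding E_apply[OF that] using n_pos by auto
  have AE: "(A \<star> E 0) k b = (if b = 0 then A k 0 else 0)" if "k < n" "b < n" for k b
  proof -
    have "(\<Sum>l<n. A k l * E 0 l b) = (\<Sum>l<n. if l = 0 then if b = 0 then A k 0 else 0 else 0)"
      by (intro sum.cong refl) (use that in \<open>auto simp: E0\<close>)
    then show ?thesis using that n_pos by (simp add: mm_apply)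
  qed
  fix a b assume ab: "a < n" "b < n"
  have "(\<Sum>k<n. E 0 a k * (A \<star> E 0) k b) = (\<Sum>k<n. if k = 0 then E 0 a 0 * (A \<star> E 0) 0 b else 0)"
    by (intro sum.cong refl) (use ab in \<open>auto simp: E0\<close>)
  then show "(E 0 \<star> A \<star> E 0) a b = (A 0 0 *\<^sub>C E 0) a b"
    using ab n_pos by (simp add: mm_apply[of a b] smul_apply AE E0)
qed simp_all

lemma E1: "E 1 = \<i> *\<^sub>C E 0"
proof (rule Mat_eqI)
  fix a b assume ab: "a < n" "b < n"
  have eq: "(1 = 2 * m) = False" "(1 = 2 * m + 1) = (m = 0)" "(0 = 2 * m) = (m = 0)" "(0 = 2 * m + 1) = False"
    for m :: nat
    by presburger+
  show "E 1 a b = (\<i> *\<^sub>C E 0) a b"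
    unfolding smul_apply E_apply[OF ab] eq by simp
qed simp_all

lemma one_less_N: "1 < N"
proof -
  obtain m where "n = Suc m" using n_pos gr0_implies_Suc by blast
  then show ?thesis by simp
qed

lemma N_pos: "0 < N"
  using n_pos by simp

lemma Gam_E0: "Gam y (a *\<^sub>C E 0) (b *\<^sub>C E 0) = (\<i> * a * b * Hmat y 0 0) *\<^sub>C E 0"
  unfolding Gam_def mm_simps E0_mm by (simp add: smul_def fun_eq_iff algebra_simps)

lemma coords_E0: "coords (c *\<^sub>C E 0) 0 = Re c"
proof -
  have "E 0 0 0 = 1" using n_pos by (simp add: E_apply)
  then show ?thesis using n_pos by (simp add: coords_def smul_apply)
qed

lemma Gam_commute: "Gam x A B = Gam x B A"
  by (simp add: Gam_def add.commute)

lemma coords_minus: "coords (- A) k = - coords A k"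
  by (simp add: coords_def)

text \<open>The component belongs to the complex line spanned by \<open>E 0\<close> and
  \<open>E 1\<close>, which is \<open>E 0\<close> times i. \<open>E0_mm\<close> keeps Gam on this
  line inside it. The symbol with indices 0, 1, 1 vanishes identically and the quadratic terms
  cancel, so only the derivative of the symbol with indices 0, 0, 1 survives.\<close>

lemma curvature_base: "curvature M c 0 1 0 1 base = - 1"
proof -
  have E0: "E 0 = 1 *\<^sub>C E 0" by (simp add: smul_simps)
  have N: "0 < N" "1 < N" by (rule N_pos, rule one_less_N)
  have \<Gamma>11: "christoffel M c 0 1 1 y = 0" if y: "y \<in> dom" for y
  proof -
    have "Hmat y 0 0 = cnj (Hmat y 0 0)"
      using fun_cong[OF fun_cong[OF adj_Hmat[OF y], of 0], of 0] by (simp only: adj_apply)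
    from arg_cong[OF this, of Im] have "Im (Hmat y 0 0) = 0" by simp
    then show ?thesis
      unfolding christoffel_tube[OF y N(1) N(2) N(2)] E1 Gam_E0 coords_E0 by simp
  qed
  have \<Gamma>01: "christoffel M c 0 0 1 y = - Re (Hmat y 0 0)" if "y \<in> dom" for y
    unfolding christoffel_tube[OF that N(1) N(1) N(2)] E1
    by (subst E0) (simp add: Gam_E0 coords_E0)
  have pd0: "pd 0 (christoffel M c 0 1 1) base = 0"
    by (rule pd_eqI, rule has_vector_derivative_line_cong[OF dom_open base_dom N(1), of "\<lambda>_. 0"])
       (simp_all add: \<Gamma>11 del: One_nat_def)
  \<comment> \<open>The imaginary part of \<open>E 1\<close> is the unit in the corner, and H is the
    identity at \<open>base\<close>; hence the corner entry of H has derivative -1.\<close>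
  have E1': "E 1 0 0 = \<i>" using n_pos by (simp add: E_apply)
  have H': "(- (Hmat base \<star> im_part (E 1) \<star> Hmat base)) 0 0 = - 1"
    using E1' by (simp add: Hmat_base idm_mm im_part_apply del: One_nat_def)
  have pd1: "pd 1 (christoffel M c 0 0 1) base = - Re (- 1)"
    by (rule pd_eqI, rule has_vector_derivative_line_cong[OF dom_open base_dom N(2), of "\<lambda>y. - Re (Hmat y 0 0)"])
       (simp_all only: \<Gamma>01 H'[symmetric] has_vector_derivative_minus Hmat_line_derivative base_dom
         bounded_linear.has_vector_derivative[OF bounded_linear_Re])
  have "Gam base (E 1) (E 1) = - E 1" "Gam base (E 0) (E 1) = - E 0"
    using Gam_E0[of base \<i> \<i>] Gam_E0[of base 1 \<i>] n_pos
    unfolding E1[symmetric] E0[symmetric] by (simp_all add: E1 Hmat_base idm_def del: One_nat_def) (simp_all add: smul_def fun_eq_iff)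
  then have \<Gamma>: "christoffel M c m 1 1 base = - (if 1 = m then 1 else 0)" "christoffel M c m 0 1 base = - (if 0 = m then 1 else 0)"
    if "m < N" for m
    using that N by (simp_all only: christoffel_tube[OF base_dom] coords_minus coords_E)
  have "(\<Sum>m<N. christoffel M c 0 0 m base * christoffel M c m 1 1 base - christoffel M c 0 1 m base * christoffel M c m 0 1 base)
      = (\<Sum>m<N. christoffel M c 0 1 m base * (if 0 = m then 1 else 0) - christoffel M c 0 0 m base * (if 1 = m then 1 else 0))"
    by (intro sum.cong refl) (simp add: \<Gamma> del: One_nat_def)
  also have "\<dots> = christoffel M c 0 1 0 base - christoffel M c 0 0 1 base"
    unfolding sum_subtractf sum_delta_mult using N by (simp del: One_nat_def)
  also have "\<dots> = 0"
    unfolding christoffel_tube[OF base_dom N(1) N(1) N(2)] christoffel_tube[OF base_dom N(1) N(2) N(1)]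
    by (simp add: Gam_commute)
  finally show ?thesis
    unfolding curvature_def onechart_simps pd0 pd1 by simp
qed

lemma not_flat: "\<not> flat M"
proof
  assume "flat M"
  then have "curvature M (dom, \<lambda>p. p) 0 1 0 1 base = 0"
    using base_dom one_less_N N_pos
    by (intro flat_def[THEN iffD1, rule_format, of M "(dom, \<lambda>p. p)" base 0 1 0 1]) simp_all
  then show False unfolding curvature_base by simp
qed

lemma E_munit: "k < N \<Longrightarrow> \<exists>a<n. \<exists>b<n. E k = munit a b \<or> E k = \<i> *\<^sub>C munit a b"
proof -
  assume k: "k < N"
  define m where "m = k div 2"
  have m: "m div n < n" "m mod n < n" "m div n * n + m mod n = m"
    using index_split[OF k] by (simp_all only: m_def)
  have k2: "k = 2 * m \<or> k = 2 * m + 1" by (auto simp: m_def)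
  have inj: "a * n + b = m \<longleftrightarrow> a = m div n \<and> b = m mod n" if "b < n" for a b
    using that m(3) by auto
  have eq: "(2 * m = 2 * m') = (m' = m)" "(2 * m = 2 * m' + 1) = False" "(2 * m + 1 = 2 * m') = False"
    "(2 * m + 1 = 2 * m' + 1) = (m' = m)" for m' by presburger+
  have "E k = munit (m div n) (m mod n) \<or> E k = \<i> *\<^sub>C munit (m div n) (m mod n)"
    using k2
  proof
    assume k: "k = 2 * m"
    have "E k = munit (m div n) (m mod n)"
    proof (rule Mat_eqI)
      fix i j assume ij: "i < n" "j < n"
      show "E k i j = (munit (m div n) (m mod n)) i j"
        unfolding k E_apply[OF ij] smul_apply eq inj[OF ij(2)] munit_def by simp
    qed (use m in simp_all)
    then show ?thesis ..
  next
    assume k: "k = 2 * m + 1"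
    have "E k = \<i> *\<^sub>C munit (m div n) (m mod n)"
    proof (rule Mat_eqI)
      fix i j assume ij: "i < n" "j < n"
      show "E k i j = (\<i> *\<^sub>C munit (m div n) (m mod n)) i j"
        unfolding k E_apply[OF ij] smul_apply eq inj[OF ij(2)] munit_def by simp
    qed (use m in simp_all)
    then show ?thesis ..
  qed
  then show ?thesis using m by blast
qed

section \<open>Spanning sets, and the algebra of the transport maps\<close>

lemma Mat_induct:
  assumes A: "A \<in> Mat"
    and zero: "P 0"
    and add: "\<And>A B. P A \<Longrightarrow> P B \<Longrightarrow> P (A + B)"
    and smul: "\<And>A c. P A \<Longrightarrow> P (c *\<^sub>C A)"
    and munit: "\<And>a b. a < n \<Longrightarrow> b < n \<Longrightarrow> P (munit a b)"
  shows "P A"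
proof -
  have E: "P (E k)" if "k < N" for k
    using E_munit[OF that] munit smul by metis
  have "P (\<Sum>k\<in>K. of_real (coords A k) *\<^sub>C E k)" if "K \<subseteq> {..<N}" for K
    using finite_subset[OF that finite_lessThan] that
  proof (induction K rule: finite_induct)
    case empty
    then show ?case using zero by (simp only: sum.empty)
  next
    case (insert k K)
    have "P (of_real (coords A k) *\<^sub>C E k + (\<Sum>k\<in>K. of_real (coords A k) *\<^sub>C E k))"
      using insert by (intro add smul E) auto
    then show ?case by (simp only: sum.insert[OF insert.hyps])
  qed
  then have "P (mat_of (coords A))" unfolding mat_of_expand by blast
  then show ?thesis by (simp add: mat_of_coords A)
qed

text \<open>Polarisation. It reduces statements that are complex linear in A to Hermitian matrices
  of rank one, the directions in which transport has a closed form.\<close>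

lemma rank_one_span:
  assumes A: "A \<in> Mat"
    and zero: "P 0"
    and add: "\<And>A B. P A \<Longrightarrow> P B \<Longrightarrow> P (A + B)"
    and smul: "\<And>A c. P A \<Longrightarrow> P (c *\<^sub>C A)"
    and rank1: "\<And>v i. i < n \<Longrightarrow> v i \<noteq> 0 \<Longrightarrow> P (\<lambda>i j. if i < n \<and> j < n then v i * cnj (v j) else 0)"
  shows "P A"
proof (rule Mat_induct[OF A zero add smul])
  fix a b assume ab: "a < n" "b < n"
  define r where "r = (\<lambda>v i j. if i < n \<and> j < n then v i * cnj (v j) else (0::complex))"
  define u where "u = (\<lambda>c i. (if i = a then 1 else 0) + (if i = b then c else (0::complex)))"
  have diag: "P (munit a a)" if a: "a < n" for a
  proof -
    have "munit a a = (\<lambda>i j. if i < n \<and> j < n then (if i = a then 1 else 0) * cnj (if j = a then 1 else 0) else 0)"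
      using a by (auto simp: munit_def fun_eq_iff)
    then show ?thesis using rank1[of a "\<lambda>i. if i = a then 1 else 0"] a by simp
  qed
  show "P (munit a b)"
  proof (cases "a = b")
    case True
    then show ?thesis using diag ab by simp
  next
    case False
    have r: "P (r (u c))" for c
      unfolding r_def by (rule rank1[OF ab(1)]) (simp add: u_def False)
    \<comment> \<open>The vectors e_a + e_b and e_a + i e_b separate the entry (a, b) from (b, a);
      both diagonal surpluses have coefficient 1 + i.\<close>
    have eq: "munit a b = (1 / 2) *\<^sub>C (r (u 1) + \<i> *\<^sub>C r (u \<i>) + (- 1 - \<i>) *\<^sub>C munit a a + (- 1 - \<i>) *\<^sub>C munit b b)"
      using ab False by (auto simp: munit_def smul_def r_def u_def fun_eq_iff)
    show ?thesis unfolding eq by (intro smul add r diag ab)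
  qed
qed

text \<open>The expanded product (1 + c A H) V (1 + c H A). If A H A = \<mu> A, then exp (s A H) = 1
  + c A H with c = (exp (s \<mu>) - 1) / \<mu>.\<close>

definition act :: "cmat \<Rightarrow> cmat \<Rightarrow> complex \<Rightarrow> cmat \<Rightarrow> cmat" where
  "act A H c V = V + c *\<^sub>C (A \<star> H \<star> V + V \<star> H \<star> A) + c\<^sup>2 *\<^sub>C (A \<star> H \<star> V \<star> H \<star> A)"

lemma act_Mat [simp]: "V \<in> Mat \<Longrightarrow> act A H c V \<in> Mat"
  by (simp add: act_def)

context
  fixes A H :: cmat and \<mu> :: complex
  assumes AH: "A \<star> H \<star> A = \<mu> *\<^sub>C A" and A: "A \<in> Mat"
begin

lemma AHAH: "A \<star> H \<star> A \<star> B = \<mu> *\<^sub>C (A \<star> B)"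
  using arg_cong[OF AH, of "\<lambda>X. X \<star> B"] by (simp only: mm_assoc mm_simps)

lemma act_commutator:
  "A \<star> H \<star> act A H c V + act A H c V \<star> H \<star> A =
   (1 + \<mu> * c) *\<^sub>C ((A \<star> H \<star> V + V \<star> H \<star> A) + (2 * c) *\<^sub>C (A \<star> H \<star> V \<star> H \<star> A))"
  unfolding act_def mm_simps mm_assoc AHAH AH
  by (simp add: smul_def fun_eq_iff algebra_simps power2_eq_square)

lemma act_quadratic:
  "A \<star> H \<star> act A H c V \<star> H \<star> A = (1 + \<mu> * c)\<^sup>2 *\<^sub>C (A \<star> H \<star> V \<star> H \<star> A)"
  unfolding act_def mm_simps mm_assoc AHAH AH
  by (simp add: smul_def fun_eq_iff algebra_simps power2_eq_square)

text \<open>The composition law says that the factors 1 + \<mu> c multiply, as the exponentials they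
  represent do.\<close>

lemma act_act: "act A H d (act A H c V) = act A H (c + d + \<mu> * c * d) V"
proof -
  have "act A H d (act A H c V) = act A H c V + d *\<^sub>C ((1 + \<mu> * c) *\<^sub>C ((A \<star> H \<star> V + V \<star> H \<star> A) + (2 * c) *\<^sub>C (A \<star> H \<star> V \<star> H \<star> A)))
      + d\<^sup>2 *\<^sub>C ((1 + \<mu> * c)\<^sup>2 *\<^sub>C (A \<star> H \<star> V \<star> H \<star> A))"
    unfolding act_def[of A H d] act_commutator act_quadratic ..
  also have "\<dots> = act A H (c + d + \<mu> * c * d) V"
    unfolding act_def by (simp add: smul_def fun_eq_iff algebra_simps power2_eq_square)
  finally show ?thesis .
qed

end

section \<open>Parallel transport along segments and loops\<close>

lemma continuous_on_coords:
  assumes "\<And>i j. i < n \<Longrightarrow> j < n \<Longrightarrow> continuous_on S (\<lambda>t. F t i j)"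
  shows "continuous_on S (\<lambda>t. coords (F t) k)"
proof (cases "k < N")
  case True
  have "continuous_on S (\<lambda>t. F t (k div 2 div n) (k div 2 mod n))"
    by (intro assms index_split True)
  then show ?thesis
    using True by (cases "even k") (simp_all add: coords_def continuous_on_Re continuous_on_Im)
next
  case False
  then show ?thesis by (simp add: coords_def)
qed

abbreviation "chart \<equiv> (dom, \<lambda>p :: nat \<Rightarrow> real. p)"

lemma transport_curve:
  assumes ab: "a < b"
    and X: "\<And>t. t \<in> {a..b} \<Longrightarrow> coords (X t) \<in> dom"
    and dX: "\<And>t i j. t \<in> {a..b} \<Longrightarrow> ((\<lambda>s. X s i j) has_vector_derivative X' t i j) (at t within {a..b})"
    and cX: "\<And>i j. continuous_on {a..b} (\<lambda>t. X' t i j)"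
    and Mat: "\<And>t. X' t \<in> Mat" "\<And>t. V t \<in> Mat"
    and dV: "\<And>t i j. t \<in> {a..b} \<Longrightarrow> ((\<lambda>s. V s i j) has_vector_derivative (- Gam (coords (X t)) (X' t) (V t)) i j) (at t within {a..b})"
  shows "transport M chart (coords (X a)) (coords (V a)) chart (coords (X b)) (coords (V b))"
proof (rule along_curve[of chart M a b "\<lambda>t. coords (X t)" "\<lambda>t i. coords (X' t) i" "\<lambda>t. coords (V t)"])
  show "((\<lambda>s. coords (X s) i) has_real_derivative coords (X' t) i) (at t within {a..b})" if "t \<in> {a..b}" for t i
    unfolding has_real_derivative_iff_has_vector_derivative
    by (rule coords_has_vector_derivative[OF dX[OF that]])
  show "continuous_on {a..b} (\<lambda>t. coords (X' t) i)" for i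
    by (rule continuous_on_coords[OF cX])
  fix t k assume t: "t \<in> {a..b}" and k: "k < dimen M"
  have "(\<Sum>i<N. \<Sum>j<N. christoffel M chart k i j (coords (X t)) * coords (X' t) i * coords (V t) j) = coords (Gam (coords (X t)) (X' t) (V t)) k"
    using k by (subst christoffel_sum[OF X[OF t]]) (simp_all add: mat_of_coords Mat)
  then show "((\<lambda>s. coords (V s) k) has_real_derivative
      - (\<Sum>i<dimen M. \<Sum>j<dimen M. christoffel M chart k i j (coords (X t)) * coords (X' t) i * coords (V t) j)) (at t within {a..b})"
    unfolding has_real_derivative_iff_has_vector_derivative onechart_simps
    by (simp only: coords_minus[symmetric] coords_has_vector_derivative[OF dV[OF t]])
qed (use ab X in simp_all)

lemma Ymat_coords: "B \<in> Mat \<Longrightarrow> Ymat (coords B) = im_part B"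
  by (simp add: Ymat_def mat_of_coords)

lemma im_part_real: "adj A = A \<Longrightarrow> im_part (of_real t *\<^sub>C A) = 0"
  unfolding im_part_def adj_simps by (simp add: smul_simps)

lemma im_part_imag: "adj A = A \<Longrightarrow> im_part (\<i> *\<^sub>C of_real t *\<^sub>C A) = of_real t *\<^sub>C A"
  unfolding im_part_def adj_simps by (simp add: smul_def fun_eq_iff)

lemma affine_derivative:
  "((\<lambda>s. (B + of_real s *\<^sub>C A) i j) has_vector_derivative A i j) (at t within S)"
proof -
  have "((\<lambda>s. B i j + of_real s * A i j) has_vector_derivative 0 + of_real 1 * A i j) (at t within S)"
    by (intro has_vector_derivative_add has_vector_derivative_const has_vector_derivative_mult_left
        has_vector_derivative_of_real DERIV_ident)
  then show ?thesis by (simp add: smul_apply)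
qed

text \<open>A Hermitian direction leaves Y unchanged, so the transport equation V' = - (i / 2) (A H
  V + V H A) has constant coefficients and V is multiplied by exp (- i t A H / 2) from the left and
  exp (- i t H A / 2) from the right. A negative \<mu> is allowed because the loop also travels in
  direction - A.\<close>

lemma transport_horizontal:
  fixes \<mu> b :: real
  assumes x: "x \<in> dom" and A: "A \<in> Mat" "adj A = A"
    and AH: "A \<star> Hmat x \<star> A = of_real \<mu> *\<^sub>C A" and \<mu>: "\<mu> \<noteq> 0" and b: "b > 0" and V: "V \<in> Mat"
  shows "transport M chart x (coords V) chart (coords (mat_of x + of_real b *\<^sub>C A))
    (coords (act A (Hmat x) ((exp (- (\<i> * of_real (\<mu> * b / 2))) - 1) / of_real \<mu>) V))"
    and "coords (mat_of x + of_real b *\<^sub>C A) \<in> dom" "Ymat (coords (mat_of x + of_real b *\<^sub>C A)) = Ymat x"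
proof -
  have Y: "Ymat (coords (mat_of x + of_real t *\<^sub>C A)) = Ymat x" for t
    by (simp only: Ymat_coords A Mat_intros mat_of_Mat im_part_add im_part_real) (simp add: Ymat_def)
  have d: "coords (mat_of x + of_real t *\<^sub>C A) \<in> dom" for t
    unfolding dom_def by (simp add: Y dom_posdef x)
  define c where "c = (\<lambda>t::real. (exp (- (\<i> * of_real (\<mu> * t / 2))) - 1) / of_real \<mu>)"
  \<comment> \<open>The equation for V reduces to the scalar equation c' = - (i / 2) (1 + \<mu> c)
    with c = 0 at time 0.\<close>
  have dc: "(c has_vector_derivative (- \<i> / 2) * (1 + of_real \<mu> * c t)) (at t within S)" for t S
  proof -
    have "((\<lambda>t. exp (- (\<i> * of_real (\<mu> * t / 2)))) has_vector_derivative
        (- (\<i> * of_real (\<mu> / 2))) * exp (- (\<i> * of_real (\<mu> * t / 2)))) (at t within S)"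
    proof -
      have f: "((\<lambda>z. exp (- (\<i> * of_real (\<mu> / 2)) * z)) has_field_derivative
          exp (- (\<i> * of_real (\<mu> / 2)) * of_real t) * (- (\<i> * of_real (\<mu> / 2)))) (at (of_real t) within of_real ` S)"
        by (rule DERIV_subset[of _ _ _ UNIV]) (auto intro!: derivative_eq_intros)
      have g: "((\<lambda>t. of_real t :: complex) has_vector_derivative 1) (at t within S)"
        using has_vector_derivative_of_real[OF DERIV_ident] by simp
      show ?thesis
        using field_vector_diff_chain_within[OF g f] by (simp add: o_def mult_ac)
    qed
    from has_vector_derivative_mult_right[OF has_vector_derivative_diff_const[THEN iffD2, OF this, of 1], of "1 / of_real \<mu>"]
    show ?thesis using \<mu> by (simp add: c_def field_simps)
  qed
  have c0: "c 0 = 0" by (simp add: c_def)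
  have dV: "((\<lambda>s. act A (Hmat x) (c s) V i j) has_vector_derivative
      (- Gam (coords (mat_of x + of_real t *\<^sub>C A)) A (act A (Hmat x) (c t) V)) i j) (at t within S)" for t S i j
  proof -
    let ?L = "A \<star> Hmat x \<star> V + V \<star> Hmat x \<star> A" and ?Q = "A \<star> Hmat x \<star> V \<star> Hmat x \<star> A"
    let ?c' = "(- \<i> / 2) * (1 + of_real \<mu> * c t)"
    have "((\<lambda>s. V i j + c s * ?L i j + c s * c s * ?Q i j) has_vector_derivative
        0 + ?c' * ?L i j + (c t * ?c' + ?c' * c t) * ?Q i j) (at t within S)"
      by (intro has_vector_derivative_add has_vector_derivative_const has_vector_derivative_mult_left
          has_vector_derivative_mult dc)
    moreover have "(- Gam (coords (mat_of x + of_real t *\<^sub>C A)) A (act A (Hmat x) (c t) V)) i j =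
        0 + ?c' * ?L i j + (c t * ?c' + ?c' * c t) * ?Q i j"
      unfolding Gam_def Hmat_def[of "coords (mat_of x + of_real t *\<^sub>C A)"] Y unfolding Hmat_def[symmetric] act_commutator[OF AH A(1)]
      by (simp add: smul_apply algebra_simps)
    ultimately show ?thesis
      unfolding act_def by (simp add: smul_apply power2_eq_square)
  qed
  have "transport M chart (coords (mat_of x + of_real 0 *\<^sub>C A)) (coords (act A (Hmat x) (c 0) V))
      chart (coords (mat_of x + of_real b *\<^sub>C A)) (coords (act A (Hmat x) (c b) V))"
    by (rule transport_curve[where X = "\<lambda>t. mat_of x + of_real t *\<^sub>C A" and X' = "\<lambda>_. A" and a = 0 and b = b
          and V = "\<lambda>t. act A (Hmat x) (c t) V"])
       (rule b d continuous_on_const A(1) act_Mat[OF V] dV affine_derivative)+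
  moreover have "act A (Hmat x) 0 V = V" by (simp add: act_def smul_simps)
  ultimately show "transport M chart x (coords V) chart (coords (mat_of x + of_real b *\<^sub>C A))
    (coords (act A (Hmat x) ((exp (- (\<i> * of_real (\<mu> * b / 2))) - 1) / of_real \<mu>) V))"
    unfolding c0 by (simp add: smul_simps coords_mat_of dom_Rn x c_def)
  show "coords (mat_of x + of_real b *\<^sub>C A) \<in> dom" "Ymat (coords (mat_of x + of_real b *\<^sub>C A)) = Ymat x"
    by (rule d, rule Y)
qed

text \<open>Along the ray Y is multiplied by y(t), and its inverse by 1 / y(t). The ansatz y(t) V
  makes the connection term constant, so a parallel field grows in proportion to Y.\<close>

lemma transport_vertical:
  fixes s :: real
  assumes x: "x \<in> dom" and s: "s > 0" and V: "V \<in> Mat"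
  shows "transport M chart x (coords V) chart (coords (mat_of x + \<i> *\<^sub>C of_real (s - 1) *\<^sub>C Ymat x)) (coords (of_real s *\<^sub>C V))"
    and "coords (mat_of x + \<i> *\<^sub>C of_real (s - 1) *\<^sub>C Ymat x) \<in> dom"
    and "Ymat (coords (mat_of x + \<i> *\<^sub>C of_real (s - 1) *\<^sub>C Ymat x)) = of_real s *\<^sub>C Ymat x"
proof -
  define B where "B = \<i> *\<^sub>C of_real (s - 1) *\<^sub>C Ymat x"
  have BM: "B \<in> Mat" by (simp add: B_def)
  have VM: "V + of_real t *\<^sub>C (of_real (s - 1) *\<^sub>C V) \<in> Mat" for t by (intro Mat_intros V)
  define y where "y = (\<lambda>t. 1 + t * (s - 1))"
  have y: "y t > 0" if "t \<in> {0..1}" for t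
  proof -
    have "y t = (1 - t) + t * s" by (simp add: y_def algebra_simps)
    then show ?thesis using that s by (cases "t = 0") (auto intro!: add_nonneg_pos)
  qed
  have Y: "Ymat (coords (mat_of x + of_real t *\<^sub>C B)) = of_real (y t) *\<^sub>C Ymat x" for t
  proof -
    have tB: "of_real t *\<^sub>C B = \<i> *\<^sub>C of_real (t * (s - 1)) *\<^sub>C Ymat x"
      by (simp add: B_def smul_def fun_eq_iff)
    have "Ymat (coords (mat_of x + of_real t *\<^sub>C B)) = Ymat x + of_real (t * (s - 1)) *\<^sub>C Ymat x"
      unfolding tB by (simp only: Ymat_coords Ymat_Mat Mat_intros mat_of_Mat im_part_add im_part_imag adj_Ymat) (simp add: Ymat_def)
    then show ?thesis by (simp add: y_def smul_def fun_eq_iff algebra_simps)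
  qed
  have d: "coords (mat_of x + of_real t *\<^sub>C B) \<in> dom" if "t \<in> {0..1}" for t
    unfolding dom_def using y[OF that] by (simp add: Y posdef_scale dom_posdef x)
  have dV: "((\<lambda>u. (V + of_real u *\<^sub>C (of_real (s - 1) *\<^sub>C V)) i j) has_vector_derivative
      (- Gam (coords (mat_of x + of_real t *\<^sub>C B)) B (V + of_real t *\<^sub>C (of_real (s - 1) *\<^sub>C V))) i j) (at t within {0..1})"
    if t: "t \<in> {0..1}" for t i j
  proof -
    have H: "Hmat (coords (mat_of x + of_real t *\<^sub>C B)) = (1 / of_real (y t)) *\<^sub>C Hmat x"
      unfolding Hmat_def Y by (rule minv_scale) (use y[OF t] dom_nonsing[OF x] in auto)
    have eq: "V + of_real t *\<^sub>C (of_real (s - 1) *\<^sub>C V) = of_real (y t) *\<^sub>C V"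
      by (simp add: y_def smul_def fun_eq_iff algebra_simps)
    have "- Gam (coords (mat_of x + of_real t *\<^sub>C B)) B (V + of_real t *\<^sub>C (of_real (s - 1) *\<^sub>C V)) = of_real (s - 1) *\<^sub>C V"
      unfolding eq Gam_def H unfolding B_def mm_simps using y[OF t]
      by (simp add: YH[OF x] idm_mm V) (simp add: smul_def fun_eq_iff)
    then show ?thesis by (simp only: affine_derivative)
  qed
  have "transport M chart (coords (mat_of x + of_real 0 *\<^sub>C B)) (coords (V + of_real 0 *\<^sub>C (of_real (s - 1) *\<^sub>C V)))
      chart (coords (mat_of x + of_real 1 *\<^sub>C B)) (coords (V + of_real 1 *\<^sub>C (of_real (s - 1) *\<^sub>C V)))"
    by (rule transport_curve[where X = "\<lambda>t. mat_of x + of_real t *\<^sub>C B" and X' = "\<lambda>_. B" and a = 0 and b = 1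
          and V = "\<lambda>t. V + of_real t *\<^sub>C (of_real (s - 1) *\<^sub>C V)"])
       (simp_all only: zero_less_one d continuous_on_const BM VM dV affine_derivative)
  moreover have "V + of_real 1 *\<^sub>C (of_real (s - 1) *\<^sub>C V) = of_real s *\<^sub>C V"
    by (simp add: smul_def fun_eq_iff algebra_simps)
  ultimately show "transport M chart x (coords V) chart (coords (mat_of x + \<i> *\<^sub>C of_real (s - 1) *\<^sub>C Ymat x)) (coords (of_real s *\<^sub>C V))"
    unfolding B_def[symmetric] by (simp add: smul_simps coords_mat_of dom_Rn x)
  show "coords (mat_of x + \<i> *\<^sub>C of_real (s - 1) *\<^sub>C Ymat x) \<in> dom"
    using d[of 1] by (simp add: B_def smul_simps)
  show "Ymat (coords (mat_of x + \<i> *\<^sub>C of_real (s - 1) *\<^sub>C Ymat x)) = of_real s *\<^sub>C Ymat x"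
    using Y[of 1] by (simp add: B_def smul_simps y_def)
qed

text \<open>The loop translates by \<open>b A\<close>, doubles the imaginary part, translates back and halves the
  imaginary part again. The two translations do not cancel because they take place at different heights.\<close>

lemma transport_loop:
  fixes \<mu> \<theta> :: real
  assumes x: "x \<in> dom" and A: "A \<in> Mat" "adj A = A"
    and AH: "A \<star> Hmat x \<star> A = of_real \<mu> *\<^sub>C A" and \<mu>: "\<mu> > 0" and \<theta>: "\<theta> > 0" and V: "V \<in> Mat"
  shows "transport M chart x (coords V) chart x (coords (act A (Hmat x) ((exp (- (\<i> * of_real \<theta>)) - 1) / of_real \<mu>) V))"
proof -
  \<comment> \<open>The outward translation contributes the phase - \<mu> b / 2. The return at
    doubled height meets half of H and contributes + \<mu> b / 4. The sum is - \<theta> for this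
    b.\<close>
  define b where "b = 4 * \<theta> / \<mu>"
  have b: "b > 0" using \<mu> \<theta> by (simp add: b_def)
  define c1 where "c1 = (exp (- (\<i> * of_real (\<mu> * b / 2))) - 1) / of_real \<mu>"
  define x1 where "x1 = coords (mat_of x + of_real b *\<^sub>C A)"
  define V1 where "V1 = act A (Hmat x) c1 V"
  have V1: "V1 \<in> Mat" using V by (simp add: V1_def)
  have \<mu>0: "\<mu> \<noteq> 0" using \<mu> by simp
  have t1: "transport M chart x (coords V) chart x1 (coords V1)" and x1: "x1 \<in> dom" and Y1: "Ymat x1 = Ymat x"
    unfolding x1_def V1_def c1_def by (rule transport_horizontal[OF x A AH \<mu>0 b V])+
  define x2 where "x2 = coords (mat_of x1 + \<i> *\<^sub>C of_real (2 - 1) *\<^sub>C Ymat x1)"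
  define V2 where "V2 = of_real 2 *\<^sub>C V1"
  have V2: "V2 \<in> Mat" using V1 by (simp add: V2_def)
  have two: "(2::real) > 0" by simp
  have t2: "transport M chart x1 (coords V1) chart x2 (coords V2)" and x2: "x2 \<in> dom" and Y2: "Ymat x2 = of_real 2 *\<^sub>C Ymat x"
    unfolding x2_def V2_def Y1[symmetric] by (rule transport_vertical[OF x1 two V1])+
  have H2: "Hmat x2 = (1 / of_real 2) *\<^sub>C Hmat x"
    unfolding Hmat_def Y2 by (rule minv_scale) (simp_all add: dom_nonsing x)
  have A': "- A \<in> Mat" "adj (- A) = - A" using A by simp_all
  have "(- A) \<star> Hmat x2 \<star> (- A) = (1 / of_real 2) *\<^sub>C (A \<star> Hmat x \<star> A)"
    unfolding H2 mm_simps by (simp add: smul_def fun_eq_iff)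
  then have AH2: "(- A) \<star> Hmat x2 \<star> (- A) = of_real (- \<mu> / 2) *\<^sub>C (- A)"
    unfolding AH by (simp add: smul_def fun_eq_iff)
  have \<mu>2: "- \<mu> / 2 \<noteq> 0" using \<mu> by simp
  define c2 where "c2 = (exp (- (\<i> * of_real (- \<mu> / 2 * b / 2))) - 1) / of_real (- \<mu> / 2)"
  define x3 where "x3 = coords (mat_of x2 + of_real b *\<^sub>C (- A))"
  define V3 where "V3 = act (- A) (Hmat x2) c2 V2"
  have V3: "V3 \<in> Mat" using V2 by (simp add: V3_def)
  have tr3: "transport M chart x2 (coords V2) chart x3 (coords V3)" and x3: "x3 \<in> dom" and Y3: "Ymat x3 = Ymat x2"
    unfolding x3_def V3_def c2_def by (rule transport_horizontal[OF x2 A' AH2 \<mu>2 b V2])+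
  have half: "(1 / 2 :: real) > 0" by simp
  have t4: "transport M chart x3 (coords V3) chart (coords (mat_of x3 + \<i> *\<^sub>C of_real (1 / 2 - 1) *\<^sub>C Ymat x3)) (coords (of_real (1 / 2) *\<^sub>C V3))"
    by (rule transport_vertical(1)[OF x3 half V3])
  have "mat_of x3 + \<i> *\<^sub>C of_real (1 / 2 - 1) *\<^sub>C Ymat x3 = mat_of x"
  proof -
    have "mat_of x3 = mat_of x2 + of_real b *\<^sub>C (- A)" "mat_of x2 = mat_of x1 + \<i> *\<^sub>C of_real (2 - 1) *\<^sub>C Ymat x1"
      "mat_of x1 = mat_of x + of_real b *\<^sub>C A"
      unfolding x3_def x2_def x1_def by (rule mat_of_coords; simp add: A)+
    then show ?thesis unfolding Y3 Y2 Y1 by (simp add: smul_def fun_eq_iff)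
  qed
  then have x4: "coords (mat_of x3 + \<i> *\<^sub>C of_real (1 / 2 - 1) *\<^sub>C Ymat x3) = x" by (simp add: coords_mat_of dom_Rn x)
  \<comment> \<open>Translation by - A with H / 2 and parameter c2 is the same map as
    \<open>act A (Hmat x) d\<close>, because both signs and both halves can be absorbed into the
    parameter.\<close>
  define d where "d = (exp (\<i> * of_real (\<mu> * b / 4)) - 1) / of_real \<mu>"
  have c2d: "c2 = - 2 * d" using \<mu> by (simp add: c2_def d_def field_simps)
  have "act (- A) ((1 / of_real 2) *\<^sub>C Hmat x) c2 (of_real 2 *\<^sub>C V1) = of_real 2 *\<^sub>C act A (Hmat x) d V1"
    unfolding act_def mm_simps c2d by (simp add: smul_def fun_eq_iff algebra_simps power2_eq_square)
  then have "of_real (1 / 2) *\<^sub>C V3 = act A (Hmat x) d V1"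
    unfolding V3_def V2_def H2 by (simp add: smul_def fun_eq_iff)
  also have "\<dots> = act A (Hmat x) (c1 + d + of_real \<mu> * c1 * d) V"
    unfolding V1_def by (rule act_act[OF AH A(1)])
  also have "c1 + d + of_real \<mu> * c1 * d = (exp (- (\<i> * of_real \<theta>)) - 1) / of_real \<mu>"
  proof -
    have m: "of_real \<mu> \<noteq> (0::complex)" using \<mu> by simp
    have "1 + of_real \<mu> * (c1 + d + of_real \<mu> * c1 * d) = (1 + of_real \<mu> * c1) * (1 + of_real \<mu> * d)"
      by (simp add: algebra_simps)
    also have "\<dots> = exp (- (\<i> * of_real (\<mu> * b / 2))) * exp (\<i> * of_real (\<mu> * b / 4))"
      using m by (simp add: c1_def d_def)
    also have "\<dots> = exp (- (\<i> * of_real \<theta>))"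
      unfolding exp_add[symmetric] using \<mu> by (simp add: b_def)
    finally show ?thesis using m by (simp add: field_simps)
  qed
  finally have V4: "of_real (1 / 2) *\<^sub>C V3 = act A (Hmat x) ((exp (- (\<i> * of_real \<theta>)) - 1) / of_real \<mu>) V" .
  show ?thesis
    using transport.concat[OF transport.concat[OF transport.concat[OF t1 t2] tr3] t4] unfolding x4 V4 .
qed

lemma rank_one_sandwich:
  fixes v :: "nat \<Rightarrow> complex"
  defines "A \<equiv> \<lambda>i j. if i < n \<and> j < n then v i * cnj (v j) else 0"
  shows "A \<in> Mat" "adj A = A" "A \<star> K \<star> A = qform K v *\<^sub>C A"
proof -
  show AM: "A \<in> Mat" by (auto simp: A_def Mat_def)
  show "adj A = A" by (auto simp: A_def adj_def fun_eq_iff)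
  show "A \<star> K \<star> A = qform K v *\<^sub>C A"
  proof (rule Mat_eqI)
    fix i j assume ij: "i < n" "j < n"
    have "(A \<star> K \<star> A) i j = (\<Sum>k<n. v i * cnj (v k) * (\<Sum>l<n. K k l * (v l * cnj (v j))))"
      using ij by (simp add: mm_apply) (simp add: A_def)
    also have "\<dots> = qform K v * (v i * cnj (v j))"
      by (simp add: qform_eq sum_distrib_left sum_distrib_right mult_ac)
    finally show "(A \<star> K \<star> A) i j = (qform K v *\<^sub>C A) i j"
      using ij by (simp add: smul_apply A_def)
  qed (use AM in auto)
qed

lemma irreducible: "irreducible_manifold M"
  unfolding irreducible_manifold_def
proof (intro conjI ballI allI impI)
  show "dimen M > 0" using N_pos by simp
  fix c x W
  assume c: "c \<in> atlas M" and x: "x \<in> snd c ` fst c"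
    and W: "lin_subspace (dimen M) W \<and> (\<forall>v\<in>W. \<forall>w. transport M c x v c x w \<longrightarrow> w \<in> W)"
  have c: "c = chart" using c by simp
  have x: "x \<in> dom" using x by (auto simp: c)
  have WN: "W \<subseteq> Rn N" and W0: "(\<lambda>i. 0) \<in> W"
    and Wlin: "\<And>u v a b. u \<in> W \<Longrightarrow> v \<in> W \<Longrightarrow> (\<lambda>i. a * u i + b * v i) \<in> W"
    and Wtr: "\<And>v w. v \<in> W \<Longrightarrow> transport M chart x v chart x w \<Longrightarrow> w \<in> W"
    using W unfolding lin_subspace_def c by auto
  define H where "H = Hmat x"
  \<comment> \<open>W read as a set of matrices; the aim is an ideal property of S.\<close>
  define S where "S = {A \<in> Mat. coords A \<in> W}"
  have add: "A + B \<in> S" if "A \<in> S" "B \<in> S" for A B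
  proof -
    have "(\<lambda>i. 1 * coords A i + 1 * coords B i) \<in> W" using that by (intro Wlin) (simp_all add: S_def)
    moreover have "(\<lambda>i. 1 * coords A i + 1 * coords B i) = coords (A + B)" by (simp add: coords_add fun_eq_iff del: plus_fun_apply)
    ultimately show ?thesis using that by (simp add: S_def)
  qed
  have rscale: "of_real r *\<^sub>C A \<in> S" if "A \<in> S" for A r
  proof -
    have "(\<lambda>i. r * coords A i + 0 * coords A i) \<in> W" using that by (intro Wlin) (simp_all add: S_def)
    moreover have "(\<lambda>i. r * coords A i + 0 * coords A i) = coords (of_real r *\<^sub>C A)" by (simp add: coords_of_real fun_eq_iff)
    ultimately show ?thesis using that by (simp add: S_def)
  qed
  have loop: "act A H ((exp (- (\<i> * of_real \<theta>)) - 1) / of_real \<mu>) V \<in> S"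
    if "V \<in> S" "A \<in> Mat" "adj A = A" "A \<star> H \<star> A = of_real \<mu> *\<^sub>C A" "\<mu> > 0" "\<theta> > 0" for A V and \<mu> \<theta> :: real
  proof -
    have V: "V \<in> Mat" "coords V \<in> W" using that by (simp_all add: S_def)
    have "coords (act A H ((exp (- (\<i> * of_real \<theta>)) - 1) / of_real \<mu>) V) \<in> W"
      using Wtr[OF V(2)] transport_loop[OF x that(2,3) _ that(5,6) V(1)] that(4) unfolding H_def by blast
    then show ?thesis using V by (simp add: S_def)
  qed
  have exp_cis: "exp (- (\<i> * of_real \<theta>)) = cis (- \<theta>)" for \<theta>
    by (simp add: cis_conv_exp)
  have e1: "exp (- (\<i> * of_real pi)) = - 1" and e2: "exp (- (\<i> * of_real (pi / 2))) = - \<i>"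
    unfolding exp_cis by (simp_all add: complex_eq_iff)
  have e4: "(exp (- (\<i> * of_real (pi / 4))))\<^sup>2 = - \<i>"
    unfolding exp_cis power2_eq_square cis_mult by (simp add: complex_eq_iff)
  \<comment> \<open>The loop with A = Y, \<mu> = 1 and angle pi / 4 multiplies V by the square of
    exp (- i pi / 4), that is by - i. So S is closed under complex scalars.\<close>
  have scale_i: "\<i> *\<^sub>C V \<in> S" if V: "V \<in> S" for V
  proof -
    have "V \<in> Mat" using V by (simp add: S_def)
    define e where "e = exp (- (\<i> * of_real (pi / 4)))"
    have "act (Ymat x) H ((e - 1) / of_real 1) V \<in> S"
      unfolding e_def by (rule loop[OF V]) (simp_all add: H_def YH[OF x] smul_simps idm_mm)
    also have "act (Ymat x) H ((e - 1) / of_real 1) V = e\<^sup>2 *\<^sub>C V"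
      unfolding act_def H_def
      by (simp add: YH[OF x] idm_mm \<open>V \<in> Mat\<close>) (simp add: smul_def fun_eq_iff algebra_simps power2_eq_square)
    finally have "of_real (- 1) *\<^sub>C (- \<i>) *\<^sub>C V \<in> S" unfolding e_def e4 by (rule rscale)
    then show ?thesis by (simp add: smul_simps)
  qed
  have smul: "c *\<^sub>C V \<in> S" if V: "V \<in> S" for V c
  proof -
    have "c *\<^sub>C V = of_real (Re c) *\<^sub>C V + of_real (Im c) *\<^sub>C \<i> *\<^sub>C V"
      by (simp add: smul_def fun_eq_iff complex_eq_iff)
    then show ?thesis using add[OF rscale[OF V] rscale[OF scale_i[OF V]]] by simp
  qed
  have rank_one: "A \<star> H \<star> V + V \<star> H \<star> A \<in> S"
    if v: "i < n" "v i \<noteq> 0" and A_def: "A = (\<lambda>i j. if i < n \<and> j < n then v i * cnj (v j) else 0)" and V: "V \<in> S"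
    for v :: "nat \<Rightarrow> complex" and i A V
  proof -
    have A: "A \<in> Mat" "adj A = A" "A \<star> H \<star> A = qform H v *\<^sub>C A"
      unfolding A_def by (rule rank_one_sandwich)+
    define \<mu> where "\<mu> = Re (qform H v)"
    have Hp: "posdef n H" and Ha: "adj H = H"
      unfolding H_def Hmat_def by (rule posdef_minv[OF dom_posdef[OF x] Ymat_Mat])+
    have \<mu>: "\<mu> > 0" unfolding \<mu>_def using posdef_qform[OF Hp, of i v] v by simp
    have "qform H v = cnj (qform H v)" using qform_adj[of H v] unfolding Ha .
    from arg_cong[OF this, of Im] have q: "qform H v = of_real \<mu>" by (simp add: \<mu>_def complex_eq_iff)
    let ?L = "A \<star> H \<star> V + V \<star> H \<star> A" and ?Q = "A \<star> H \<star> V \<star> H \<star> A"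
    \<comment> \<open>The loops of angle pi and pi / 2. Together with V itself they give three
      values of a quadratic polynomial in c, and a linear combination isolates its linear
      coefficient.\<close>
    define c1 c2 where "c1 = (- 1 - 1) / complex_of_real \<mu>" and "c2 = (- \<i> - 1) / complex_of_real \<mu>"
    have "act A H c1 V \<in> S" unfolding c1_def e1[symmetric] using A \<mu> by (intro loop[OF V]) (simp_all add: q)
    moreover have "act A H c2 V \<in> S" unfolding c2_def e2[symmetric] using A \<mu> by (intro loop[OF V]) (simp_all add: q)
    ultimately have "(c2\<^sup>2 *\<^sub>C act A H c1 V + (- (c1\<^sup>2)) *\<^sub>C act A H c2 V) + (c1\<^sup>2 - c2\<^sup>2) *\<^sub>C V \<in> S"
      by (intro add smul V)
    also have "(c2\<^sup>2 *\<^sub>C act A H c1 V + (- (c1\<^sup>2)) *\<^sub>C act A H c2 V) + (c1\<^sup>2 - c2\<^sup>2) *\<^sub>C V = (c1 * c2 * (c2 - c1)) *\<^sub>C ?L"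
      unfolding act_def by (simp add: smul_def fun_eq_iff algebra_simps power2_eq_square)
    finally have "(1 / (c1 * c2 * (c2 - c1))) *\<^sub>C (c1 * c2 * (c2 - c1)) *\<^sub>C ?L \<in> S" by (rule smul)
    moreover have "c1 * c2 * (c2 - c1) \<noteq> 0"
      using \<mu> by (simp add: c1_def c2_def complex_eq_iff)
    ultimately show ?thesis unfolding smul_simps(5) by (simp add: smul_simps)
  qed
  have S0: "0 \<in> S"
  proof -
    have "coords 0 = (\<lambda>i. 0)" by (auto simp: coords_def)
    then show ?thesis using W0 by (simp add: S_def)
  qed
  have jordan: "\<forall>V\<in>S. A \<star> H \<star> V + V \<star> H \<star> A \<in> S" if "A \<in> Mat" for A
  proof (rule rank_one_span[OF that, where P = "\<lambda>A. \<forall>V\<in>S. A \<star> H \<star> V + V \<star> H \<star> A \<in> S"]; intro ballI)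
    fix V assume V: "V \<in> S"
    show "0 \<star> H \<star> V + V \<star> H \<star> 0 \<in> S" using S0 by (simp add: mm_simps)
    fix A B :: cmat and c
    show "(A + B) \<star> H \<star> V + V \<star> H \<star> (A + B) \<in> S"
      if "\<forall>V\<in>S. A \<star> H \<star> V + V \<star> H \<star> A \<in> S" "\<forall>V\<in>S. B \<star> H \<star> V + V \<star> H \<star> B \<in> S"
    proof -
      have "(A + B) \<star> H \<star> V + V \<star> H \<star> (A + B) = (A \<star> H \<star> V + V \<star> H \<star> A) + (B \<star> H \<star> V + V \<star> H \<star> B)"
        unfolding mm_simps by (simp add: add_ac)
      then show ?thesis using add that V by simp
    qed
    show "(c *\<^sub>C A) \<star> H \<star> V + V \<star> H \<star> (c *\<^sub>C A) \<in> S" if "\<forall>V\<in>S. A \<star> H \<star> V + V \<star> H \<star> A \<in> S"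
      unfolding mm_simps smul_simps(1)[symmetric] using smul that V by blast
  next
    fix v :: "nat \<Rightarrow> complex" and i V assume "i < n" "v i \<noteq> 0" "V \<in> S"
    then show "(\<lambda>i j. if i < n \<and> j < n then v i * cnj (v j) else 0) \<star> H \<star> V + V \<star> H \<star> (\<lambda>i j. if i < n \<and> j < n then v i * cnj (v j) else 0) \<in> S"
      using rank_one[OF _ _ refl] by blast
  qed
  \<comment> \<open>For V = U Y and A = C Y the factors H and Y cancel, and A H V + V H A becomes (C
    U + U C) Y.\<close>
  define T where "T = {U \<in> Mat. U \<star> Ymat x \<in> S}"
  show "W = {\<lambda>i. 0} \<or> W = Rn (dimen M)"
  proof (cases "W = {\<lambda>i. 0}")
    case False
    then obtain w where w: "w \<in> W" "w \<noteq> (\<lambda>i. 0)" using W0 by blast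
    have wN: "w \<in> Rn N" using w WN by blast
    have nz: "mat_of w \<noteq> 0" using mat_of_eq_0[OF wN] w by blast
    have eq: "(mat_of w \<star> H) \<star> Ymat x = mat_of w" by (simp add: mm_assoc H_def YH[OF x] idm_mm)
    have "mat_of w \<in> S" using w by (simp add: S_def coords_mat_of wN)
    then have U: "mat_of w \<star> H \<in> T" unfolding T_def mem_Collect_eq eq by simp
    have U0: "mat_of w \<star> H \<noteq> 0"
    proof
      assume "mat_of w \<star> H = 0"
      then have "mat_of w = 0 \<star> Ymat x" using eq by simp
      then show False using nz by (simp only: mm_simps)
    qed
    have Tadd: "A + B \<in> T" if "A \<in> T" "B \<in> T" for A B
      using that add[of "A \<star> Ymat x" "B \<star> Ymat x"] by (simp add: T_def mm_simps)
    have Tsmul: "c *\<^sub>C A \<in> T" if "A \<in> T" for A c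
      using that smul[of "A \<star> Ymat x" c] by (simp add: T_def mm_simps)
    have munit: "munit a b \<in> T" if "a < n" "b < n" for a b
    proof (rule jordan_simple[OF _ Tadd Tsmul _ U U0 that])
      show "T \<subseteq> Mat" by (auto simp: T_def)
      fix A C assume A: "A \<in> T" and C: "C \<in> Mat"
      have "(C \<star> Ymat x) \<star> H \<star> (A \<star> Ymat x) + (A \<star> Ymat x) \<star> H \<star> (C \<star> Ymat x) \<in> S"
        using jordan[of "C \<star> Ymat x"] A by (simp add: T_def)
      also have "(C \<star> Ymat x) \<star> H \<star> (A \<star> Ymat x) + (A \<star> Ymat x) \<star> H \<star> (C \<star> Ymat x) = (C \<star> A + A \<star> C) \<star> Ymat x"
        by (simp add: mm_simps mm_assoc H_def YH[OF x])
      finally show "C \<star> A + A \<star> C \<in> T" by (simp add: T_def)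
    qed
    have "Rn N \<subseteq> W"
    proof
      fix u assume u: "u \<in> Rn N"
      have "0 \<in> T" using S0 by (simp add: T_def mm_simps)
      have "A \<in> T" if "A \<in> Mat" for A
        by (rule Mat_induct[where P = "\<lambda>A. A \<in> T", OF that \<open>0 \<in> T\<close> Tadd Tsmul munit])
      then have "mat_of u \<star> H \<in> T" by simp
      then have "mat_of u \<in> S" by (simp add: T_def mm_assoc H_def YH[OF x] idm_mm)
      then show "u \<in> W" by (simp add: S_def coords_mat_of u)
    qed
    then show ?thesis using WN by auto
  qed simp
qed

end

section \<open>The hyperbolic plane with constant Kaehler angle\<close>

definition zc :: "(nat \<Rightarrow> real) \<Rightarrow> complex" where
  "zc x = Complex (x 0) (x 1)"

definition pt :: "complex \<Rightarrow> nat \<Rightarrow> real" where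
  "pt w = (\<lambda>i. if i = 0 then Re w else if i = 1 then Im w else 0)"

definition half_plane :: "(nat \<Rightarrow> real) set" where
  "half_plane = {x \<in> Rn 2. 0 < x 1}"

text \<open>The chart of the embedded half plane: coordinates 0 and 1 of a point are the real and
  imaginary part of the corner entry, which is z because m is positive.\<close>

definition first_two :: "(nat \<Rightarrow> real) \<Rightarrow> nat \<Rightarrow> real" where
  "first_two x = (\<lambda>i. if i < 2 then x i else 0)"

lemma sum_lessThan_2: "(\<Sum>i<(2::nat). f i) = f 0 + (f 1 :: 'a :: comm_monoid_add)"
  by (simp add: numeral_2_eq_2)

lemma less_2_cases': "i < (2::nat) \<longleftrightarrow> i = 0 \<or> i = 1"
  by auto

lemma pt_zc: "x \<in> Rn 2 \<Longrightarrow> pt (zc x) = x"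
  by (auto simp: pt_def zc_def mem_Rn fun_eq_iff)

lemma zc_pt: "zc (pt w) = w"
  by (simp add: pt_def zc_def)

lemma pt_Rn: "pt w \<in> Rn 2"
  by (auto simp: pt_def mem_Rn)

lemma zc_line: "zc (x(j := t)) = zc x + of_real (t - x j) * zc (basis_vector j)"
  by (auto simp: zc_def basis_vector_def complex_eq_iff)

lemma zc_sum: "(\<Sum>j<2. of_real (v j) * zc (basis_vector j)) = zc v"
  by (simp add: sum_lessThan_2 zc_def basis_vector_def complex_eq_iff)

text \<open>The first \<open>m\<close> of the \<open>n\<close> diagonal entries are \<open>z\<close>; the others are \<open>- cnj z\<close>, because this is
  the antiholomorphic isometry of the upper half plane.\<close>

locale tube_disc = tube +
  fixes m :: nat
  assumes m: "0 < m" "m \<le> n"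
begin

definition bdiag :: "complex \<Rightarrow> complex \<Rightarrow> cmat" where
  "bdiag a b = (\<lambda>i j. if i = j \<and> i < n then (if i < m then a else b) else 0)"

definition disc :: "complex \<Rightarrow> cmat" where
  "disc w = bdiag w (- cnj w)"

definition emb :: "(nat \<Rightarrow> real) \<Rightarrow> nat \<Rightarrow> real" where
  "emb x = coords (disc (zc x))"

text \<open>n copies of the hyperbolic metric y^-2 (dx^2 + dy^2), one for each diagonal
  entry.\<close>

definition half_plane_metric :: "(nat \<Rightarrow> real) \<Rightarrow> nat \<Rightarrow> nat \<Rightarrow> real" where
  "half_plane_metric x i j = (if i = j then real n * inverse (x 1 * x 1) else 0)"

lemma bdiag_Mat [simp]: "bdiag a b \<in> Mat" and disc_Mat [simp]: "disc w \<in> Mat"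
  by (auto simp: bdiag_def disc_def Mat_def)

lemma bdiag_mm: "bdiag a b \<star> bdiag c d = bdiag (a * c) (b * d)"
proof (rule Mat_eqI)
  fix i j assume ij: "i < n" "j < n"
  have "(\<Sum>k<n. bdiag a b i k * bdiag c d k j) = (\<Sum>k<n. if k = i then bdiag a b i i * bdiag c d i j else 0)"
    by (intro sum.cong refl) (auto simp: bdiag_def)
  then show "(bdiag a b \<star> bdiag c d) i j = bdiag (a * c) (b * d) i j"
    using ij by (simp add: mm_apply) (simp add: bdiag_def)
qed simp_all

lemma bdiag_simps:
  "adj (bdiag a b) = bdiag (cnj a) (cnj b)" "c *\<^sub>C bdiag a b = bdiag (c * a) (c * b)"
  "bdiag a b + bdiag c d = bdiag (a + c) (b + d)" "bdiag a b - bdiag c d = bdiag (a - c) (b - d)" "- bdiag a b = bdiag (- a) (- b)"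
  by (auto simp: bdiag_def adj_def smul_def fun_eq_iff)

lemma idm_bdiag: "idm = bdiag 1 1"
  by (auto simp: bdiag_def idm_def fun_eq_iff)

lemma tr_bdiag: "tr (bdiag a b) = of_nat m * a + of_nat (n - m) * b"
proof -
  have n: "{..<n} = {..<m} \<union> {m..<n}" using m by auto
  have "tr (bdiag a b) = (\<Sum>i<n. if i < m then a else b)"
    by (simp add: tr_def bdiag_def)
  also have "\<dots> = (\<Sum>i<m. if i < m then a else b) + (\<Sum>i=m..<n. if i < m then a else b)"
    unfolding n by (rule sum.union_disjoint) auto
  finally show ?thesis by simp
qed

text \<open>w and - cnj w have the same imaginary part, so Y is a scalar matrix on the embedded
  plane and every computation there is entrywise.\<close>

lemma im_part_disc: "im_part (disc w) = of_real (Im w) *\<^sub>C idm"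
  unfolding im_part_def disc_def bdiag_simps idm_bdiag by (rule arg_cong2[of _ _ _ _ bdiag]) (simp_all add: complex_eq_iff)

lemma disc_linear: "disc (a + b) = disc a + disc b" "disc (of_real r * a) = of_real r *\<^sub>C disc a" "disc (a - b) = disc a - disc b"
  by (simp_all add: disc_def bdiag_simps)

lemma mat_of_emb: "mat_of (emb x) = disc (zc x)"
  unfolding emb_def by (rule mat_of_coords) simp

lemma Ymat_emb: "Ymat (emb x) = of_real (x 1) *\<^sub>C idm"
  unfolding Ymat_def mat_of_emb im_part_disc by (simp add: zc_def)

lemma emb_dom: "x \<in> half_plane \<Longrightarrow> emb x \<in> dom"
  by (simp add: dom_def Ymat_emb posdef_scale posdef_idm half_plane_def) (simp add: emb_def)

lemma Hmat_emb:
  assumes "x \<in> half_plane"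
  shows "Hmat (emb x) = bdiag (1 / of_real (x 1)) (1 / of_real (x 1))"
  unfolding Hmat_def Ymat_emb idm_bdiag bdiag_simps
  by (rule minv_eqI) (use assms in \<open>simp_all add: bdiag_mm idm_bdiag half_plane_def\<close>)

lemma emb_first_two: "x \<in> Rn 2 \<Longrightarrow> first_two (emb x) = x"
proof
  fix i assume x: "x \<in> Rn 2"
  have D0: "disc w 0 0 = w" for w using m by (simp add: disc_def bdiag_def)
  have "emb x 0 = x 0" "emb x 1 = x 1"
    using one_less_N N_pos by (simp_all add: emb_def coords_def D0 zc_def)
  then show "first_two (emb x) i = x i"
    using x less_2_cases'[of i] by (auto simp: first_two_def mem_Rn)
qed

lemma half_plane_Rn: "x \<in> half_plane \<Longrightarrow> x \<in> Rn 2"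
  by (simp add: half_plane_def)

lemma half_plane_open: "openin (Euclidean_space 2) half_plane"
proof -
  have "open {x :: nat \<Rightarrow> real. 0 < x 1}"
    by (intro open_Collect_less continuous_on_const continuous_on_product_coordinates)
  then show ?thesis
    unfolding half_plane_def Euclidean_space_eq topspace_euclidean_subtopology
    by (auto simp: openin_open)
qed

lemma gsmooth_emb: "gsmooth K V (\<lambda>x. emb x k)"
  unfolding emb_def
proof (rule gsmooth_coords)
  fix i j
  have z: "gsmooth K V zc"
  proof -
    have "zc = (\<lambda>x. of_real (x 0) + \<i> * of_real (x 1))" by (auto simp: zc_def complex_eq_iff fun_eq_iff)
    from arg_cong[OF this, of "gsmooth K V"] show ?thesis
      by (rule iffD2) (intro gsmooth_add gsmooth_mult gsmooth_const gsmooth_linear[OF bounded_linear_of_real] gsmooth_coord)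
  qed
  have "gsmooth K V (\<lambda>x. - cnj (zc x))"
    by (intro gsmooth_minus gsmooth_linear[OF bounded_linear_cnj] z)
  moreover have "(\<lambda>x. disc (zc x) i j) = (\<lambda>x. 0) \<or> (\<lambda>x. disc (zc x) i j) = (\<lambda>x. zc x) \<or>
      (\<lambda>x. disc (zc x) i j) = (\<lambda>x. - cnj (zc x))"
    by (cases "i = j \<and> i < n"; cases "i < m") (auto simp: disc_def bdiag_def)
  ultimately show "gsmooth K V (\<lambda>x. disc (zc x) i j)"
    using z gsmooth_const[of K V "0 :: complex"] by (elim disjE) simp_all
qed

lemma emb_cont: "continuous_on V emb"
proof (rule continuous_on_coordinatewise_then_product)
  show "continuous_on V (\<lambda>x. emb x i)" for i
    using gsmooth_emb[of 0 V i] gCk_cont unfolding gsmooth_def by blast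
qed

lemma first_two_cont: "continuous_on V first_two"
proof (rule continuous_on_coordinatewise_then_product)
  show "continuous_on V (\<lambda>x. first_two x i)" for i
    by (cases "i < 2") (simp_all add: first_two_def continuous_on_subset[OF continuous_on_product_coordinates subset_UNIV])
qed

lemma bilin_half_plane_metric: "bilin 2 (half_plane_metric x) v w = real n * inverse (x 1 * x 1) * Re (zc v * cnj (zc w))"
  by (simp add: bilin_def sum_lessThan_2 half_plane_metric_def zc_def algebra_simps)

lemma zc_eq_0: "v \<in> Rn 2 \<Longrightarrow> zc v = 0 \<Longrightarrow> v = (\<lambda>i. 0)"
  using pt_zc[of v] by (auto simp: pt_def)

lemma gsmooth_half_plane_metric: "gsmooth 2 half_plane (\<lambda>x. half_plane_metric x i j)"
proof (cases "i = j")
  case True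
  have "gsmooth 2 half_plane (\<lambda>x. inverse (x 1 * x 1))"
    by (rule gsmooth_inverse) (auto intro!: gsmooth_mult gsmooth_coord simp: half_plane_def)
  then show ?thesis
    using True by (simp add: half_plane_metric_def gsmooth_mult gsmooth_const del: inverse_mult_distrib)
next
  case False
  then show ?thesis by (simp add: half_plane_metric_def gsmooth_const)
qed

sublocale S: onechart_manifold 2 half_plane emb first_two half_plane_metric
proof
  show "openin (Euclidean_space 2) half_plane" by (rule half_plane_open)
  show "gsmooth 2 half_plane (\<lambda>x. half_plane_metric x i j)" for i j by (rule gsmooth_half_plane_metric)
  show "0 < bilin 2 (half_plane_metric x) v v" if "x \<in> half_plane" "v \<in> Rn 2" "v \<noteq> (\<lambda>i. 0)" for x v
  proof -
    have "zc v \<noteq> 0" using zc_eq_0 that by blast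
    then have "0 < Re (zc v * cnj (zc v))" by (simp add: complex_mult_cnj complex_neq_0)
    then show ?thesis
      unfolding bilin_half_plane_metric using that(1) n_pos by (intro mult_pos_pos) (simp_all add: half_plane_def)
  qed
qed (auto simp: emb_first_two half_plane_Rn emb_cont first_two_cont half_plane_metric_def)

lemma emb_derivative:
  "((\<lambda>t. emb (x(j := t)) i) has_vector_derivative emb (basis_vector j) i) (at t0)"
  unfolding emb_def
proof (rule coords_has_vector_derivative)
  fix a b
  have "((\<lambda>t. (disc (zc x - of_real (x j) * zc (basis_vector j)) + of_real t *\<^sub>C disc (zc (basis_vector j))) a b)
      has_vector_derivative disc (zc (basis_vector j)) a b) (at t0)"
    by (rule affine_derivative)
  moreover have "disc (zc x - of_real (x j) * zc (basis_vector j)) + of_real t *\<^sub>C disc (zc (basis_vector j)) = disc (zc (x(j := t)))" for t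
  proof -
    have "zc x - of_real (x j) * zc (basis_vector j) + of_real t * zc (basis_vector j) = zc (x(j := t))"
      unfolding zc_line by (simp add: left_diff_distrib)
    then show ?thesis by (simp only: disc_linear(1)[symmetric] disc_linear(2)[symmetric])
  qed
  ultimately show "((\<lambda>t. disc (zc (x(j := t))) a b) has_vector_derivative disc (zc (basis_vector j)) a b) (at t0)"
    by (simp only:)
qed

lemma emb_sum: "(\<Sum>j<2. emb (basis_vector j) i * v j) = emb v i"
proof -
  have z: "zc v = of_real (v 0) * zc (basis_vector 0) + of_real (v 1) * zc (basis_vector 1)"
    using zc_sum[of v] by (simp only: sum_lessThan_2)
  have "emb v i = coords (disc (of_real (v 0) * zc (basis_vector 0) + of_real (v 1) * zc (basis_vector 1))) i"
    unfolding emb_def by (subst z) (rule refl)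
  also have "\<dots> = v 0 * emb (basis_vector 0) i + v 1 * emb (basis_vector 1) i"
    unfolding disc_linear coords_add coords_of_real emb_def ..
  finally show ?thesis by (simp add: sum_lessThan_2 mult.commute)
qed

lemma emb_differential:
  assumes "x \<in> half_plane"
  shows "differential 2 (rep (emb ` half_plane, first_two) chart (\<lambda>p. p)) x v = emb v"
proof -
  have "differential 2 (rep (emb ` half_plane, first_two) chart (\<lambda>p. p)) x v = (\<lambda>i. \<Sum>j<2. emb (basis_vector j) i * v j)"
    by (rule S.differential_rep[OF assms]) (simp add: emb_derivative)
  then show ?thesis unfolding emb_sum .
qed

lemma Re_complex_of_real_mult: "Re (of_real r * z) = r * Re z"
  by simp

lemma ip_bdiag:
  assumes "x \<in> half_plane"
  shows "ip (emb x) (bdiag a b) (bdiag c d) = inverse (x 1 * x 1) * Re (of_nat m * (a * cnj c) + of_nat (n - m) * (b * cnj d))"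
proof -
  have "Hmat (emb x) \<star> bdiag a b \<star> Hmat (emb x) \<star> adj (bdiag c d) =
      of_real (inverse (x 1 * x 1)) *\<^sub>C bdiag (a * cnj c) (b * cnj d)"
    unfolding Hmat_emb[OF assms] bdiag_simps bdiag_mm by (rule arg_cong2[of _ _ _ _ bdiag]) (simp_all add: field_simps)
  then show ?thesis
    unfolding ip_def by (simp only: tr_simps tr_bdiag Re_complex_of_real_mult)
qed

text \<open>The antiholomorphic entries contribute the conjugate product, which has the same real
  part; both blocks therefore add up to n.\<close>

lemma ip_disc:
  assumes "x \<in> half_plane"
  shows "ip (emb x) (disc a) (disc b) = real n * inverse (x 1 * x 1) * Re (a * cnj b)"
proof -
  have "real m + real (n - m) = real n" using m by simp
  have "Re (of_nat m * (a * cnj b) + of_nat (n - m) * (- cnj a * cnj (- cnj b))) = (real m + real (n - m)) * Re (a * cnj b)"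
    by (simp add: algebra_simps)
  then show ?thesis
    unfolding disc_def ip_bdiag[OF assms] \<open>real m + real (n - m) = real n\<close> by simp
qed

abbreviation "SM \<equiv> S.M"

lemma emb_submanifold: "riemannian_submanifold SM M"
  unfolding riemannian_submanifold_def
proof (intro conjI)
  show "riemannian_manifold SM" by (rule S.riemannian)
  have "pt \<i> \<in> half_plane" by (simp add: half_plane_def pt_Rn) (simp add: pt_def)
  then show "topspace (space_of SM) \<noteq> {}" by auto
  show "smooth_map SM M (\<lambda>p. p)"
    by (rule S.smooth_mapI) (use emb_dom gsmooth_emb in \<open>auto simp: continuous_on_id\<close>)
  show "preserves_metric SM M (\<lambda>p. p)"
    unfolding preserves_metric_def
    by (auto simp: emb_first_two half_plane_Rn emb_differential inner_at_def bilin_gmet bilin_half_plane_metric mat_of_emb ip_disc)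
qed simp

section \<open>Connection of the half plane and total geodesy\<close>

lemma christoffel_half_plane:
  assumes x: "x \<in> half_plane" and k: "k < 2" "i < 2" "j < 2"
  shows "christoffel SM c k i j x = pt (\<i> * zc (basis_vector i) * zc (basis_vector j) / of_real (x 1)) k"
proof (rule christoffel_eqI[where h = "\<lambda>i j. if i = j \<and> i < 2 then x 1 * x 1 / real n else 0"
      and G = "\<lambda>i j l. if i = 1 \<and> j = l then - (2 * real n * inverse (x 1 * x 1 * x 1)) else 0"])
  have x1: "x 1 > 0" using x by (simp add: half_plane_def)
  fix i j l :: nat
  show "(if i = j \<and> i < 2 then x 1 * x 1 / real n else 0) = 0" if "2 \<le> i \<or> 2 \<le> j"
    using that by auto
  show "(\<Sum>k<2. (if i = k \<and> i < 2 then x 1 * x 1 / real n else 0) * half_plane_metric x k j) = (if i = j then 1 else 0)" if "i < 2" "j < 2"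
    using that x1 n_pos unfolding sum_lessThan_2 half_plane_metric_def less_2_cases' by (auto simp: field_simps)
  show "half_plane_metric x i j = half_plane_metric x j i" by (simp add: half_plane_metric_def)
  show "(if i = j \<and> i < 2 then x 1 * x 1 / real n else 0) = (if j = i \<and> j < 2 then x 1 * x 1 / real n else 0)" by auto
  show "((\<lambda>t. half_plane_metric (x(i := t)) j l) has_vector_derivative
      (if i = 1 \<and> j = l then - (2 * real n * inverse (x 1 * x 1 * x 1)) else 0)) (at (x i))" if "i < 2"
  proof (cases "i = 1 \<and> j = l")
    case True
    have "((\<lambda>t. real n * inverse (t * t)) has_real_derivative - (2 * real n * inverse (x 1 * x 1 * x 1))) (at (x 1))"
      using x1 by (auto intro!: derivative_eq_intros simp: field_simps)
    then show ?thesis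
      using True by (simp add: half_plane_metric_def has_real_derivative_iff_has_vector_derivative del: inverse_mult_distrib One_nat_def)
  next
    case False
    then have "half_plane_metric (x(i := t)) j l = half_plane_metric x j l" for t by (auto simp: half_plane_metric_def)
    moreover have "(if i = 1 \<and> j = l then - (2 * real n * inverse (x 1 * x 1 * x 1)) else 0) = 0" using False by (rule if_not_P)
    ultimately show ?thesis by (simp only: has_vector_derivative_const)
  qed
next
  have x1: "x 1 > 0" using x by (simp add: half_plane_def)
  have b: "zc (basis_vector 0) = 1" "zc (basis_vector 1) = \<i>"
    by (simp_all add: zc_def basis_vector_def complex_eq_iff)
  fix l :: nat assume "l < 2"
  then show "(if i = 1 \<and> j = l then - (2 * real n * inverse (x 1 * x 1 * x 1)) else 0)
    + (if j = 1 \<and> i = l then - (2 * real n * inverse (x 1 * x 1 * x 1)) else 0)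
    - (if l = 1 \<and> i = j then - (2 * real n * inverse (x 1 * x 1 * x 1)) else 0)
    = 2 * (\<Sum>m<2. half_plane_metric x l m * pt (\<i> * zc (basis_vector i) * zc (basis_vector j) / of_real (x 1)) m)"
    using k(2,3) x1 unfolding less_2_cases' sum_lessThan_2 half_plane_metric_def pt_def
    by (elim disjE) (simp_all add: b divide_inverse mult_ac del: One_nat_def,
        simp_all add: field_simps power2_eq_square)
qed (use k in auto)

text \<open>In complex notation the connection form of y^-2 |dz|^2 is i u w / y, the same shape as
  Gam for 1 by 1 matrices; the constant factor n leaves it unchanged.\<close>

lemma christoffel_half_plane_sum:
  assumes x: "x \<in> half_plane" and k: "k < 2"
  shows "(\<Sum>i<2. \<Sum>j<2. christoffel SM c k i j x * u i * w j) = pt (\<i> * zc u * zc w / of_real (x 1)) k"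
proof -
  have b: "zc (basis_vector 0) = 1" "zc (basis_vector 1) = \<i>"
    by (simp_all add: zc_def basis_vector_def complex_eq_iff)
  have two: "(0::nat) < 2" "(1::nat) < 2" by simp_all
  have x1: "x 1 > 0" using x by (simp add: half_plane_def)
  show ?thesis
    unfolding sum_lessThan_2 christoffel_half_plane[OF x k two(1) two(1)] christoffel_half_plane[OF x k two(1) two(2)]
      christoffel_half_plane[OF x k two(2) two(1)] christoffel_half_plane[OF x k two(2) two(2)] b
    using k x1 unfolding less_2_cases' by (elim disjE) (simp_all add: pt_def zc_def field_simps)
qed

abbreviation "chart2 \<equiv> (emb ` half_plane, first_two)"

lemma disc_has_vector_derivative:
  assumes "(f has_vector_derivative f') (at t within S)"
  shows "((\<lambda>s. disc (f s) i j) has_vector_derivative disc f' i j) (at t within S)"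
proof -
  have "((\<lambda>s. - cnj (f s)) has_vector_derivative - cnj f') (at t within S)"
    by (intro has_vector_derivative_minus has_vector_derivative_cnj assms)
  moreover have "(\<forall>w. disc w i j = 0) \<or> (\<forall>w. disc w i j = w) \<or> (\<forall>w. disc w i j = - cnj w)"
    by (cases "i = j \<and> i < n"; cases "i < m") (auto simp: disc_def bdiag_def)
  ultimately show ?thesis
    using assms by (elim disjE) simp_all
qed

lemma zc_has_vector_derivative:
  assumes "((\<lambda>s. x s 0) has_real_derivative x' 0) F" "((\<lambda>s. x s 1) has_real_derivative x' 1) F"
  shows "((\<lambda>s. zc (x s)) has_vector_derivative zc x') F"
  unfolding zc_def has_vector_derivative_complex_iff using assms by simp

lemma pt_has_real_derivative:
  assumes "(z has_vector_derivative z') F"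
  shows "((\<lambda>s. pt (z s) k) has_real_derivative pt z' k) F"
  using assms unfolding has_vector_derivative_complex_iff pt_def by simp

text \<open>On an antiholomorphic entry Gam gives i (cnj w)^2 / y, which is - cnj (i w^2 / y). So
  Gam maps the tangent plane into itself and agrees with the connection of the half plane: the
  second fundamental form vanishes.\<close>

lemma Gam_emb:
  assumes "x \<in> half_plane"
  shows "Gam (emb x) (disc w) (disc w) = disc (\<i> * w * w / of_real (x 1))"
  unfolding Gam_def Hmat_emb[OF assms] disc_def bdiag_mm bdiag_simps
  by (rule arg_cong2[of _ _ _ _ bdiag]) (simp_all add: field_simps)

lemma disc_minus: "disc (- w) = - disc w"
  by (simp add: disc_def bdiag_simps)

text \<open>The embedding is real linear in z, so it carries velocities and accelerations over
  unchanged, and \<open>Gam_emb\<close> matches the two geodesic equations.\<close>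

lemma geodesic_embedded:
  assumes g: "geodesic SM I \<gamma>"
  shows "geodesic M I \<gamma>"
proof -
  have I: "open I" "is_interval I" using g by (simp_all add: geodesic_def)
  have c: "continuous_on I \<gamma>" and \<gamma>: "\<And>t. t \<in> I \<Longrightarrow> \<gamma> t \<in> emb ` half_plane"
    using g by (auto simp: geodesic_def)
  define x where "x = (\<lambda>s. first_two (\<gamma> s))"
  define v where "v = velocity chart2 \<gamma>"
  have x: "x s \<in> half_plane" "emb (x s) = \<gamma> s" if "s \<in> I" for s
    using \<gamma>[OF that] by (auto simp: x_def emb_first_two half_plane_Rn)
  have diff: "(\<lambda>s. x s k) field_differentiable at t"
    and acc: "((\<lambda>s. v s k) has_real_derivative
       - (\<Sum>i<2. \<Sum>j<2. christoffel SM chart2 k i j (x t) * v t i * v t j)) (at t)"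
    if "t \<in> I" "k < 2" for t k
    using g that \<gamma>[OF that(1)] unfolding geodesic_def x_def v_def by auto
  have dx: "((\<lambda>s. x s k) has_real_derivative v t k) (at t)" if "t \<in> I" "k < 2" for t k
    using diff[OF that] unfolding v_def velocity_def x_def by (simp add: DERIV_deriv_iff_field_differentiable)
  have two: "(0::nat) < 2" "(1::nat) < 2" by simp_all
  have dz: "((\<lambda>s. zc (x s)) has_vector_derivative zc (v t)) (at t)" if "t \<in> I" for t
    by (rule zc_has_vector_derivative[OF dx[OF that two(1)] dx[OF that two(2)]])
  have d\<gamma>: "((\<lambda>s. \<gamma> s k) has_real_derivative emb (v t) k) (at t)" if t: "t \<in> I" for t k
  proof -
    have "((\<lambda>s. emb (x s) k) has_vector_derivative emb (v t) k) (at t)"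
      unfolding emb_def by (intro coords_has_vector_derivative disc_has_vector_derivative dz t)
    then have "((\<lambda>s. \<gamma> s k) has_vector_derivative emb (v t) k) (at t)"
      by (rule has_vector_derivative_transform_within_open[OF _ I(1) t]) (simp add: x(2))
    then show ?thesis by (simp add: has_real_derivative_iff_has_vector_derivative)
  qed
  have vel: "velocity chart \<gamma> t = emb (v t)" if "t \<in> I" for t
    unfolding velocity_def using DERIV_imp_deriv[OF d\<gamma>[OF that]] by auto
  have "((\<lambda>s. velocity chart \<gamma> s k) has_real_derivative
      - (\<Sum>i<N. \<Sum>j<N. christoffel M chart k i j (\<gamma> t) * velocity chart \<gamma> t i * velocity chart \<gamma> t j)) (at t)"
    if t: "t \<in> I" and k: "k < N" for t k
  proof -
    \<comment> \<open>The acceleration prescribed by the half plane, as a complex number.\<close>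
    let ?a = "- (\<i> * zc (v t) * zc (v t) / of_real (x t 1))"
    have "((\<lambda>s. v s k) has_real_derivative pt ?a k) (at t)" if "k < 2" for k
    proof -
      have "- pt w k = pt (- w) k" for w by (simp add: pt_def)
      then show ?thesis using acc[OF t that] unfolding christoffel_half_plane_sum[OF x(1)[OF t] that] by simp
    qed
    from this[OF two(1)] this[OF two(2)]
    have "((\<lambda>s. zc (v s)) has_vector_derivative zc (pt ?a)) (at t)"
      by (rule zc_has_vector_derivative)
    then have "((\<lambda>s. emb (v s) k) has_vector_derivative coords (disc ?a) k) (at t)"
      unfolding emb_def zc_pt by (intro coords_has_vector_derivative disc_has_vector_derivative)
    then have "((\<lambda>s. velocity chart \<gamma> s k) has_vector_derivative coords (disc ?a) k) (at t)"
      by (rule has_vector_derivative_transform_within_open[OF _ I(1) t]) (simp add: vel)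
    moreover have "(\<Sum>i<N. \<Sum>j<N. christoffel M chart k i j (\<gamma> t) * velocity chart \<gamma> t i * velocity chart \<gamma> t j) = - coords (disc ?a) k"
      unfolding vel[OF t] x(2)[OF t, symmetric]
      by (subst christoffel_sum[OF emb_dom[OF x(1)[OF t]] k]) (simp only: mat_of_emb Gam_emb[OF x(1)[OF t]] disc_minus coords_minus minus_minus)
    ultimately show ?thesis
      unfolding has_real_derivative_iff_has_vector_derivative by (simp only: minus_minus)
  qed
  moreover have "(\<lambda>s. \<gamma> s k) field_differentiable at t" if "t \<in> I" for t k
    using d\<gamma>[OF that] by (auto simp: field_differentiable_def)
  moreover have "\<gamma> ` I \<subseteq> dom" using \<gamma> emb_dom by fastforce
  ultimately show ?thesis
    using I c unfolding geodesic_def by auto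
qed

lemma emb_totally_geodesic: "totally_geodesic SM M"
  unfolding totally_geodesic_def using emb_submanifold geodesic_embedded by blast

section \<open>Explicit geodesics and completeness\<close>

lemma geodesic_halfplane:
  assumes z: "\<And>t. (z has_vector_derivative z' t) (at t)"
    and z': "\<And>t. (z' has_vector_derivative - (\<i> * z' t * z' t / of_real (Im (z t)))) (at t)"
    and pos: "\<And>t. Im (z t) > 0"
  shows "geodesic SM UNIV (\<lambda>t. emb (pt (z t)))" "velocity chart2 (\<lambda>t. emb (pt (z t))) t = pt (z' t)"
proof -
  have hp: "pt (z t) \<in> half_plane" for t
    using pos[of t] by (simp add: half_plane_def pt_Rn) (simp add: pt_def)
  have f: "first_two (emb (pt (z t))) = pt (z t)" for t
    by (rule emb_first_two[OF pt_Rn])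
  have vel: "velocity chart2 (\<lambda>t. emb (pt (z t))) t = pt (z' t)" for t
    unfolding velocity_def using DERIV_imp_deriv[OF pt_has_real_derivative[OF z]] by (simp add: f)
  show "velocity chart2 (\<lambda>t. emb (pt (z t))) t = pt (z' t)" by (rule vel)
  have "continuous_on UNIV (\<lambda>t. pt (z t))"
  proof (rule continuous_on_coordinatewise_then_product)
    show "continuous_on UNIV (\<lambda>t. pt (z t) k)" for k
      by (rule DERIV_continuous_on[OF pt_has_real_derivative[OF has_vector_derivative_at_within[OF z]]])
  qed
  from continuous_on_compose2[OF emb_cont this subset_UNIV]
  have cont: "continuous_on UNIV (\<lambda>t. emb (pt (z t)))" .
  have acc: "((\<lambda>s. pt (z' s) k) has_real_derivative
      - (\<Sum>i<2. \<Sum>j<2. christoffel SM chart2 k i j (pt (z t)) * pt (z' t) i * pt (z' t) j)) (at t)" if "k < 2" for k t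
  proof -
    have "pt (z t) 1 = Im (z t)" by (simp add: pt_def)
    then have "(\<Sum>i<2. \<Sum>j<2. christoffel SM chart2 k i j (pt (z t)) * pt (z' t) i * pt (z' t) j)
        = pt (\<i> * z' t * z' t / of_real (Im (z t))) k"
      by (simp only: christoffel_half_plane_sum[OF hp that] zc_pt)
    moreover have "- pt w k = pt (- w) k" for w by (simp add: pt_def)
    ultimately show ?thesis using pt_has_real_derivative[OF z'] by simp
  qed
  have "(\<lambda>s. pt (z s) k) field_differentiable at t" for k t
    using pt_has_real_derivative[OF z[of t]] by (auto simp: field_differentiable_def)
  moreover have "continuous_map (top_of_set UNIV) (top_of_set (emb ` half_plane)) (\<lambda>t. emb (pt (z t)))"
    using cont hp by (auto simp: continuous_map_in_subtopology)
  ultimately show "geodesic SM UNIV (\<lambda>t. emb (pt (z t)))"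
    using acc unfolding geodesic_def by (simp add: f vel)
qed

lemma vertical_geodesic:
  fixes x y c :: real
  assumes y: "y > 0"
  defines "z \<equiv> \<lambda>t. Complex x (y * exp (c * t))"
  defines "z' \<equiv> \<lambda>t. Complex 0 (c * y * exp (c * t))"
  shows "(z has_vector_derivative z' t) (at t)"
    "(z' has_vector_derivative - (\<i> * z' t * z' t / of_real (Im (z t)))) (at t)" "Im (z t) > 0"
proof -
  show "(z has_vector_derivative z' t) (at t)"
    unfolding z_def z'_def has_vector_derivative_complex_iff by (auto intro!: derivative_eq_intros)
  have "- (\<i> * z' t * z' t / of_real (Im (z t))) = Complex 0 (c * c * y * exp (c * t))"
    using y by (simp add: z_def z'_def complex_eq_iff)
  moreover have "(z' has_vector_derivative Complex 0 (c * c * y * exp (c * t))) (at t)"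
    unfolding z'_def has_vector_derivative_complex_iff by (auto intro!: derivative_eq_intros)
  ultimately show "(z' has_vector_derivative - (\<i> * z' t * z' t / of_real (Im (z t)))) (at t)"
    by simp
  show "Im (z t) > 0" using y by (simp add: z_def)
qed

text \<open>The semicircle with centre a and radius R on the real axis, parametrised by tanh and 1 /
  cosh. Here c is the signed speed for y^-2 |dz|^2 and d the initial phase.\<close>

lemma circular_geodesic:
  fixes a R c d :: real
  assumes R: "R > 0"
  defines "C \<equiv> \<lambda>t. cosh (c * t + d)" and "S \<equiv> \<lambda>t. sinh (c * t + d)"
  defines "z \<equiv> \<lambda>t. Complex (a + R * (S t / C t)) (R / C t)"
  defines "z' \<equiv> \<lambda>t. Complex (c * R / (C t)\<^sup>2) (- (c * R * S t / (C t)\<^sup>2))"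
  shows "(z has_vector_derivative z' t) (at t)"
    "(z' has_vector_derivative - (\<i> * z' t * z' t / of_real (Im (z t)))) (at t)" "Im (z t) > 0"
proof -
  have C: "C t > 0" for t by (simp add: C_def cosh_real_pos)
  have CS: "(C t)\<^sup>2 = (S t)\<^sup>2 + 1" for t by (simp add: C_def S_def cosh_square_eq)
  have dC: "(C has_real_derivative c * S t) (at t)" and dS: "(S has_real_derivative c * C t) (at t)" for t
    unfolding C_def S_def by (auto intro!: derivative_eq_intros)
  show "Im (z t) > 0" using R C by (simp add: z_def)
  have C0: "C t \<noteq> 0" for t using C[of t] by simp
  have "((\<lambda>t. a + R * (S t / C t)) has_real_derivative R * ((c * C t * C t - S t * (c * S t)) / (C t * C t))) (at t)"
    by (auto intro!: derivative_eq_intros dC dS C0 simp: algebra_simps)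
  moreover have "R * ((c * C t * C t - S t * (c * S t)) / (C t * C t)) = c * R / (C t)\<^sup>2"
  proof -
    have "c * C t * C t - S t * (c * S t) = c * ((C t)\<^sup>2 - (S t)\<^sup>2)" by (simp add: power2_eq_square algebra_simps)
    also have "\<dots> = c" by (simp add: CS)
    finally show ?thesis by (simp add: power2_eq_square)
  qed
  moreover have "((\<lambda>t. R / C t) has_real_derivative - (c * R * S t / (C t)\<^sup>2)) (at t)"
    by (auto intro!: derivative_eq_intros dC C0 simp: power2_eq_square)
  ultimately show "(z has_vector_derivative z' t) (at t)"
    unfolding z_def z'_def has_vector_derivative_complex_iff by simp
  have "((\<lambda>t. c * R / (C t)\<^sup>2) has_real_derivative - (2 * c\<^sup>2 * R * S t / (C t) ^ 3)) (at t)"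
    using C0[of t] by (auto intro!: derivative_eq_intros dC simp: power2_eq_square power3_eq_cube field_simps)
  moreover have "((\<lambda>t. - (c * R * S t / (C t)\<^sup>2)) has_real_derivative - (c\<^sup>2 * R * ((C t)\<^sup>2 - 2 * (S t)\<^sup>2) / (C t) ^ 3)) (at t)"
    using C0[of t] by (auto intro!: derivative_eq_intros dC dS simp: power2_eq_square power3_eq_cube field_simps)
  moreover have "- (\<i> * z' t * z' t / of_real (Im (z t))) = Complex (- (2 * c\<^sup>2 * R * S t / (C t) ^ 3)) (- (c\<^sup>2 * R * ((C t)\<^sup>2 - 2 * (S t)\<^sup>2) / (C t) ^ 3))"
  proof -
    have "(C t)\<^sup>2 - 2 * (S t)\<^sup>2 = 1 - (S t)\<^sup>2" by (simp add: CS)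
    moreover have "Re (- (\<i> * z' t * z' t / of_real (Im (z t)))) = - (2 * c\<^sup>2 * R * S t / (C t) ^ 3)"
      using C0[of t] R by (simp add: z_def z'_def power2_eq_square power3_eq_cube field_simps)
    moreover have "Im (- (\<i> * z' t * z' t / of_real (Im (z t)))) = - (c\<^sup>2 * R * (1 - (S t)\<^sup>2) / (C t) ^ 3)"
      using C0[of t] R by (simp add: z_def z'_def power2_eq_square power3_eq_cube field_simps)
    ultimately show ?thesis by (simp only: complex_eq_iff complex.sel)
  qed
  ultimately show "(z' has_vector_derivative - (\<i> * z' t * z' t / of_real (Im (z t)))) (at t)"
    unfolding z'_def by (simp only: has_vector_derivative_complex_iff complex.sel)
qed

lemma half_plane_geodesic_exists:
  assumes z0: "Im z0 > 0"
  shows "\<exists>z z'. (\<forall>t. (z has_vector_derivative z' t) (at t)) \<and>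
    (\<forall>t. (z' has_vector_derivative - (\<i> * z' t * z' t / of_real (Im (z t)))) (at t)) \<and>
    (\<forall>t. Im (z t) > 0) \<and> z 0 = z0 \<and> z' 0 = v"
proof (cases "Re v = 0")
  case True
  show ?thesis
    \<comment> \<open>The height y grows at rate c y, so the initial velocity forces c = Im v / Im
      z0; v = 0 gives a constant curve.\<close>
    by (rule exI, rule exI, intro conjI allI)
       (rule vertical_geodesic[OF z0, where x = "Re z0" and c = "Im v / Im z0"],
        rule vertical_geodesic[OF z0], rule vertical_geodesic[OF z0],
        use True z0 in \<open>simp_all add: complex_eq_iff\<close>)
next
  case False
  \<comment> \<open>The velocity has slope - sinh, which fixes d. The initial height R / cosh d then
    fixes R, the real part of the velocity fixes c, and the initial point fixes a.\<close>
  define d where "d = arsinh (- Im v / Re v)"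
  have s: "sinh d = - Im v / Re v" by (simp add: d_def)
  define h where "h = cosh d"
  have h: "h > 0" by (simp add: h_def cosh_real_pos)
  define R where "R = Im z0 * h"
  have R: "R > 0" using z0 h by (simp add: R_def)
  show ?thesis
    by (rule exI, rule exI, intro conjI allI)
       (rule circular_geodesic[OF R, where a = "Re z0 - R * (sinh d / h)" and d = d and c = "Re v * h / Im z0"],
        rule circular_geodesic[OF R], rule circular_geodesic[OF R],
        use False z0 h in \<open>simp_all add: complex_eq_iff h_def[symmetric] s R_def power2_eq_square\<close>)
qed

lemma half_plane_complete: "geodesically_complete SM"
  unfolding geodesically_complete_def
proof (intro ballI)
  fix c p v assume c: "c \<in> atlas SM" and p: "p \<in> fst c" and v: "v \<in> Rn (dimen SM)"
  have c: "c = chart2" using c by simp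
  obtain x where x: "x \<in> half_plane" "p = emb x" using p by (auto simp: c)
  have "Im (zc x) > 0" using x by (simp add: half_plane_def zc_def)
  from half_plane_geodesic_exists[OF this, of "zc v"]
  obtain z z' where z: "\<forall>t. (z has_vector_derivative z' t) (at t)"
    "\<forall>t. (z' has_vector_derivative - (\<i> * z' t * z' t / of_real (Im (z t)))) (at t)" "\<forall>t. Im (z t) > 0"
    "z 0 = zc x" "z' 0 = zc v"
    by (elim exE conjE)
  show "\<exists>\<gamma>. geodesic SM UNIV \<gamma> \<and> \<gamma> 0 = p \<and> velocity c \<gamma> 0 = v"
    using geodesic_halfplane[OF z(1,2,3)[rule_format]] v x
    by (intro exI[of _ "\<lambda>t. emb (pt (z t))"]) (simp add: c z(4,5) pt_zc half_plane_Rn)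
qed

lemma emb_connected: "connected_space (top_of_set (emb ` half_plane))"
proof (rule connected_space_segments)
  fix p q and t :: real assume p: "p \<in> emb ` half_plane" and q: "q \<in> emb ` half_plane" and t: "t \<in> {0..1}"
  obtain x y where x: "x \<in> half_plane" "p = emb x" and y: "y \<in> half_plane" "q = emb y"
    using p q by blast
  let ?g = "\<lambda>i. (1 - t) * x i + t * y i"
  have z: "zc ?g = of_real (1 - t) * zc x + of_real t * zc y"
    by (simp add: zc_def complex_eq_iff)
  have eq: "emb ?g = (\<lambda>i. (1 - t) * p i + t * q i)"
  proof
    fix i show "emb ?g i = (1 - t) * p i + t * q i"
      unfolding x(2) y(2) emb_def z disc_linear coords_add coords_of_real ..
  qed
  have "(1 - t) * x 1 + t * y 1 > 0"
    using x y t by (cases "t = 0") (auto simp: half_plane_def intro!: add_nonneg_pos)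
  then have "?g \<in> half_plane"
    using x y by (simp add: half_plane_def mem_Rn)
  from imageI[OF this, of emb] show "(\<lambda>i. (1 - t) * p i + t * q i) \<in> emb ` half_plane"
    unfolding eq .
qed

section \<open>Projection of the complex structure and the Kaehler angle\<close>

lemma tangent_emb:
  assumes "x \<in> half_plane"
  shows "tangent_subspace SM chart2 chart (emb x) = {coords (disc w) | w. True}"
proof -
  have "tangent_subspace SM chart2 chart (emb x) = emb ` Rn 2"
    unfolding tangent_subspace_def using assms by (simp add: emb_first_two half_plane_Rn emb_differential)
  also have "\<dots> = {coords (disc w) | w. True}"
  proof (intro equalityI subsetI)
    fix u assume "u \<in> {coords (disc w) | w. True}"
    then obtain w where "u = coords (disc w)" by blast
    then have "u = emb (pt w)" by (simp add: emb_def zc_pt)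
    then show "u \<in> emb ` Rn 2" using pt_Rn by blast
  qed (auto simp: emb_def)
  finally show ?thesis .
qed

lemma disc_eq_0: "disc w = 0 \<Longrightarrow> w = 0"
proof -
  assume "disc w = 0"
  then have "disc w 0 0 = 0" by simp
  then show "w = 0" using m by (simp add: disc_def bdiag_def)
qed

lemma mat_of_coords_diff: "mat_of (\<lambda>i. coords A i - coords B i) = A - B" if "A \<in> Mat" "B \<in> Mat"
  using that by (simp add: mat_of_diff mat_of_coords)

text \<open>The mean of m signs +1 and n - m signs -1: compared with \<open>disc\<close> of i a, the
  matrix i \<open>disc a\<close> agrees on the first m entries and is opposite on the
  others.\<close>

definition \<kappa> :: real where
  "\<kappa> = (2 * real m - real n) / real n"

text \<open>The difference has weight 1 - \<kappa> on the m holomorphic entries and 1 + \<kappa>,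
  with opposite sign, on the others. The inner products cancel exactly when m (1 - \<kappa>) = (n -
  m) (1 + \<kappa>).\<close>

lemma projection_orthogonal:
  assumes x: "x \<in> half_plane"
  shows "ip (emb x) (\<i> *\<^sub>C disc a - disc (of_real \<kappa> * \<i> * a)) (disc b) = 0"
proof -
  have nm: "real (n - m) = real n - real m" using m by simp
  have 1: "real m * (1 - \<kappa>) = (real n - real m) * (1 + \<kappa>)"
    using n_pos by (simp add: \<kappa>_def field_simps)
  have "\<i> *\<^sub>C disc a - disc (of_real \<kappa> * \<i> * a) = bdiag (of_real (1 - \<kappa>) * \<i> * a) (- (of_real (1 + \<kappa>) * \<i> * cnj a))"
    unfolding disc_def bdiag_simps by (rule arg_cong2[of _ _ _ _ bdiag]) (simp_all add: algebra_simps)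
  then have "ip (emb x) (\<i> *\<^sub>C disc a - disc (of_real \<kappa> * \<i> * a)) (disc b) = inverse (x 1 * x 1) *
      Re (of_nat m * (of_real (1 - \<kappa>) * \<i> * a * cnj b) + of_nat (n - m) * (- (of_real (1 + \<kappa>) * \<i> * cnj a) * cnj (- cnj b)))"
    unfolding disc_def[of b] by (simp only: ip_bdiag[OF x])
  also have "Re (of_nat m * (of_real (1 - \<kappa>) * \<i> * a * cnj b) + of_nat (n - m) * (- (of_real (1 + \<kappa>) * \<i> * cnj a) * cnj (- cnj b)))
      = (real m * (1 - \<kappa>) - (real n - real m) * (1 + \<kappa>)) * Re (\<i> * a * cnj b)"
    by (simp add: nm algebra_simps)
  also have "inverse (x 1 * x 1) * ((real m * (1 - \<kappa>) - (real n - real m) * (1 + \<kappa>)) * Re (\<i> * a * cnj b)) = 0"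
    unfolding 1 by simp
  finally show ?thesis .
qed

lemma orth_proj_emb:
  assumes x: "x \<in> half_plane"
  shows "orth_proj (inner_at M chart (emb x)) {coords (disc w) | w. True} (Jstd (coords (disc a))) = coords (disc (of_real \<kappa> * \<i> * a))"
proof -
  have ip: "inner_at M chart (emb x) (\<lambda>i. Jstd (coords (disc a)) i - coords (disc b) i) (coords (disc c)) = ip (emb x) (\<i> *\<^sub>C disc a - disc b) (disc c)" for b c
    unfolding inner_at_def onechart_simps bilin_gmet Jstd_coords[OF disc_Mat] by (simp add: mat_of_coords_diff mat_of_coords)
  show ?thesis
    unfolding orth_proj_def
  proof (rule the_equality)
    show "coords (disc (of_real \<kappa> * \<i> * a)) \<in> {coords (disc w) | w. True} \<and> (\<forall>v\<in>{coords (disc w) | w. True}.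
        inner_at M chart (emb x) (\<lambda>i. Jstd (coords (disc a)) i - coords (disc (of_real \<kappa> * \<i> * a)) i) v = 0)"
      using ip projection_orthogonal[OF x] by auto
    fix u assume u: "u \<in> {coords (disc w) | w. True} \<and> (\<forall>v\<in>{coords (disc w) | w. True}.
        inner_at M chart (emb x) (\<lambda>i. Jstd (coords (disc a)) i - u i) v = 0)"
    then obtain b where b: "u = coords (disc b)" by blast
    let ?k = "of_real \<kappa> * \<i> * a"
    have "coords (disc (?k - b)) \<in> {coords (disc w) | w. True}" by blast
    from bspec[OF conjunct2[OF u] this]
    have z: "ip (emb x) (\<i> *\<^sub>C disc a - disc b) (disc (?k - b)) = 0"
      unfolding b ip .
    \<comment> \<open>The difference of two candidates lies in the tangent plane and is orthogonal
      to it, so its length is 0. This gives the uniqueness behind \<open>THE\<close>.\<close>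
    have "ip (emb x) (disc (?k - b)) (disc (?k - b)) = ip (emb x) ((\<i> *\<^sub>C disc a - disc b) - (\<i> *\<^sub>C disc a - disc ?k)) (disc (?k - b))"
      by (simp add: disc_linear(3))
    also have "\<dots> = 0"
      unfolding ip_simps(3)[of _ "\<i> *\<^sub>C disc a - disc b"] z projection_orthogonal[OF x] by simp
    finally have "\<not> 0 < ip (emb x) (disc (?k - b)) (disc (?k - b))" by simp
    then have "disc (?k - b) = 0" using ip_pos[OF emb_dom[OF x] disc_Mat] by blast
    then have "?k - b = 0" by (rule disc_eq_0)
    then show "u = coords (disc ?k)" by (simp add: b)
  qed
qed

text \<open>The projection of J multiplies the complex parameter by \<kappa> i, so lengths scale by
  the same factor for every vector. Nonnegativity of \<kappa> places the arccos in
  [0, pi/2].\<close>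

lemma constant_angle:
  assumes "0 \<le> \<kappa>"
  shows "submanifold_constant_kaehler_angle SM M (arccos \<kappa>)"
  unfolding submanifold_constant_kaehler_angle_def
proof (intro ballI impI)
  fix p b c assume b: "b \<in> atlas SM" and c: "c \<in> atlas M" and p: "p \<in> fst b"
  have bc: "b = chart2" "c = chart" using b c by simp_all
  obtain x where x: "x \<in> half_plane" "p = emb x" using p by (auto simp: bc)
  have \<kappa>1: "\<kappa> \<le> 1" using m n_pos by (simp add: \<kappa>_def)
  have angle: "0 \<le> arccos \<kappa>" "arccos \<kappa> \<le> pi / 2" "cos (arccos \<kappa>) = \<kappa>"
    using assms \<kappa>1 arccos_le_pi2[OF assms \<kappa>1] by (simp_all add: arccos_lbound cos_arccos)
  have ip: "inner_at M chart (emb x) (coords (disc v)) (coords (disc w)) = real n * inverse (x 1 * x 1) * Re (v * cnj w)" for v w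
    unfolding inner_at_def onechart_simps bilin_gmet by (simp only: mat_of_coords disc_Mat ip_disc[OF x(1)])
  have "has_kaehler_angle (inner_at M chart (emb x)) Jstd {coords (disc w) | w. True} (coords (disc a)) (arccos \<kappa>)" for a
  proof -
    have "Re (of_real \<kappa> * \<i> * a * cnj (of_real \<kappa> * \<i> * a)) = \<kappa>\<^sup>2 * Re (a * cnj a)"
      by (simp add: power2_eq_square algebra_simps)
    then show ?thesis
      unfolding has_kaehler_angle_def orth_proj_emb[OF x(1)] ip using angle by (simp only: angle mult_ac simp_thms)
  qed
  then show "constant_kaehler_angle (inner_at M c (snd c p)) Jstd (tangent_subspace SM b c p) (arccos \<kappa>)"
    unfolding constant_kaehler_angle_def bc snd_conv x(2) tangent_emb[OF x(1)] by blast
qed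

lemma angle_mem: "0 \<le> \<kappa> \<Longrightarrow> arccos \<kappa> \<in> kaehler_angles"
proof -
  assume \<kappa>: "0 \<le> \<kappa>"
  have \<kappa>1: "\<kappa> \<le> 1" using m n_pos by (simp add: \<kappa>_def)
  show ?thesis
    unfolding kaehler_angles_def
  proof (intro CollectI conjI exI)
    show "0 \<le> arccos \<kappa>" "arccos \<kappa> \<le> pi / 2"
      using \<kappa> \<kappa>1 arccos_le_pi2[OF \<kappa> \<kappa>1] by (simp_all add: arccos_lbound)
    show "hermitian_symmetric_space M" by (rule hermitian_symmetric)
    show "irreducible_manifold M" by (rule irreducible)
    show "\<not> flat M" by (rule not_flat)
    show "totally_geodesic SM M" by (rule emb_totally_geodesic)
    show "connected_space (space_of SM)" using emb_connected by simp
    show "geodesically_complete SM" by (rule half_plane_complete)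
    show "submanifold_constant_kaehler_angle SM M (arccos \<kappa>)" by (rule constant_angle[OF \<kappa>])
  qed
qed

end

section \<open>Density of the angles with rational cosine\<close>

lemma arccos_rational_mem:
  assumes "0 < b" "a \<le> b"
  shows "arccos (real a / real b) \<in> kaehler_angles"
proof -
  \<comment> \<open>With n = 2 b and m = a + b, 2 m - n = 2 a, so \<kappa> = a / b.\<close>
  interpret tube_disc "2 * b" "a + b"
    by unfold_locales (use assms in auto)
  have "\<kappa> = real a / real b" using assms by (simp add: \<kappa>_def)
  then show ?thesis using angle_mem by simp
qed

theorem theoremB:
  shows "\<exists>D. D \<subseteq> kaehler_angles \<and> D \<subseteq> {0..pi/2} \<and>
           (top_of_set {0..pi/2}) closure_of D = {0..pi/2}"
proof -
  define D where "D = {arccos (real a / real b) | a b. 0 < b \<and> a \<le> b}"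
  have D1: "D \<subseteq> kaehler_angles" using arccos_rational_mem by (auto simp: D_def)
  have D2: "D \<subseteq> {0..pi/2}" using D1 by (auto simp: kaehler_angles_def)
  have "\<phi> \<in> closure D" if \<phi>: "\<phi> \<in> {0..pi/2}" for \<phi>
  proof -
    define r where "r = cos \<phi>"
    have r: "0 \<le> r" "r \<le> 1" "arccos r = \<phi>"
      using \<phi> by (simp_all add: r_def cos_ge_zero arccos_cos)
    \<comment> \<open>Rational approximation of r from below, with error at most 1 / (k + 1).
      Rounding down keeps the numerator at most k + 1, so the value stays among the admissible
      cosines.\<close>
    define f where "f = (\<lambda>k. real (nat \<lfloor>real (Suc k) * r\<rfloor>) / real (Suc k))"
    have fl: "real (nat \<lfloor>real (Suc k) * r\<rfloor>) = of_int \<lfloor>real (Suc k) * r\<rfloor>" for k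
      using r by (simp add: of_nat_nat)
    have ub: "f k \<le> r" for k
    proof -
      have "real (nat \<lfloor>real (Suc k) * r\<rfloor>) \<le> real (Suc k) * r" unfolding fl by (rule of_int_floor_le)
      then show ?thesis by (simp add: f_def divide_le_eq mult.commute)
    qed
    have lb: "r - 1 / real (Suc k) \<le> f k" for k
    proof -
      have "real (Suc k) * r - 1 \<le> real (nat \<lfloor>real (Suc k) * r\<rfloor>)" unfolding fl by linarith
      then have "(real (Suc k) * r - 1) / real (Suc k) \<le> f k"
        unfolding f_def by (rule divide_right_mono) simp
      then show ?thesis by (simp add: diff_divide_distrib del: of_nat_Suc)
    qed
    have "(\<lambda>k. r - 1 / real (Suc k)) \<longlonglongrightarrow> r - 0"
      by (intro tendsto_diff tendsto_const LIMSEQ_Suc[OF lim_1_over_n])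
    then have lim: "f \<longlonglongrightarrow> r"
      by (intro tendsto_sandwich[of "\<lambda>k. r - 1 / real (Suc k)" f sequentially "\<lambda>_. r"])
         (simp_all add: ub lb del: of_nat_Suc)
    have f01: "f k \<in> {-1..1}" for k
    proof -
      have "0 \<le> f k" by (simp add: f_def)
      then show ?thesis using ub[of k] r by auto
    qed
    have "(\<lambda>k. arccos (f k)) \<longlonglongrightarrow> arccos r"
      by (rule continuous_on_tendsto_compose[OF continuous_on_arccos' lim]) (use r f01 in auto)
    moreover have "arccos (f k) \<in> D" for k
    proof -
      have "real (nat \<lfloor>real (Suc k) * r\<rfloor>) \<le> real (Suc k)"
      proof -
        have "real (Suc k) * r \<le> real (Suc k)" using r by (simp add: mult_left_le)
        then show ?thesis unfolding fl using of_int_floor_le[of "real (Suc k) * r"] by linarith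
      qed
      then have "nat \<lfloor>real (Suc k) * r\<rfloor> \<le> Suc k" by (simp only: of_nat_le_iff)
      then show ?thesis unfolding D_def f_def by blast
    qed
    ultimately show ?thesis unfolding closure_sequential r(3) by (intro exI[of _ "\<lambda>k. arccos (f k)"] conjI allI)
  qed
  then have "(top_of_set {0..pi/2}) closure_of D = {0..pi/2}"
    using D2 by (auto simp: closure_of_subtopology Int_absorb1)
  then show ?thesis using D1 D2 by blast
qed

end
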